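(* Let $d\ge 1$, let $p>q>d/2$, and let $f_1(r)=r^{-p}$, $f_2(r)=r^{-q}$ for $r>0$. Then there exist $V_0>0$ and $V_1>0$, both depending only on $p,q,d$, such that the following holds. For all $0<V<V_0$, the charged lattice $(V^{1/d}\mathbb Z^d,\varphi_\pm)$ is the unique minimizer of $E_{f_1,f_2}$ in $\mathcal Q(V)$, i.e. $$E_{f_1,f_2}[V^{1/d}L,\varphi]\ \ge\ E_{f_1,f_2}[V^{1/d}\mathbb Z^d,\varphi_\pm]\qquad\text{for all } L\in\mathcal Q(1),\ N\in\mathbb N,\ \varphi\in\Lambda_N(V^{1/d}L),$$ with equality if and only if $N$ is even, $\varphi=\varphi_\pm$ and $L=\mathbb Z^d$ (up to a linear isometry of $\mathbb R^d$). Furthermore, for all $V>V_1$, $(V^{1/d}\mathbb Z^d,\varphi_\pm)$ is not a minimizer of $E_{f_1,f_2}$.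
   Context: A lattice in $\mathbb R^d$ is a set $L=\bigoplus_{i=1}^d\mathbb Z u_i$ for a basis $\{u_1,\dots,u_d\}$ of $\mathbb R^d$; its volume is $|\det(u_1,\dots,u_d)|$. $\mathcal Q(V)$ is the set of orthorhombic lattices of volume $V$, i.e. those lattices of volume $V$ that can be represented by an orthogonal basis; for such lattices $u_1,\dots,u_d$ denotes an orthogonal basis. For $N\in\mathbb N=\{1,2,\dots\}$, $K_N(L)=\{\sum_{i=1}^d m_iu_i: m_i\in\{0,\dots,N-1\}\}$, and $\Lambda_N(L)$ is the set of charge distributions $\varphi:L\to\mathbb R$ such that (i) $\varphi(x+Nu_i)=\varphi(x)$ for all $x\in L$ and $1\le i\le d$; (ii) $\varphi(0)>0$; (iii) $\sum_{x\in K_N(L)}\varphi(x)^2=N^d$. A charged lattice is a pair $(L,\varphi)$ consisting of a lattice $L$ and $\varphi\in\Lambda_N(L)$ for some $N\in\mathbb N$. The alternate distribution $\varphi_\pm\in\Lambda_2(L)$ is $\varphi_\pm(\sum_i m_iu_i)=+1$ if $\sum_i m_i$ is even and $-1$ otherwise. The energy $E_{f_1,f_2}$ is defined on all charged lattices $(L,\varphi)$ ($L$ an arbitrary lattice in $\mathbb R^d$): for $\varphi\in\Lambda_N(L)$, $$E_{f_1,f_2}[L,\varphi]=\sum_{z\in L\setminus\{0\}}f_1(|z|^2)+\frac1{N^d}\sum_{z\in L\setminus\{0\}}\ \sum_{x\in K_N(L)}\varphi(x)\varphi(x+z)\,f_2(|z|^2).$$ *)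

theory Defs
  imports "HOL-Analysis.Analysis"
begin

text \<open>
  The dimension is \<open>d = CARD('n)\<close>. The cell \<open>K\<^sub>N\<close>, the charge distributions and the alternate
  distribution refer to a basis of the lattice and not only to the underlying point set, so these
  notions take the basis \<open>u\<close> as argument.
\<close>

definition lattice_basis :: "('n::finite \<Rightarrow> real ^ 'n) \<Rightarrow> bool" where
  "lattice_basis u \<longleftrightarrow> inj u \<and> independent (range u) \<and> span (range u) = UNIV"

definition orthogonal_basis :: "('n::finite \<Rightarrow> real ^ 'n) \<Rightarrow> bool" where
  "orthogonal_basis u \<longleftrightarrow> lattice_basis u \<and> (\<forall>i j. i \<noteq> j \<longrightarrow> orthogonal (u i) (u j))"

definition lattice_point :: "('n::finite \<Rightarrow> real ^ 'n) \<Rightarrow> ('n \<Rightarrow> int) \<Rightarrow> real ^ 'n" where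
  "lattice_point u m = (\<Sum>i\<in>UNIV. of_int (m i) *\<^sub>R u i)"

definition lattice :: "('n::finite \<Rightarrow> real ^ 'n) \<Rightarrow> (real ^ 'n) set" where
  "lattice u = range (lattice_point u)"

definition volume :: "('n::finite \<Rightarrow> real ^ 'n) \<Rightarrow> real" where
  "volume u = \<bar>det (\<chi> i. u i)\<bar>"

definition orthorhombic :: "real \<Rightarrow> (real ^ 'n::finite) set set" where
  "orthorhombic V = {L. \<exists>u. orthogonal_basis u \<and> L = lattice u \<and> volume u = V}"

definition scale_basis :: "real \<Rightarrow> ('n::finite \<Rightarrow> real ^ 'n) \<Rightarrow> ('n \<Rightarrow> real ^ 'n)" where
  "scale_basis c u = (\<lambda>i. c *\<^sub>R u i)"

definition std_basis :: "'n::finite \<Rightarrow> real ^ 'n" where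
  "std_basis i = axis i 1"

definition period_cell :: "nat \<Rightarrow> ('n::finite \<Rightarrow> real ^ 'n) \<Rightarrow> (real ^ 'n) set" where
  "period_cell N u = lattice_point u ` {m. \<forall>i. 0 \<le> m i \<and> m i < int N}"

text \<open>
  A charge distribution is represented by a function on the whole space of which only the values on
  \<open>lattice u\<close> matter; equality of charge distributions is equality on \<open>lattice u\<close>.
\<close>

definition charge_distributions ::
  "nat \<Rightarrow> ('n::finite \<Rightarrow> real ^ 'n) \<Rightarrow> (real ^ 'n \<Rightarrow> real) set" where
  "charge_distributions N u =
     {\<phi>. (\<forall>x\<in>lattice u. \<forall>i. \<phi> (x + real N *\<^sub>R u i) = \<phi> x) \<and>
          \<phi> 0 > 0 \<and>
          (\<Sum>x\<in>period_cell N u. (\<phi> x)\<^sup>2) = real N ^ CARD('n)}"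

text \<open>For a basis \<open>u\<close> the coordinates \<open>m\<close> of a lattice point are unique.\<close>

definition alternate :: "('n::finite \<Rightarrow> real ^ 'n) \<Rightarrow> real ^ 'n \<Rightarrow> real" where
  "alternate u x = (if \<exists>m. x = lattice_point u m \<and> even (\<Sum>i\<in>UNIV. m i) then 1 else - 1)"

definition energy ::
  "(real \<Rightarrow> real) \<Rightarrow> (real \<Rightarrow> real) \<Rightarrow> nat \<Rightarrow> ('n::finite \<Rightarrow> real ^ 'n) \<Rightarrow> (real ^ 'n \<Rightarrow> real) \<Rightarrow> real"
where
  "energy f1 f2 N u \<phi> =
     (\<Sum>\<^sub>\<infinity>z\<in>lattice u - {0}. f1 ((norm z)\<^sup>2)) +
     1 / real N ^ CARD('n) *
       (\<Sum>\<^sub>\<infinity>z\<in>lattice u - {0}. \<Sum>x\<in>period_cell N u. \<phi> x * \<phi> (x + z) * f2 ((norm z)\<^sup>2))"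

end

theory Submission
  imports Defs "HOL-Library.Function_Algebras" "HOL-Real_Asymp.Real_Asymp"
begin

text \<open>
  Since \<open>x powr (- q)\<close> is a mixture of the functions \<open>exp (- s x)\<close>, sums over an orthorhombic lattice
  reduce to products of one-dimensional Gaussian sums.

  Charges: the autocorrelation \<open>C\<close> of a charge distribution is positive definite. By the finite form of
  Jacobi's triple product, convolution with \<open>exp (- s k\<^sup>2)\<close> is a limit of products of operators
  \<open>(1 + r S) (1 + r S\<^sup>*)\<close>, with \<open>S\<close> a shift, and each of these is at least \<open>(1 - r)\<^sup>2\<close>, the value on
  which \<open>S = - 1\<close>. So the alternate distribution minimizes, and equality forces \<open>S = - 1\<close> for every shift.

  Lattices: the functional equation of the theta function makes \<open>ln (theta3 (exp t))\<close> convex, hence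
  the sum \<open>F\<close> for \<open>f1\<close> exceeds its value at the cubic lattice by at least a multiple of
  \<open>\<Sum> min 1 (t\<^sub>i\<^sup>2)\<close>, where \<open>t\<^sub>i = 2 ln a\<^sub>i\<close> for edge lengths \<open>a\<^sub>i\<close> of product 1. The alternating sum \<open>G\<close>
  for \<open>f2\<close> may be below its cubic value, but only by a multiple of \<open>\<Sum> t\<^sub>i\<^sup>2\<close> near the cubic lattice
  (the linear term vanishes by symmetry) and of \<open>1 + F\<close> elsewhere. The factor in front of \<open>F\<close> dominates for
  small volumes. For large volumes the energy of the cubic lattice tends to 0, whereas lattices with one
  short edge of suitable fixed length have energy below a fixed negative number.
\<close>

section \<open>Positive definite functions and the finite triple product\<close>

text \<open>The two unknowns separate: on a fixed orthorhombic lattice the alternate charges are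
  optimal at every volume, so that only sums with alternating weights remain to be compared. By
  homogeneity the two parts of the energy then scale like \<open>V powr (- 2 * p / d)\<close> and
  \<open>V powr (- 2 * q / d)\<close>, and \<open>p > q\<close> decides which of them prevails. The
  triple product enters in finite form because its factors are finite combinations of translations.
  Inequalities between kernels can then be kept as inequalities between quadratic forms; these
  survive further factors, the limit and further axes, and no Fourier analysis on the charge side is
  required. The functional equation enters because the series of \<open>theta3\<close> gives usable
  estimates only for large arguments. They hold from 3 on, just below the fixed point
  \<open>pi\<close> of the equation, and reflection covers the rest. Strictness always comes from a
  margin on one unit interval of the mixing parameter \<open>s\<close>, together with nonnegativity
  of the integrand everywhere else.\<close>

lemma dominated_convergence_infsum:
  fixes f :: "nat \<Rightarrow> 'i \<Rightarrow> real"
  assumes M: "M summable_on A" and bound: "\<And>n i. i \<in> A \<Longrightarrow> \<bar>f n i\<bar> \<le> M i"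
    and lim: "\<And>i. i \<in> A \<Longrightarrow> (\<lambda>n. f n i) \<longlonglongrightarrow> g i"
  shows "(\<lambda>n. infsum (f n) A) \<longlonglongrightarrow> infsum g A"
proof -
  have gM: "\<bar>g i\<bar> \<le> M i" if "i \<in> A" for i
    using lim[OF that] bound[OF that] by (intro LIMSEQ_le_const2[OF tendsto_rabs[OF lim[OF that]]]) auto
  have abs: "(\<lambda>i. norm (h i)) summable_on A" if "\<And>i. i \<in> A \<Longrightarrow> \<bar>h i\<bar> \<le> M i" for h :: "'i \<Rightarrow> real"
    using summable_on_comparison_test[OF M, of "\<lambda>i. norm (h i)"] that by auto
  \<comment> \<open>Dominated unordered sums are integrals against counting measure, which reduces
    the claim to Lebesgue's theorem.\<close>
  have eq: "infsum h A = (\<integral>i. h i \<partial>count_space A)" if "\<And>i. i \<in> A \<Longrightarrow> \<bar>h i\<bar> \<le> M i" for h :: "'i \<Rightarrow> real"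
    using infsetsum_infsum[of h A] abs[OF that] abs_summable_equivalent[of h A]
    unfolding infsetsum_def by auto
  have "integrable (count_space A) M"
    using M summable_on_iff_abs_summable_on_real[of M A] abs_summable_equivalent[of M A]
    unfolding Infinite_Set_Sum.abs_summable_on_def by simp
  then have "(\<lambda>n. \<integral>i. f n i \<partial>count_space A) \<longlonglongrightarrow> (\<integral>i. g i \<partial>count_space A)"
    by (intro integral_dominated_convergence[where w=M]) (use bound lim in \<open>auto simp: AE_count_space\<close>)
  then show ?thesis
    using eq[of g] eq[of "f _"] gM bound by simp
qed

definition pos_def :: "('a::ab_group_add \<Rightarrow> real) \<Rightarrow> bool" where
  "pos_def C \<longleftrightarrow> (\<forall>A v. finite A \<longrightarrow> 0 \<le> (\<Sum>x\<in>A. \<Sum>y\<in>A. v x * v y * C (x - y)))"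

text \<open>Comparisons of kernels are carried along as \<open>pos_def\<close> of a difference,
  which is stable under smearing and limits; only at the end are they evaluated at the origin, by
  this lemma.\<close>

lemma pos_def_zero: "pos_def C \<Longrightarrow> 0 \<le> C 0"
  unfolding pos_def_def by (elim allE[of _ "{0}"] allE[of _ "\<lambda>_. 1"]) simp

lemma pos_def_add: "pos_def C \<Longrightarrow> pos_def D \<Longrightarrow> pos_def (\<lambda>x. C x + D x)"
  unfolding pos_def_def by (simp add: distrib_left sum.distrib)

lemma pos_def_scale: "pos_def C \<Longrightarrow> 0 \<le> a \<Longrightarrow> pos_def (\<lambda>x. a * C x)"
  unfolding pos_def_def
proof (intro allI impI)
  fix A v assume "\<forall>A v. finite A \<longrightarrow> 0 \<le> (\<Sum>x\<in>A. \<Sum>y\<in>A. v x * v y * C (x - y))" "0 \<le> a" "finite (A::'a set)"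
  then have "0 \<le> a * (\<Sum>x\<in>A. \<Sum>y\<in>A. v x * v y * C (x - y))" by simp
  then show "0 \<le> (\<Sum>x\<in>A. \<Sum>y\<in>A. v x * v y * (a * C (x - y)))"
    by (simp add: sum_distrib_left mult_ac)
qed

lemma pos_def_lim:
  assumes "\<And>n. pos_def (C n)" "\<And>x. (\<lambda>n. C n x) \<longlonglongrightarrow> D x"
  shows "pos_def D"
  unfolding pos_def_def
proof (intro allI impI)
  fix A v assume "finite (A::'a set)"
  then show "0 \<le> (\<Sum>x\<in>A. \<Sum>y\<in>A. v x * v y * D (x - y))"
    using assms(1) unfolding pos_def_def
    by (intro LIMSEQ_le_const[where X="\<lambda>n. \<Sum>x\<in>A. \<Sum>y\<in>A. v x * v y * C n (x - y)"])
      (auto intro!: tendsto_intros assms(2))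
qed

text \<open>With \<open>z\<close> standing for translation by \<open>e\<close>, this is the action
  of the Laurent polynomial \<open>(1 + r * z) * (1 + r / z)\<close>.\<close>

definition smear :: "real \<Rightarrow> 'a::ab_group_add \<Rightarrow> ('a \<Rightarrow> real) \<Rightarrow> 'a \<Rightarrow> real" where
  "smear r e C x = (1 + r\<^sup>2) * C x + r * C (x + e) + r * C (x - e)"

text \<open>As Laurent polynomials, \<open>(1 + r * z) * (1 + r / z) = (1 - r)\<^sup>2 + r * ((1 +
  z) * (1 + 1 / z))\<close>. For \<open>r \<ge> 0\<close> the second term preserves positive
  definiteness, and it vanishes at \<open>z = - 1\<close>.\<close>

lemma smear_split: "smear r e C x = (1 - r)\<^sup>2 * C x + r * smear 1 e C x"
  unfolding smear_def by (simp add: power2_eq_square algebra_simps)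

text \<open>If \<open>C\<close> is the kernel of a quadratic form in \<open>v\<close>, then \<open>smear r e C\<close> is its kernel in
  \<open>v + r \<cdot> v (\<cdot> - e)\<close>.\<close>

lemma pos_def_smear:
  assumes "pos_def C" shows "pos_def (smear r e C)"
  unfolding pos_def_def
proof (intro allI impI)
  fix A v assume A: "finite (A::'a set)"
  define B where "B = A \<union> (\<lambda>x. x + e) ` A"
  define w where "w x = (if x \<in> A then v x else 0) + r * (if x - e \<in> A then v (x - e) else 0)" for x
  have B: "finite B" using A by (simp add: B_def)
  \<comment> \<open>Moves the smearing from \<open>w\<close> to the function it is paired with; one
    application in each argument of the form yields the kernel \<open>smear r e C\<close>.\<close>
  have lin: "(\<Sum>x\<in>B. w x * g x) = (\<Sum>x\<in>A. v x * (g x + r * g (x + e)))" for g :: "'a \<Rightarrow> real"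
  proof -
    have "(\<Sum>x\<in>B. (if x \<in> A then v x else 0) * g x) = (\<Sum>x\<in>A. v x * g x)"
      using B by (intro sum.mono_neutral_cong_right) (auto simp: B_def)
    moreover have "(\<lambda>x. x + e) ` A = {x. x - e \<in> A}" by force
    then have "(\<Sum>x\<in>B. (if x - e \<in> A then v (x - e) else 0) * g x) = (\<Sum>x\<in>(\<lambda>x. x + e) ` A. v (x - e) * g x)"
      using B by (intro sum.mono_neutral_cong_right) (auto simp: B_def)
    moreover have "\<dots> = (\<Sum>x\<in>A. v x * g (x + e))"
      by (subst sum.reindex) (auto simp: inj_on_def)
    moreover have "(\<Sum>x\<in>B. w x * g x) = (\<Sum>x\<in>B. (if x \<in> A then v x else 0) * g x)
        + r * (\<Sum>x\<in>B. (if x - e \<in> A then v (x - e) else 0) * g x)"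
      by (simp add: w_def distrib_right sum.distrib sum_distrib_left mult.assoc)
    moreover have "(\<Sum>x\<in>A. v x * (g x + r * g (x + e))) = (\<Sum>x\<in>A. v x * g x) + r * (\<Sum>x\<in>A. v x * g (x + e))"
      by (simp add: distrib_left sum.distrib sum_distrib_left mult.left_commute)
    ultimately show ?thesis by simp
  qed
  have "0 \<le> (\<Sum>x\<in>B. \<Sum>y\<in>B. w x * w y * C (x - y))"
    using assms B unfolding pos_def_def by auto
  also have "\<dots> = (\<Sum>x\<in>B. w x * (\<Sum>y\<in>B. w y * C (x - y)))"
    by (simp add: sum_distrib_left mult_ac)
  also have "\<dots> = (\<Sum>x\<in>A. v x * ((\<Sum>y\<in>A. v y * (C (x - y) + r * C (x - (y + e))))
      + r * (\<Sum>y\<in>A. v y * (C (x + e - y) + r * C (x + e - (y + e))))))"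
    by (simp only: lin)
  also have "\<dots> = (\<Sum>x\<in>A. \<Sum>y\<in>A. v x * v y * smear r e C (x - y))"
    unfolding smear_def sum_distrib_left
    by (simp add: sum_distrib_left sum.distrib[symmetric] algebra_simps power2_eq_square)
  finally show "0 \<le> (\<Sum>x\<in>A. \<Sum>y\<in>A. v x * v y * smear r e C (x - y))" .
qed

text \<open>\<open>tri q n k\<close> is the coefficient of \<open>z\<^sup>k\<close> in \<open>\<Prod>j<n. (1 + q ^ (2 * j + 1) * z) * (1 + q ^ (2 * j + 1) / z)\<close>,
  divided by the constant coefficient \<open>\<Prod>j<n. tri_norm q j\<close>. Because of the truncated subtraction it vanishes
  for \<open>k > n\<close>.\<close>

definition tri :: "real \<Rightarrow> nat \<Rightarrow> nat \<Rightarrow> real" where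
  "tri q n k = q ^ (k * k) * (\<Prod>l<k. (1 - (q\<^sup>2) ^ (n - l)) / (1 - (q\<^sup>2) ^ (n + 1 + l)))"

lemma tri_0 [simp]: "tri q n 0 = 1" by (simp add: tri_def)

lemma tri_Suc: "tri q n (Suc k) = tri q n k * q ^ (2 * k + 1) * ((1 - (q\<^sup>2) ^ (n - k)) / (1 - (q\<^sup>2) ^ (n + 1 + k)))"
proof -
  have "Suc k * Suc k = k * k + (2 * k + 1)" by simp
  then have "q ^ (Suc k * Suc k) = q ^ (k * k) * q ^ (2 * k + 1)"
    by (simp only: power_add)
  then show ?thesis by (simp only: tri_def prod.lessThan_Suc mult_ac)
qed

lemma tri_eq_0: "k > n \<Longrightarrow> tri q n k = 0"
  unfolding tri_def by (subst prod_zero[where A="{..<k}"]) (auto intro!: bexI[of _ n])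

text \<open>Together with \<open>tri_Suc\<close> this expresses all coefficients in the recurrence
  between rows \<open>n\<close> and \<open>n + 1\<close> as rational multiples of the single value
  \<open>tri q n j\<close>.\<close>

lemma tri_Suc_Suc:
  assumes "0 < q" "q < 1"
  shows "tri q (Suc n) (Suc j) = tri q n j * q ^ (2 * j + 1) * (1 - (q\<^sup>2) ^ (n + 1))\<^sup>2 /
    ((1 - (q\<^sup>2) ^ (n + 1 + j)) * (1 - (q\<^sup>2) ^ (n + 2 + j)))"
proof (induction j)
  have x: "0 < q\<^sup>2" "q\<^sup>2 < 1" using assms by (auto simp: power_less_one_iff)
  have ne: "(q\<^sup>2) ^ Suc k \<noteq> 1" for k using x by (metis power_Suc_less_one less_irrefl)
  {
    case 0 show ?case using ne[of n] ne[of "Suc n"] by (simp add: tri_Suc power2_eq_square)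
  next
    case (Suc j)
    show ?case
      using ne[of "n+j"] ne[of "Suc (n + j)"] ne[of "Suc (Suc (n + j))"]
      by (subst tri_Suc, subst Suc.IH, simp only: tri_Suc[of q n j])
        (simp add: divide_simps power2_eq_square)
  }
qed

text \<open>The constant coefficient is the Gaussian binomial "2n choose n" in base
  \<open>q\<^sup>2\<close>. This is the quotient of two consecutive ones, with one factor
  \<open>1 - (q\<^sup>2) ^ (n + 1)\<close> cancelled.\<close>

definition tri_norm :: "real \<Rightarrow> nat \<Rightarrow> real" where
  "tri_norm q n = (1 + (q\<^sup>2) ^ (n + 1)) * (1 - (q\<^sup>2) ^ (2 * n + 1)) / (1 - (q\<^sup>2) ^ (n + 1))"

lemma tri_rec_0:
  assumes "0 < q" "q < 1"
  shows "tri_norm q n = 1 + (q ^ (2 * n + 1))\<^sup>2 + 2 * q ^ (2 * n + 1) * tri q n 1"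
proof -
  have x: "0 < q\<^sup>2" "q\<^sup>2 < 1" using assms by (auto simp: power_less_one_iff)
  have ne: "(q\<^sup>2) ^ Suc k \<noteq> 1" for k using x by (metis power_Suc_less_one less_irrefl)
  define y where "y = (q\<^sup>2) ^ n"
  have e: "(q\<^sup>2) ^ (n + 1) = y * q\<^sup>2" "(q\<^sup>2) ^ (2 * n + 1) = y * y * q\<^sup>2" "q ^ (2 * n + 1) = y * q"
    by (simp_all add: y_def power_add[symmetric] power_mult[symmetric] mult_2 power_mult_distrib[symmetric])
  have "1 - y * q\<^sup>2 \<noteq> 0" using ne[of n] e(1)[unfolded Suc_eq_plus1[symmetric]] by (metis eq_iff_diff_eq_0)
  moreover have t: "tri q n 1 = q * ((1 - y) / (1 - y * q\<^sup>2))"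
    using tri_Suc[of q n 0, unfolded add_0_right e(1)] by (simp add: y_def)
  ultimately show ?thesis
    unfolding tri_norm_def e t by (simp add: divide_simps) (simp add: power2_eq_square algebra_simps)
qed

text \<open>Comparison of the coefficients of \<open>z ^ (j + 1)\<close> when the factor with
  \<open>r = q ^ (2 * n + 1)\<close> joins the product.\<close>

lemma tri_rec_Suc:
  assumes "0 < q" "q < 1"
  shows "tri_norm q n * tri q (Suc n) (Suc j) = (1 + (q ^ (2 * n + 1))\<^sup>2) * tri q n (Suc j)
     + q ^ (2 * n + 1) * (tri q n j + tri q n (Suc (Suc j)))"
proof -
  have x: "0 < q\<^sup>2" "q\<^sup>2 < 1" using assms by (auto simp: power_less_one_iff)
  have ne: "(q\<^sup>2) ^ Suc k \<noteq> 1" for k using x by (metis power_Suc_less_one less_irrefl)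
  \<comment> \<open>The exponents \<open>n - j\<close> and \<open>n - Suc j\<close> are truncated.
    In the generic case, writing \<open>n = j + 1 + m\<close> makes all exponents sums, and the
    claim becomes an identity between rational functions of \<open>a\<close>, \<open>b\<close> and
    \<open>q\<close>.\<close>
  consider "j > n" | "j = n" | m where "n = j + 1 + m"
    by (metis Suc_eq_plus1 add.commute add.left_commute less_imp_add_positive linorder_neqE_nat less_iff_Suc_add)
  then show ?thesis
  proof cases
    case 1 then show ?thesis using assms by (simp add: tri_Suc_Suc tri_eq_0)
  next
    case 2
    define y where "y = (q\<^sup>2) ^ n"
    have e: "(q\<^sup>2) ^ (n + 1) = y * q\<^sup>2" "(q\<^sup>2) ^ (2 * n + 1) = y * y * q\<^sup>2" "q ^ (2 * n + 1) = y * q"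
      "(q\<^sup>2) ^ (n + 1 + n) = y * y * q\<^sup>2" "(q\<^sup>2) ^ (n + 2 + n) = y * y * q\<^sup>2 * q\<^sup>2"
      by (simp_all add: y_def power_add[symmetric] power_mult[symmetric] mult_2 power_mult_distrib[symmetric])
    have "1 - y * q\<^sup>2 \<noteq> 0" using ne[of n] e(1)[unfolded Suc_eq_plus1[symmetric]] by (metis eq_iff_diff_eq_0)
    moreover have "1 - y * y * q\<^sup>2 \<noteq> 0" using ne[of "2 * n"] e(2)[unfolded Suc_eq_plus1[symmetric]] by (metis eq_iff_diff_eq_0)
    moreover have "1 - y * y * q\<^sup>2 * q\<^sup>2 \<noteq> 0" using ne[of "Suc (2 * n)"] e(5) by (simp add: mult_2)
    ultimately show ?thesis
      using assms unfolding 2 tri_Suc_Suc[OF assms] tri_norm_def e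
      by (simp add: tri_eq_0 divide_simps) (simp add: power2_eq_square algebra_simps)
  next
    case 3
    define a where "a = (q\<^sup>2) ^ j"
    define b where "b = (q\<^sup>2) ^ m"
    define X where "X = q\<^sup>2"
    have e: "(q\<^sup>2) ^ (n + 1) = a * b * X * X" "(q\<^sup>2) ^ (2 * n + 1) = a * a * b * b * X * X * X" "q ^ (2 * n + 1) = a * b * X * q"
      "(q\<^sup>2) ^ (n + 1 + j) = a * a * b * X * X" "(q\<^sup>2) ^ (n + 2 + j) = a * a * b * X * X * X"
      "(q\<^sup>2) ^ (n + 1 + Suc j) = a * a * b * X * X * X"
      "(q\<^sup>2) ^ (n - j) = b * X" "(q\<^sup>2) ^ (n - Suc j) = b" "q ^ (2 * j + 1) = a * q" "q ^ (2 * Suc j + 1) = a * X * q"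
      by (simp_all add: 3 a_def b_def X_def power_add power_mult power2_eq_square power_mult_distrib mult_ac)
    have "1 - a * a * b * X * X \<noteq> 0" using ne[of "n + j"] e(4) by simp
    moreover have "1 - a * a * b * X * X * X \<noteq> 0" using ne[of "Suc (n + j)"] e(5) by simp
    moreover have "1 - a * b * X * X \<noteq> 0" using ne[of n] e(1) by simp
    moreover have t1: "tri q n (Suc j) = tri q n j * (a * q) * ((1 - b * X) / (1 - a * a * b * X * X))"
      unfolding tri_Suc e ..
    moreover have t2: "tri q n (Suc (Suc j)) = tri q n j * (a * q) * ((1 - b * X) / (1 - a * a * b * X * X))
       * (a * X * q) * ((1 - b) / (1 - a * a * b * X * X * X))"
      by (subst tri_Suc) (simp only: t1 e)
    have X: "q * (q * z) = X * z" for z by (simp add: X_def power2_eq_square)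
    show ?thesis
      using calculation(1-3) unfolding tri_Suc_Suc[OF assms] tri_norm_def t1 t2 e
      by (simp add: divide_simps) (simp add: power2_eq_square algebra_simps X)
  qed
qed

section \<open>Convolution with the finite triple product\<close>

text \<open>The additive map \<open>h\<close> lays the integers along a line in the group, so that a
  one-dimensional product can act on functions of several integer variables.\<close>

definition tri_conv :: "real \<Rightarrow> nat \<Rightarrow> (int \<Rightarrow> 'a::ab_group_add) \<Rightarrow> ('a \<Rightarrow> real) \<Rightarrow> 'a \<Rightarrow> real" where
  "tri_conv q n h C x = (\<Sum>k\<in>{- int n..int n}. tri q n (nat \<bar>k\<bar>) * C (x + h k))"

text \<open>Brings a sum and its two translates to one common index range; the coefficients that the
  wider range adds are 0.\<close>

lemma sum_int_shift:
  fixes t g :: "int \<Rightarrow> real"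
  assumes "\<And>k. \<bar>k\<bar> > int n \<Longrightarrow> t k = 0" and "d \<in> {-1, 0, 1}"
  shows "(\<Sum>k\<in>{- int n..int n}. t k * g (k + d)) = (\<Sum>k\<in>{- int (Suc n)..int (Suc n)}. t (k - d) * g k)"
proof -
  have "(\<Sum>k\<in>{- int n..int n}. t k * g (k + d)) = (\<Sum>k\<in>{- int n + d..int n + d}. t (k - d) * g k)"
    by (rule sum.reindex_bij_witness[of _ "\<lambda>k. k - d" "\<lambda>k. k + d"]) auto
  also have "\<dots> = (\<Sum>k\<in>{- int (Suc n)..int (Suc n)}. t (k - d) * g k)"
    using assms by (intro sum.mono_neutral_left) auto
  finally show ?thesis .
qed

lemma tri_rec_int:
  assumes "0 < q" "q < 1"
  shows "tri_norm q n * tri q (Suc n) (nat \<bar>k\<bar>) = (1 + (q ^ (2 * n + 1))\<^sup>2) * tri q n (nat \<bar>k\<bar>)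
     + q ^ (2 * n + 1) * (tri q n (nat \<bar>k - 1\<bar>) + tri q n (nat \<bar>k + 1\<bar>))"
proof -
  consider "k = 0" | j where "k = int (Suc j)" | j where "k = - int (Suc j)"
    by (metis int_cases3 not0_implies_Suc of_nat_0_less_iff less_irrefl)
  then show ?thesis
  proof cases
    case 1 then show ?thesis using tri_rec_0[OF assms, of n] by simp
  next
    case (2 j)
    then have "nat \<bar>k\<bar> = Suc j" "nat \<bar>k - 1\<bar> = j" "nat \<bar>k + 1\<bar> = Suc (Suc j)" by auto
    then show ?thesis using tri_rec_Suc[OF assms, of n j] by simp
  next
    case (3 j)
    then have "nat \<bar>k\<bar> = Suc j" "nat \<bar>k - 1\<bar> = Suc (Suc j)" "nat \<bar>k + 1\<bar> = j" by auto
    then show ?thesis using tri_rec_Suc[OF assms, of n j] by (simp add: add.commute)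
  qed
qed

text \<open>One more factor of the product is one more smearing; \<open>tri_norm\<close> accounts
  for the division by the constant coefficient.\<close>

lemma tri_conv_Suc:
  assumes q: "0 < q" "q < 1" and h: "\<And>k l. h (k + l) = h k + h l"
  shows "tri_norm q n * tri_conv q (Suc n) h C x = smear (q ^ (2 * n + 1)) (h 1) (tri_conv q n h C) x"
proof -
  let ?t = "\<lambda>k. tri q n (nat \<bar>k\<bar>)" and ?r = "q ^ (2 * n + 1)" and ?J = "{- int (Suc n)..int (Suc n)}"
  have t0: "?t k = 0" if "\<bar>k\<bar> > int n" for k
    by (rule tri_eq_0) (use that in auto)
  have hm: "h (k - 1) = h k - h 1" for k using h[of "k - 1" 1] by simp
  have a: "tri_conv q n h C x = (\<Sum>k\<in>?J. ?t k * C (x + h k))"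
    unfolding tri_conv_def using sum_int_shift[of n ?t 0 "\<lambda>k. C (x + h k)", OF t0] by simp
  have b: "tri_conv q n h C (x + h 1) = (\<Sum>k\<in>?J. ?t (k - 1) * C (x + h k))"
    unfolding tri_conv_def using sum_int_shift[of n ?t 1 "\<lambda>k. C (x + h k)", OF t0] by (simp add: h add_ac)
  have c: "tri_conv q n h C (x - h 1) = (\<Sum>k\<in>?J. ?t (k + 1) * C (x + h k))"
    unfolding tri_conv_def using sum_int_shift[of n ?t "-1" "\<lambda>k. C (x + h k)", OF t0] hm by (simp add: algebra_simps)
  have "tri_norm q n * tri_conv q (Suc n) h C x = (\<Sum>k\<in>?J. (tri_norm q n * tri q (Suc n) (nat \<bar>k\<bar>)) * C (x + h k))"
    by (simp add: tri_conv_def sum_distrib_left mult_ac)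
  also have "\<dots> = smear ?r (h 1) (tri_conv q n h C) x"
    unfolding smear_def a b c tri_rec_int[OF q]
    by (simp add: sum_distrib_left sum.distrib[symmetric] algebra_simps)
  finally show ?thesis .
qed

definition alt :: "int \<Rightarrow> real" where "alt k = (if even k then 1 else - 1)"

text \<open>The normalized product at \<open>z = - 1\<close>. It is the eigenvalue that the
  inequalities below compare with.\<close>

definition tri_alt :: "real \<Rightarrow> nat \<Rightarrow> real" where
  "tri_alt q n = (\<Sum>k\<in>{- int n..int n}. tri q n (nat \<bar>k\<bar>) * alt k)"

lemma tri_alt_0: "tri_alt q 0 = 1" by (simp add: tri_alt_def alt_def)

lemma tri_alt_Suc:
  assumes q: "0 < q" "q < 1"
  shows "tri_norm q n * tri_alt q (Suc n) = (1 - q ^ (2 * n + 1))\<^sup>2 * tri_alt q n"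
proof -
  \<comment> \<open>\<open>alt\<close> is an eigenfunction of each of these convolutions, so the
    recurrence of the operators becomes one of the eigenvalues.\<close>
  have e: "tri_conv q n id alt x = tri_alt q n * alt x" for n x
    unfolding tri_conv_def tri_alt_def sum_distrib_right
    by (intro sum.cong) (auto simp: alt_def)
  show ?thesis
    using tri_conv_Suc[OF q, of id n alt 0] unfolding smear_def e
    by (simp add: alt_def power2_eq_square algebra_simps)
qed

lemma tri_norm_pos: "0 < q \<Longrightarrow> q < 1 \<Longrightarrow> 0 < tri_norm q n"
proof -
  assume q: "0 < q" "q < 1"
  then have x: "0 < q\<^sup>2" "q\<^sup>2 < 1" by (auto simp: power_less_one_iff)
  have "(q\<^sup>2) ^ Suc k < 1" for k using x by (metis power_Suc_less_one)
  from this[of n] this[of "2 * n"] x show ?thesis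
    unfolding tri_norm_def by (intro divide_pos_pos mult_pos_pos add_pos_pos) auto
qed

lemma tri_alt_nonneg: "0 < q \<Longrightarrow> q < 1 \<Longrightarrow> 0 \<le> tri_alt q n"
proof (induction n)
  case (Suc n)
  then have "0 \<le> tri_norm q n * tri_alt q (Suc n)" by (simp add: tri_alt_Suc)
  then show ?case using tri_norm_pos[OF Suc.prems, of n] by (simp add: zero_le_mult_iff)
qed (simp add: tri_alt_0)

lemma pos_def_tri_conv:
  assumes q: "0 < q" "q < 1" and h: "\<And>k l. h (k + l) = h k + h l" and C: "pos_def C"
  shows "pos_def (tri_conv q n h C)"
proof (induction n)
  case 0
  have "h 0 = 0" using h[of 0 0] by simp
  then show ?case using C by (simp add: tri_conv_def[abs_def])
next
  case (Suc n)
  have "tri_conv q (Suc n) h C = (\<lambda>x. 1 / tri_norm q n * smear (q ^ (2 * n + 1)) (h 1) (tri_conv q n h C) x)"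
    using tri_norm_pos[OF q, of n] tri_conv_Suc[OF q h, of n C] by (simp add: fun_eq_iff field_simps)
  moreover have "pos_def (\<lambda>x. 1 / tri_norm q n * smear (q ^ (2 * n + 1)) (h 1) (tri_conv q n h C) x)"
    using tri_norm_pos[OF q, of n] by (intro pos_def_scale pos_def_smear Suc.IH) auto
  ultimately show ?case by simp
qed

text \<open>The factor \<open>smear (q ^ 1)\<close> of \<open>tri_conv\<close> contributes the term with \<open>smear 1\<close>,
  which is responsible for strictness; in all the others only \<open>smear r e C \<ge> (1 - r)\<^sup>2 C\<close> is used.\<close>

lemma tri_conv_ge:
  assumes q: "0 < q" "q < 1" and h: "\<And>k l. h (k + l) = h k + h l" and C: "pos_def C"
  shows "pos_def (\<lambda>x. tri_conv q (Suc n) h C x - tri_alt q (Suc n) * C x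
    - tri_alt q (Suc n) * (q / (1 - q)\<^sup>2) * smear 1 (h 1) C x)"
proof (induction n)
  case 0
  have "h 0 = 0" using h[of 0 0] by simp
  then have "tri_conv q 0 h C = C" by (simp add: tri_conv_def[abs_def])
  \<comment> \<open>For a single factor there is equality: relative to its value
    \<open>(1 - q)\<^sup>2\<close> at \<open>z = - 1\<close>, the remainder of the splitting has
    weight \<open>q / (1 - q)\<^sup>2\<close>.\<close>
  then have "tri_norm q 0 * tri_conv q (Suc 0) h C x = (1 - q)\<^sup>2 * C x + q * smear 1 (h 1) C x" for x
    using tri_conv_Suc[OF q h, of 0 C x] by (simp add: smear_split[of q])
  moreover have "tri_norm q 0 * tri_alt q (Suc 0) = (1 - q)\<^sup>2"
    using tri_alt_Suc[OF q, of 0] by (simp add: tri_alt_0)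
  moreover have "(1 - q)\<^sup>2 > 0" using q by simp
  ultimately have "tri_norm q 0 * (tri_conv q (Suc 0) h C x - tri_alt q (Suc 0) * C x
    - tri_alt q (Suc 0) * (q / (1 - q)\<^sup>2) * smear 1 (h 1) C x) = 0" for x
    by (simp add: right_diff_distrib mult.assoc[symmetric])
  then show ?case using tri_norm_pos[OF q, of 0] by (simp add: pos_def_def)
next
  case (Suc n)
  define r where "r = q ^ (2 * Suc n + 1)"
  have r: "0 \<le> r" using q by (simp add: r_def)
  let ?c = "tri_norm q (Suc n)" and ?m = "q / (1 - q)\<^sup>2"
  let ?T = "tri_conv q (Suc n) h C" and ?l = "tri_alt q (Suc n)"
  have c: "?c > 0" by (rule tri_norm_pos[OF q])
  \<comment> \<open>Splitting only the new factor writes the new defect as a nonnegative multiple of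
    the old one plus a smeared positive definite function.\<close>
  have "tri_conv q (Suc (Suc n)) h C x - tri_alt q (Suc (Suc n)) * C x
      - tri_alt q (Suc (Suc n)) * ?m * smear 1 (h 1) C x
    = (1 - r)\<^sup>2 / ?c * (?T x - ?l * C x - ?l * ?m * smear 1 (h 1) C x) + r / ?c * smear 1 (h 1) ?T x" for x
  proof -
    have 1: "tri_conv q (Suc (Suc n)) h C x = ((1 - r)\<^sup>2 * ?T x + r * smear 1 (h 1) ?T x) / ?c"
      using tri_conv_Suc[OF q h, of "Suc n" C x, folded r_def] c by (simp add: smear_split[of r] field_simps)
    have 2: "tri_alt q (Suc (Suc n)) = (1 - r)\<^sup>2 / ?c * ?l"
      using tri_alt_Suc[OF q, of "Suc n", folded r_def] c by (simp add: field_simps)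
    show ?thesis unfolding 1 2 by (simp add: add_divide_distrib right_diff_distrib)
  qed
  moreover have "pos_def (\<lambda>x. (1 - r)\<^sup>2 / ?c * (?T x - ?l * C x - ?l * ?m * smear 1 (h 1) C x) + r / ?c * smear 1 (h 1) ?T x)"
    using c q r by (intro pos_def_add pos_def_scale Suc.IH pos_def_smear pos_def_tri_conv C h) auto
  ultimately show ?case by simp
qed

section \<open>Smearing with Gaussian weights\<close>

lemma summable_on_abs_bound:
  fixes f g :: "'a \<Rightarrow> real"
  assumes "g summable_on A" "\<And>x. x \<in> A \<Longrightarrow> \<bar>f x\<bar> \<le> g x"
  shows "f summable_on A"
proof (rule summable_on_iff_abs_summable_on_real[THEN iffD2])
  show "(\<lambda>x. norm (f x)) summable_on A"
    by (rule summable_on_comparison_test[OF assms(1)]) (use assms(2) in auto)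
qed

lemma summable_on_int:
  fixes f :: "int \<Rightarrow> real"
  assumes "(\<lambda>n. f (int n)) summable_on UNIV" "(\<lambda>n. f (- int n)) summable_on UNIV"
  shows "f summable_on UNIV"
proof -
  have "f summable_on range int" using assms(1) by (subst summable_on_reindex) (auto simp: o_def)
  moreover have "f summable_on range (\<lambda>n. - int n)"
    using assms(2) by (subst summable_on_reindex) (auto simp: o_def inj_on_def)
  ultimately have "f summable_on (range int \<union> range (\<lambda>n. - int n))" by (rule summable_on_union)
  moreover have "range int \<union> range (\<lambda>n. - int n) = UNIV"
  proof -
    have "k \<in> range int \<union> range (\<lambda>n. - int n)" for k by (cases k rule: int_cases2) auto
    then show ?thesis by blast
  qed
  ultimately show ?thesis by simp
qed

definition gauss :: "real \<Rightarrow> int \<Rightarrow> real" where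
  "gauss s k = exp (- s * (of_int k)\<^sup>2)"

lemma gauss_pos [simp]: "0 < gauss s k" and gauss_nonneg [simp]: "0 \<le> gauss s k"
  and abs_gauss [simp]: "\<bar>gauss s k\<bar> = gauss s k"
  and gauss_0 [simp]: "gauss s 0 = 1"
  and gauss_uminus [simp]: "gauss s (- k) = gauss s k"
  by (simp_all add: gauss_def)

lemma gauss_eq_power: "gauss s k = exp (- s) ^ (nat \<bar>k\<bar> * nat \<bar>k\<bar>)"
proof -
  have "(real_of_int k)\<^sup>2 = real (nat \<bar>k\<bar> * nat \<bar>k\<bar>)" by (simp add: power2_eq_square)
  then show ?thesis unfolding gauss_def by (simp add: exp_of_nat_mult[symmetric] mult.commute)
qed

lemma gauss_summable [simp]: "0 < s \<Longrightarrow> gauss s summable_on UNIV"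
proof -
  assume s: "0 < s"
  have "summable (\<lambda>n. exp (- s) ^ n)" using s by (intro summable_geometric) auto
  then have g: "(\<lambda>n::nat. exp (- s) ^ n) summable_on UNIV"
    by (intro summable_nonneg_imp_summable_on) auto
  have "gauss s (int n) \<le> exp (- s) ^ n" for n
    unfolding gauss_eq_power by (rule power_decreasing) (use s in \<open>auto simp: le_square\<close>)
  then show ?thesis
    by (intro summable_on_int; simp; intro summable_on_comparison_test[OF g]) auto
qed

definition theta_conv :: "real \<Rightarrow> (int \<Rightarrow> 'a::ab_group_add) \<Rightarrow> ('a \<Rightarrow> real) \<Rightarrow> 'a \<Rightarrow> real" where
  "theta_conv s h C x = (\<Sum>\<^sub>\<infinity>k. gauss s k * C (x + h k))"

definition theta3 :: "real \<Rightarrow> real" where "theta3 s = (\<Sum>\<^sub>\<infinity>k. gauss s k)"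

definition theta4 :: "real \<Rightarrow> real" where "theta4 s = (\<Sum>\<^sub>\<infinity>k. gauss s k * alt k)"

lemma abs_alt [simp]: "\<bar>alt k\<bar> = 1" by (simp add: alt_def)

lemma gauss_summable_mult:
  assumes "0 < s" and "\<And>k. \<bar>c k\<bar> \<le> B"
  shows "(\<lambda>k. gauss s k * c k) summable_on UNIV"
proof -
  show ?thesis
    by (rule summable_on_abs_bound[OF summable_on_cmult_left[OF gauss_summable[OF assms(1)], of B]])
      (auto simp: abs_mult intro!: mult_left_mono assms(2))
qed

text \<open>Since \<open>n - l \<le> n + 1 + l\<close>, each quotient in \<open>tri\<close> lies
  between 0 and 1. With \<open>q = exp (- s)\<close> this gives a Gaussian majorant independent of
  \<open>n\<close>.\<close>

lemma tri_nonneg_le: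
  assumes q: "0 < q" "q < 1"
  shows "0 \<le> tri q n k" "tri q n k \<le> q ^ (k * k)"
proof -
  have x: "0 < q\<^sup>2" "q\<^sup>2 < 1" using q by (auto simp: power_less_one_iff)
  have f: "0 \<le> (1 - (q\<^sup>2) ^ (n - l)) / (1 - (q\<^sup>2) ^ (n + 1 + l))"
    "(1 - (q\<^sup>2) ^ (n - l)) / (1 - (q\<^sup>2) ^ (n + 1 + l)) \<le> 1" for l
  proof -
    have "(q\<^sup>2) ^ (n - l) \<le> 1" "(q\<^sup>2) ^ (n + 1 + l) < 1"
      using x power_le_one[of "q\<^sup>2" "n - l"] power_Suc_less_one[of "q\<^sup>2" "n + l"] by auto
    moreover have "(q\<^sup>2) ^ (n + 1 + l) \<le> (q\<^sup>2) ^ (n - l)" using x by (intro power_decreasing) auto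
    ultimately show "0 \<le> (1 - (q\<^sup>2) ^ (n - l)) / (1 - (q\<^sup>2) ^ (n + 1 + l))"
    "(1 - (q\<^sup>2) ^ (n - l)) / (1 - (q\<^sup>2) ^ (n + 1 + l)) \<le> 1" by (auto simp: divide_simps)
  qed
  show "0 \<le> tri q n k" unfolding tri_def using f q by (intro mult_nonneg_nonneg prod_nonneg) auto
  show "tri q n k \<le> q ^ (k * k)" unfolding tri_def using f q
    by (intro mult_left_le prod_le_1) auto
qed

lemma tri_lim:
  assumes q: "0 < q" "q < 1"
  shows "(\<lambda>n. tri q n k) \<longlonglongrightarrow> q ^ (k * k)"
proof -
  have x: "0 < q\<^sup>2" "q\<^sup>2 < 1" using q by (auto simp: power_less_one_iff)
  have p: "(\<lambda>n. (q\<^sup>2) ^ n) \<longlonglongrightarrow> 0" using x by (intro LIMSEQ_power_zero) auto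
  have p1: "(\<lambda>n. (q\<^sup>2) ^ (n - l)) \<longlonglongrightarrow> 0" for l
    by (rule LIMSEQ_offset[where k=l]) (simp add: p)
  have p2: "(\<lambda>n. (q\<^sup>2) ^ (n + 1 + l)) \<longlonglongrightarrow> 0" for l
    using LIMSEQ_ignore_initial_segment[OF p, of "1 + l"] by (simp add: add.assoc)
  have "(\<lambda>n. q ^ (k * k) * (\<Prod>l<k. (1 - (q\<^sup>2) ^ (n - l)) / (1 - (q\<^sup>2) ^ (n + 1 + l))))
      \<longlonglongrightarrow> q ^ (k * k) * (\<Prod>l<k. (1 - 0) / (1 - 0))"
    by (intro tendsto_mult tendsto_const tendsto_prod tendsto_divide tendsto_diff p1 p2) auto
  then show ?thesis by (simp add: tri_def)
qed

lemma tri_conv_lim: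
  assumes s: "0 < s" and B: "\<And>x. \<bar>C x\<bar> \<le> B"
  shows "(\<lambda>n. tri_conv (exp (- s)) n h C x) \<longlonglongrightarrow> theta_conv s h C x"
proof -
  let ?q = "exp (- s)"
  have q: "0 < ?q" "?q < 1" using s by auto
  have e: "tri_conv ?q n h C x = (\<Sum>\<^sub>\<infinity>k. tri ?q n (nat \<bar>k\<bar>) * C (x + h k))" for n
    unfolding tri_conv_def
    by (subst infsum_finite[symmetric], simp, intro infsum_cong_neutral) (auto simp: tri_eq_0)
  show ?thesis
    unfolding e theta_conv_def
  proof (rule dominated_convergence_infsum)
    show "(\<lambda>k. gauss s k * B) summable_on UNIV" using s by (intro summable_on_cmult_left) simp
    show "\<bar>tri ?q n (nat \<bar>k\<bar>) * C (x + h k)\<bar> \<le> gauss s k * B" for n k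
      using tri_nonneg_le[OF q] B unfolding gauss_eq_power abs_mult by (intro mult_mono) auto
    show "(\<lambda>n. tri ?q n (nat \<bar>k\<bar>) * C (x + h k)) \<longlonglongrightarrow> gauss s k * C (x + h k)" for k
      unfolding gauss_eq_power by (intro tendsto_intros tri_lim q)
  qed
qed

lemma tri_alt_lim:
  assumes "0 < s" shows "(\<lambda>n. tri_alt (exp (- s)) n) \<longlonglongrightarrow> theta4 s"
  using tri_conv_lim[OF assms, of alt 1 id 0]
  unfolding tri_conv_def theta_conv_def tri_alt_def theta4_def by simp

text \<open>The alternating series does not show this; it is inherited from the products, whose
  factors at \<open>z = - 1\<close> are squares.\<close>

lemma theta4_nonneg: "0 < s \<Longrightarrow> 0 \<le> theta4 s"
  by (rule LIMSEQ_le_const[OF tri_alt_lim]) (auto intro!: tri_alt_nonneg)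

lemma pos_def_theta_conv:
  assumes s: "0 < s" and h: "\<And>k l. h (k + l) = h k + h l" and C: "pos_def C" and B: "\<And>x. \<bar>C x\<bar> \<le> B"
  shows "pos_def (theta_conv s h C)"
  by (rule pos_def_lim[OF pos_def_tri_conv[OF _ _ h C] tri_conv_lim[OF s B]]) (use s in auto)

lemma theta_conv_ge:
  assumes s: "0 < s" and h: "\<And>k l. h (k + l) = h k + h l" and C: "pos_def C" and B: "\<And>x. \<bar>C x\<bar> \<le> B"
  shows "pos_def (\<lambda>x. theta_conv s h C x - theta4 s * C x
    - theta4 s * (exp (- s) / (1 - exp (- s))\<^sup>2) * smear 1 (h 1) C x)"
  by (rule pos_def_lim[OF tri_conv_ge[where q="exp (- s)", OF _ _ h C]])
    (use s in \<open>auto intro!: tendsto_intros LIMSEQ_Suc[OF tri_conv_lim[OF s B]] LIMSEQ_Suc[OF tri_alt_lim[OF s]]\<close>)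

text \<open>The limit lemmas ask for a bounded function, so boundedness has to survive the
  convolution along each axis.\<close>

lemma theta_conv_bound:
  assumes s: "0 < s" and B: "\<And>x. \<bar>C x\<bar> \<le> B"
  shows "\<bar>theta_conv s h C x\<bar> \<le> theta3 s * B"
proof -
  have a: "(\<lambda>k. norm (gauss s k * C (x + h k))) summable_on UNIV"
    by (rule summable_on_iff_abs_summable_on_real[THEN iffD1]) (rule gauss_summable_mult[OF s B])
  have "norm (theta_conv s h C x) \<le> (\<Sum>\<^sub>\<infinity>k. norm (gauss s k * C (x + h k)))"
    unfolding theta_conv_def by (rule norm_infsum_bound[OF a])
  also have "\<dots> \<le> (\<Sum>\<^sub>\<infinity>k. gauss s k * B)"
    by (rule infsum_mono[OF a]) (use s B in \<open>auto intro!: summable_on_cmult_left mult_left_mono simp: abs_mult\<close>)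
  also have "\<dots> = theta3 s * B" unfolding theta3_def using s by (intro infsum_cmult_left) auto
  finally show ?thesis by simp
qed

section \<open>From one axis to all axes\<close>

definition axis_int :: "'n \<Rightarrow> int \<Rightarrow> 'n \<Rightarrow> int" where
  "axis_int i k = (\<lambda>j. if j = i then k else 0)"

lemma axis_int_add: "axis_int i (k + l) = axis_int i k + axis_int i l"
  by (auto simp: axis_int_def fun_eq_iff)

text \<open>The sublattice spanned by the axes in \<open>S\<close>, on which sums are built up by
  induction over \<open>S\<close>.\<close>

definition supp_in :: "'n set \<Rightarrow> ('n \<Rightarrow> int) set" where
  "supp_in S = {m. \<forall>i. i \<notin> S \<longrightarrow> m i = 0}"

lemma supp_in_empty [simp]: "supp_in {} = {0}" and supp_in_UNIV [simp]: "supp_in UNIV = UNIV"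
  by (auto simp: supp_in_def fun_eq_iff)

lemma bij_betw_supp_in_insert:
  assumes "i \<notin> S"
  shows "bij_betw (\<lambda>(k, m). axis_int i k + m) (UNIV \<times> supp_in S) (supp_in (insert i S))"
  by (rule bij_betw_byWitness[where f'="\<lambda>m. (m i, m(i := 0))"])
    (use assms in \<open>auto simp: supp_in_def axis_int_def fun_eq_iff\<close>)

lemma prod_axis_int_add:
  assumes "i \<notin> S" "m \<in> supp_in S" "finite S"
  shows "(\<Prod>j\<in>insert i S. f j ((axis_int i k + m) j)) = f i k * (\<Prod>j\<in>S. f j (m j))"
proof -
  have "(\<Prod>j\<in>S. f j ((axis_int i k + m) j)) = (\<Prod>j\<in>S. f j (m j))"
    using assms(1) by (intro prod.cong) (auto simp: axis_int_def)
  then show ?thesis using assms by (simp add: supp_in_def axis_int_def)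
qed

lemma summable_on_prod_supp_in:
  fixes f :: "'n \<Rightarrow> int \<Rightarrow> real"
  assumes "finite S" "\<And>i k. 0 \<le> f i k" "\<And>i. f i summable_on UNIV"
  shows "(\<lambda>m. \<Prod>i\<in>S. f i (m i)) summable_on supp_in S"
  using assms(1)
proof induction
  case empty show ?case by simp
next
  case (insert i S)
  let ?P = "\<lambda>m. \<Prod>j\<in>S. f j (m j)"
  have "(\<lambda>(k, m). f i k * ?P m) summable_on UNIV \<times> supp_in S"
  proof (rule summable_on_SigmaI)
    show "((\<lambda>m. (\<lambda>(k, m). f i k * ?P m) (k, m)) has_sum f i k * infsum ?P (supp_in S)) (supp_in S)" for k
      using has_sum_cmult_right[OF has_sum_infsum[OF insert.IH]] by simp
    show "(\<lambda>k. f i k * infsum ?P (supp_in S)) summable_on UNIV"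
      by (rule summable_on_cmult_left[OF assms(3)])
  qed (auto intro!: mult_nonneg_nonneg prod_nonneg assms(2))
  then have "(\<lambda>x. \<Prod>j\<in>insert i S. f j ((case x of (k, m) \<Rightarrow> axis_int i k + m) j)) summable_on UNIV \<times> supp_in S"
    by (rule summable_on_cong[THEN iffD1, rotated])
      (auto simp del: plus_fun_apply prod.insert simp: prod_axis_int_add insert.hyps)
  then show ?case
    by (subst summable_on_reindex_bij_betw[OF bij_betw_supp_in_insert[OF insert.hyps(2)], symmetric])
qed

lemma summable_on_prod_UNIV:
  fixes f :: "'n::finite \<Rightarrow> int \<Rightarrow> real"
  assumes "\<And>i k. 0 \<le> f i k" "\<And>i. f i summable_on UNIV"
  shows "(\<lambda>m. \<Prod>i\<in>UNIV. f i (m i)) summable_on UNIV"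
  using summable_on_prod_supp_in[of UNIV f] assms by simp

lemma infsum_prod_UNIV:
  fixes f :: "'n::finite \<Rightarrow> int \<Rightarrow> real"
  assumes "\<And>i. f i summable_on UNIV"
  shows "(\<Sum>\<^sub>\<infinity>m. \<Prod>i\<in>UNIV. f i (m i)) = (\<Prod>i\<in>UNIV. \<Sum>\<^sub>\<infinity>k. f i k)"
  using infsum_prod_PiE_abs[of "UNIV :: 'n set" f "\<lambda>_. UNIV"] assms
    summable_on_iff_abs_summable_on_real[THEN iffD1, of "f _" UNIV] by auto

definition multi_conv :: "'n::finite set \<Rightarrow> ('n \<Rightarrow> real) \<Rightarrow> (('n \<Rightarrow> int) \<Rightarrow> real) \<Rightarrow> ('n \<Rightarrow> int) \<Rightarrow> real" where
  "multi_conv S s C x = (\<Sum>\<^sub>\<infinity>m\<in>supp_in S. (\<Prod>i\<in>S. gauss (s i) (m i)) * C (x + m))"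

lemma multi_conv_empty: "multi_conv {} s C = C"
  by (simp add: multi_conv_def fun_eq_iff)

lemma multi_conv_insert:
  assumes s: "\<And>i. 0 < s i" and B: "\<And>x. \<bar>C x\<bar> \<le> B" and i: "i \<notin> S"
  shows "multi_conv (insert i S) s C x = theta_conv (s i) (axis_int i) (multi_conv S s C) x"
proof -
  let ?P = "\<lambda>S m. \<Prod>j\<in>S. gauss (s j) (m j)"
  have pa: "?P (insert i S) (axis_int i k + m) = gauss (s i) k * ?P S m" if "m \<in> supp_in S" for k m
    by (rule prod_axis_int_add[of i S m "\<lambda>j. gauss (s j)"]) (use that i in auto)
  have "(\<lambda>m. ?P (insert i S) m * B) summable_on supp_in (insert i S)"
    by (intro summable_on_cmult_left summable_on_prod_supp_in) (auto simp: s)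
  then have "(\<lambda>m. ?P (insert i S) m * C (x + m)) summable_on supp_in (insert i S)"
    by (rule summable_on_abs_bound)
      (auto simp: abs_mult abs_prod simp del: prod.insert intro!: mult_left_mono B prod_nonneg)
  then have "(\<lambda>y. ?P (insert i S) ((case y of (k, m) \<Rightarrow> axis_int i k + m)) * C (x + (case y of (k, m) \<Rightarrow> axis_int i k + m)))
     summable_on UNIV \<times> supp_in S"
    by (subst (asm) summable_on_reindex_bij_betw[OF bij_betw_supp_in_insert[OF i], symmetric])
  then have sm: "(\<lambda>(k, m). gauss (s i) k * ?P S m * C (x + axis_int i k + m)) summable_on UNIV \<times> supp_in S"
    by (rule summable_on_cong[THEN iffD1, rotated])
      (clarsimp simp del: plus_fun_apply prod.insert simp: pa i add.assoc)
  have "multi_conv (insert i S) s C x = (\<Sum>\<^sub>\<infinity>y\<in>UNIV \<times> supp_in S.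
      ?P (insert i S) ((case y of (k, m) \<Rightarrow> axis_int i k + m)) * C (x + (case y of (k, m) \<Rightarrow> axis_int i k + m)))"
    unfolding multi_conv_def
    by (subst infsum_reindex_bij_betw[OF bij_betw_supp_in_insert[OF i], symmetric]) simp
  also have "\<dots> = (\<Sum>\<^sub>\<infinity>(k, m)\<in>UNIV \<times> supp_in S. gauss (s i) k * ?P S m * C (x + axis_int i k + m))"
    by (rule infsum_cong) (clarsimp simp del: plus_fun_apply prod.insert simp: pa i add.assoc)
  also have "\<dots> = (\<Sum>\<^sub>\<infinity>k. \<Sum>\<^sub>\<infinity>m\<in>supp_in S. gauss (s i) k * ?P S m * C (x + axis_int i k + m))"
    by (rule infsum_Sigma'_banach[OF sm, symmetric])
  also have "\<dots> = theta_conv (s i) (axis_int i) (multi_conv S s C) x"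
    unfolding theta_conv_def multi_conv_def by (simp add: mult.assoc infsum_cmult_right')
  finally show ?thesis .
qed

text \<open>The four claims go together in the induction: a new axis needs a bounded, positive
  definite kernel to act on, the plain inequality to replace that kernel by \<open>C\<close>, and
  the sharpened inequality to keep the gain of each axis already treated.\<close>

lemma multi_conv_pos_def:
  assumes s: "\<And>i. 0 < s i" and C: "pos_def C" and B: "\<And>x. \<bar>C x\<bar> \<le> B"
  shows "(\<exists>B. \<forall>x. \<bar>multi_conv S s C x\<bar> \<le> B) \<and> pos_def (multi_conv S s C) \<and>
    pos_def (\<lambda>x. multi_conv S s C x - (\<Prod>i\<in>S. theta4 (s i)) * C x) \<and>
    (\<forall>i\<in>S. pos_def (\<lambda>x. multi_conv S s C x - (\<Prod>i\<in>S. theta4 (s i)) * C x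
      - (\<Prod>i\<in>S. theta4 (s i)) * (exp (- s i) / (1 - exp (- s i))\<^sup>2) * smear 1 (axis_int i 1) C x))"
proof -
  have "finite S" by simp
  then show ?thesis
  proof induction
    case empty
    then show ?case using C B by (auto simp: multi_conv_empty pos_def_def)
  next
    case (insert i S)
    define D where "D = multi_conv S s C"
    define L where "L = (\<Prod>j\<in>S. theta4 (s j))"
    define \<mu> where "\<mu> j = exp (- s j) / (1 - exp (- s j))\<^sup>2" for j
    define T where "T = theta_conv (s i) (axis_int i) D"
    have mu: "0 \<le> \<mu> j" for j by (simp add: \<mu>_def)
    have L: "0 \<le> L" unfolding L_def by (intro prod_nonneg) (auto intro: theta4_nonneg s)
    have t4: "0 \<le> theta4 (s i)" by (intro theta4_nonneg s)
    obtain B' where B': "\<And>x. \<bar>D x\<bar> \<le> B'" using insert.IH by (auto simp: D_def)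
    have D: "pos_def D" "pos_def (\<lambda>x. D x - L * C x)"
      "\<And>j. j \<in> S \<Longrightarrow> pos_def (\<lambda>x. D x - L * C x - L * \<mu> j * smear 1 (axis_int j 1) C x)"
      using insert.IH by (auto simp: D_def L_def \<mu>_def)
    have MT: "multi_conv (insert i S) s C = T"
      unfolding T_def D_def by (rule ext, rule multi_conv_insert[OF s B insert.hyps(2)])
    have PL: "(\<Prod>j\<in>insert i S. theta4 (s j)) = theta4 (s i) * L" using insert.hyps by (simp add: L_def)
    note s' = s[of i] and h = axis_int_add[of i]
    have smz: "smear 1 e (\<lambda>x. D x - L * C x) x = smear 1 e D x - L * smear 1 e C x" for e x
      by (simp add: smear_def algebra_simps)
    have 1: "pos_def T" unfolding T_def by (rule pos_def_theta_conv[OF s' h D(1) B'])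
    have 2: "pos_def (\<lambda>x. T x - theta4 (s i) * D x - theta4 (s i) * \<mu> i * smear 1 (axis_int i 1) D x)"
      unfolding T_def \<mu>_def by (rule theta_conv_ge[OF s' h D(1) B'])
    have 3: "pos_def (\<lambda>x. T x - theta4 (s i) * D x)"
      using pos_def_add[OF 2 pos_def_scale[OF pos_def_smear[OF D(1), of 1 "axis_int i 1"], of "theta4 (s i) * \<mu> i"]] t4 mu
      by simp
    have 4: "pos_def (\<lambda>x. T x - theta4 (s i) * L * C x)"
      using pos_def_add[OF 3 pos_def_scale[OF D(2) t4]] by (simp add: algebra_simps)
    have 5: "pos_def (\<lambda>x. T x - theta4 (s i) * L * C x - theta4 (s i) * L * \<mu> j * smear 1 (axis_int j 1) C x)"
      if "j \<in> S" for j
      using pos_def_add[OF 3 pos_def_scale[OF D(3)[OF that] t4]] by (simp add: algebra_simps)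
    \<comment> \<open>The gain of the new axis first appears in terms of \<open>D\<close>; smearing
      the inequality between \<open>D\<close> and \<open>L * C\<close> converts it into a gain in
      terms of \<open>C\<close>.\<close>
    have "pos_def (\<lambda>x. (T x - theta4 (s i) * D x - theta4 (s i) * \<mu> i * smear 1 (axis_int i 1) D x)
       + (theta4 (s i) * (D x - L * C x) + theta4 (s i) * \<mu> i * smear 1 (axis_int i 1) (\<lambda>x. D x - L * C x) x))"
      using t4 mu by (intro pos_def_add pos_def_scale 2 D(2) pos_def_smear) auto
    then have 6: "pos_def (\<lambda>x. T x - theta4 (s i) * L * C x - theta4 (s i) * L * \<mu> i * smear 1 (axis_int i 1) C x)"
      unfolding smz by (simp add: algebra_simps)
    have "\<exists>B. \<forall>x. \<bar>T x\<bar> \<le> B"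
      using theta_conv_bound[where C=D, OF s' B'] unfolding T_def by blast
    then show ?case unfolding MT PL \<mu>_def[symmetric] using 1 4 5 6 by auto
  qed
qed

definition alternating :: "('n::finite \<Rightarrow> int) \<Rightarrow> real" where
  "alternating m = (\<Prod>i\<in>UNIV. alt (m i))"

lemma prod_theta4:
  assumes "\<And>i. 0 < s i"
  shows "(\<Prod>i\<in>UNIV. theta4 (s i)) = (\<Sum>\<^sub>\<infinity>m. (\<Prod>i\<in>UNIV. gauss (s i) (m i)) * alternating m)"
  unfolding theta4_def alternating_def prod.distrib[symmetric]
  by (rule infsum_prod_UNIV[symmetric]) (rule gauss_summable_mult[of _ _ 1], use assms in auto)

text \<open>The gain is stated for one arbitrary axis: in the equality case each axis is examined on
  its own.\<close>

theorem gauss_sum_pos_def_ge: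
  fixes C :: "('n::finite \<Rightarrow> int) \<Rightarrow> real"
  assumes s: "\<And>i. 0 < s i" and C: "pos_def C" and B: "\<And>x. \<bar>C x\<bar> \<le> B"
  shows "(\<Prod>i\<in>UNIV. theta4 (s i)) * (C 0 + exp (- s i) / (1 - exp (- s i))\<^sup>2 * smear 1 (axis_int i 1) C 0)
    \<le> (\<Sum>\<^sub>\<infinity>m. (\<Prod>i\<in>UNIV. gauss (s i) (m i)) * C m)"
proof -
  let ?L = "\<Prod>i\<in>UNIV. theta4 (s i)" and ?m = "exp (- s i) / (1 - exp (- s i))\<^sup>2"
  have "pos_def (\<lambda>x. multi_conv UNIV s C x - ?L * C x - ?L * ?m * smear 1 (axis_int i 1) C x)"
    using multi_conv_pos_def[where s=s and C=C and S=UNIV, OF s C B] by blast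
  from pos_def_zero[OF this] show ?thesis
    by (simp add: multi_conv_def algebra_simps)
qed

section \<open>The functional equation of the theta function\<close>

text \<open>The Dirichlet kernel, in a form free of division so that \<open>sin (a / 2) = 0\<close>
  is covered.\<close>

lemma sum_cos_symmetric:
  fixes a :: real
  shows "2 * sin (a / 2) * (\<Sum>j\<in>{- int M..int M}. cos (of_int j * a)) = 2 * sin ((of_nat M + 1 / 2) * a)"
proof (induction M)
  case (Suc M)
  have "{- int (Suc M)..int (Suc M)} = insert (int (Suc M)) (insert (- int (Suc M)) {- int M..int M})"
    by auto
  then have "(\<Sum>j\<in>{- int (Suc M)..int (Suc M)}. cos (of_int j * a))
    = 2 * cos ((of_nat M + 1) * a) + (\<Sum>j\<in>{- int M..int M}. cos (of_int j * a))"
    using cos_minus[of "a + of_nat M * a"] by (simp add: algebra_simps)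
  then have "2 * sin (a / 2) * (\<Sum>j\<in>{- int (Suc M)..int (Suc M)}. cos (of_int j * a))
    = 4 * sin (a / 2) * cos ((of_nat M + 1) * a) + 2 * sin ((of_nat M + 1 / 2) * a)"
    using Suc.IH by (simp add: algebra_simps)
  also have "\<dots> = 2 * sin ((of_nat (Suc M) + 1 / 2) * a)"
  proof -
    define y where "y = (of_nat M + 1) * a"
    have "(of_nat (Suc M) + 1 / 2) * a = y + a / 2" "(of_nat M + 1 / 2) * a = y - a / 2"
      by (simp_all add: y_def algebra_simps add_divide_distrib)
    then show ?thesis by (simp add: sin_add sin_diff y_def[symmetric])
  qed
  finally show ?case .
qed simp

text \<open>An odd modulus lets a range symmetric about 0 represent every residue class
  once.\<close>

lemma sum_cos_roots_of_unity:
  fixes m :: int and M :: nat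
  defines "N \<equiv> 2 * int M + 1"
  shows "(\<Sum>j\<in>{- int M..int M}. cos (2 * pi * of_int m * of_int j / of_int N)) = (if N dvd m then of_int N else 0)"
proof (cases "N dvd m")
  case True
  then obtain k where m: "m = N * k" by auto
  have "cos (2 * pi * of_int m * of_int j / of_int N) = 1" for j
  proof -
    have "2 * pi * of_int m * of_int j / of_int N = 2 * pi * of_int (k * j)"
      by (simp add: m N_def)
    also have "cos \<dots> = 1" by (metis cos_int_2pin mult.commute)
    finally show ?thesis .
  qed
  then show ?thesis using True by (simp add: N_def)
next
  case False
  define a where "a = 2 * pi * of_int m / of_int N"
  have N: "real_of_int N > 0" by (simp add: N_def)
  have "sin (a / 2) \<noteq> 0"
  proof
    assume "sin (a / 2) = 0"
    then obtain i where "a / 2 = of_int i * pi" using sin_zero_iff_int2 by blast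
    then have "real_of_int m = of_int (i * N)" using N by (simp add: a_def field_simps)
    then have "m = i * N" by (simp only: of_int_eq_iff)
    then show False using False by simp
  qed
  moreover have "sin ((of_nat M + 1 / 2) * a) = 0"
  proof -
    have "(of_nat M + 1 / 2) * a = of_int m * pi" using N by (simp add: a_def N_def field_simps)
    then show ?thesis by (metis sin_zero_iff_int2)
  qed
  ultimately have "(\<Sum>j\<in>{- int M..int M}. cos (of_int j * a)) = 0"
    using sum_cos_symmetric[of a M] by simp
  then show ?thesis using False by (simp add: a_def mult_ac)
qed

section \<open>Central binomial coefficients and a discrete Poisson formula\<close>

definition cbin :: "nat \<Rightarrow> nat \<Rightarrow> real" where "cbin n l = real ((2 * n) choose (n + l))"

lemma cbin_eq_0: "l > n \<Longrightarrow> cbin n l = 0" by (simp add: cbin_def)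

lemma cos_power_expansion:
  "(2 * cos x) ^ (2 * n) = (\<Sum>k\<in>{- int n..int n}. cbin n (nat \<bar>k\<bar>) * cos (2 * of_int k * x))"
proof -
  have "complex_of_real ((2 * cos x) ^ (2 * n)) = (cis x + cis (- x)) ^ (2 * n)"
    by (simp add: complex_eq_iff flip: of_real_power)
  also have "\<dots> = (\<Sum>l\<le>2 * n. of_nat ((2 * n) choose l) * cis x ^ l * cis (- x) ^ (2 * n - l))"
    by (rule binomial_ring)
  also have "\<dots> = (\<Sum>l\<le>2 * n. of_nat ((2 * n) choose l) * cis (2 * (real l - real n) * x))"
  proof (rule sum.cong)
    fix l assume "l \<in> {..2 * n}"
    then have e: "real l * x + real (2 * n - l) * (- x) = 2 * (real l - real n) * x"
      by (simp add: of_nat_diff algebra_simps)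
    have "cis x ^ l * cis (- x) ^ (2 * n - l) = cis (2 * (real l - real n) * x)"
      by (simp only: Complex.DeMoivre cis_mult e)
    then show "of_nat ((2 * n) choose l) * cis x ^ l * cis (- x) ^ (2 * n - l) = of_nat ((2 * n) choose l) * cis (2 * (real l - real n) * x)"
      by (metis mult.assoc)
  qed simp
  finally have "(2 * cos x) ^ (2 * n) = Re (\<Sum>l\<le>2 * n. of_nat ((2 * n) choose l) * cis (2 * (real l - real n) * x))"
    by (metis Re_complex_of_real)
  also have "\<dots> = (\<Sum>l\<le>2 * n. real ((2 * n) choose l) * cos (2 * (real l - real n) * x))"
    by simp
  also have "\<dots> = (\<Sum>k\<in>{- int n..int n}. cbin n (nat \<bar>k\<bar>) * cos (2 * of_int k * x))"
  proof (rule sum.reindex_bij_witness[of _ "\<lambda>k. nat (k + int n)" "\<lambda>l. int l - int n"])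
    fix l assume l: "l \<in> {..2 * n}"
    have "cbin n (nat \<bar>int l - int n\<bar>) = real ((2 * n) choose l)"
    proof (cases "n \<le> l")
      case True
      then have "n + nat \<bar>int l - int n\<bar> = l" by auto
      then show ?thesis by (simp only: cbin_def)
    next
      case False
      then have "n + nat \<bar>int l - int n\<bar> = 2 * n - l" by auto
      then have "cbin n (nat \<bar>int l - int n\<bar>) = real ((2 * n) choose (2 * n - l))"
        by (simp only: cbin_def)
      then show ?thesis using l by (simp only: atMost_iff binomial_symmetric[of l "2 * n"])
    qed
    then show "cbin n (nat \<bar>int l - int n\<bar>) * cos (2 * of_int (int l - int n) * x) = real ((2 * n) choose l) * cos (2 * (real l - real n) * x)"
      by simp
  qed auto
  finally show ?thesis .
qed

text \<open>A discrete Poisson summation formula: averaging over the \<open>N\<close>-th roots of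
  unity retains exactly the coefficients whose index is a multiple of \<open>N\<close>. The cosine
  side will tend to a theta series with parameter \<open>c * pi\<^sup>2\<close>, the binomial side
  to one with \<open>1 / c\<close>.\<close>

lemma sum_cos_power_eq:
  fixes M n :: nat
  defines "N \<equiv> 2 * M + 1"
  shows "(\<Sum>j\<in>{- int M..int M}. (2 * cos (pi * of_int j / real N)) ^ (2 * n))
    = real N * (\<Sum>\<^sub>\<infinity>k::int. cbin n (nat \<bar>k\<bar> * N))"
proof -
  have N: "real_of_int (2 * int M + 1) = real N" "2 * int M + 1 = int N" by (simp_all add: N_def)
  have "(\<Sum>j\<in>{- int M..int M}. (2 * cos (pi * of_int j / real N)) ^ (2 * n))
    = (\<Sum>j\<in>{- int M..int M}. \<Sum>k\<in>{- int n..int n}. cbin n (nat \<bar>k\<bar>) * cos (2 * pi * of_int k * of_int j / real N))"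
    unfolding cos_power_expansion by (simp add: mult_ac)
  also have "\<dots> = (\<Sum>k\<in>{- int n..int n}. cbin n (nat \<bar>k\<bar>) *
      (\<Sum>j\<in>{- int M..int M}. cos (2 * pi * of_int k * of_int j / real N)))"
    by (subst sum.swap) (simp add: sum_distrib_left)
  also have "\<dots> = (\<Sum>k\<in>{- int n..int n}. cbin n (nat \<bar>k\<bar>) * (if int N dvd k then real N else 0))"
    using sum_cos_roots_of_unity[where M=M, unfolded N] by (simp cong: if_cong)
  also have "\<dots> = (\<Sum>\<^sub>\<infinity>k\<in>{- int n..int n}. cbin n (nat \<bar>k\<bar>) * (if int N dvd k then real N else 0))" by simp
  also have "\<dots> = (\<Sum>\<^sub>\<infinity>k\<in>(\<lambda>k. k * int N) ` UNIV. real N * cbin n (nat \<bar>k\<bar>))"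
    by (rule infsum_cong_neutral) (auto simp: image_iff dvd_def mult.commute cbin_eq_0)
  also have "\<dots> = (\<Sum>\<^sub>\<infinity>k::int. real N * cbin n (nat \<bar>k * int N\<bar>))"
    by (subst infsum_reindex) (auto simp: inj_on_def N_def o_def)
  also have "\<dots> = real N * (\<Sum>\<^sub>\<infinity>k::int. cbin n (nat \<bar>k\<bar> * N))"
    by (simp add: infsum_cmult_right' abs_mult nat_mult_distrib)
  finally show ?thesis .
qed

lemma cbin_Suc: "cbin n (Suc l) * real (n + l + 1) = cbin n l * real (n - l)"
proof -
  have "Suc (n + l) * ((2 * n) choose Suc (n + l)) = (2 * n - (n + l)) * ((2 * n) choose (n + l))"
    by (simp only: binomial_absorption binomial_absorb_comp)
  then have "real (Suc (n + l) * ((2 * n) choose Suc (n + l))) = real ((n - l) * ((2 * n) choose (n + l)))"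
    by (simp add: mult_2)
  then have "real (Suc (n + l)) * real ((2 * n) choose Suc (n + l)) = real (n - l) * real ((2 * n) choose (n + l))"
    by (simp only: of_nat_mult)
  then show ?thesis by (simp add: cbin_def mult.commute)
qed

lemma cbin_pos: "cbin n 0 > 0" by (simp add: cbin_def)

lemma cbin_nonneg: "cbin n l \<ge> 0" by (simp add: cbin_def)

text \<open>Consecutive ratios \<open>(n - l) / (n + l + 1) = 1 - (2 * l + 1) / (n + l + 1)\<close>
  are bounded by exponentials. The separate bound \<open>L\<close> keeps one denominator throughout
  the induction, so that the odd numbers in the exponents add up to a square.\<close>

lemma cbin_upper:
  "l \<le> L \<Longrightarrow> cbin n l \<le> cbin n 0 * exp (- (real l)\<^sup>2 / (real n + real L))"
proof (induction l)
  case (Suc l)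
  show ?case
  proof (cases "Suc l \<le> n")
    case True
    define D where "D = real n + real L"
    have D: "0 < D" "real (n + l + 1) \<le> D" using True Suc.prems by (auto simp: D_def)
    have "cbin n (Suc l) = cbin n l * (1 - (2 * real l + 1) / real (n + l + 1))"
      using cbin_Suc[of n l] True by (simp add: field_simps of_nat_diff)
    also have "1 - (2 * real l + 1) / real (n + l + 1) \<le> 1 - (2 * real l + 1) / D"
      using D by (intro diff_left_mono divide_left_mono) auto
    also have "\<dots> \<le> exp (- (2 * real l + 1) / D)"
      using exp_ge_add_one_self[of "- ((2 * real l + 1) / D)"] by (simp only: minus_divide_left uminus_add_conv_diff diff_conv_add_uminus)
    also have "cbin n l * exp (- (2 * real l + 1) / D) \<le> (cbin n 0 * exp (- (real l)\<^sup>2 / D)) * exp (- (2 * real l + 1) / D)"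
      using Suc unfolding D_def by (intro mult_right_mono) auto
    also have "\<dots> = cbin n 0 * exp (- (real (Suc l))\<^sup>2 / D)"
      by (simp add: mult.assoc exp_add[symmetric] power2_eq_square algebra_simps add_divide_distrib diff_divide_distrib)
    finally show ?thesis unfolding D_def using cbin_nonneg by (simp add: mult_left_mono)
  next
    case False
    then show ?thesis using cbin_pos[of n] by (simp add: cbin_eq_0)
  qed
qed simp

text \<open>The same telescoping with the inverse ratios \<open>1 + (2 * l + 1) / (n - l)\<close>;
  here the common denominator is \<open>n - L\<close>.\<close>

lemma cbin_lower:
  "l \<le> L \<Longrightarrow> L < n \<Longrightarrow> cbin n 0 * exp (- (real l)\<^sup>2 / (real n - real L)) \<le> cbin n l"
proof (induction l)
  case (Suc l)
  define D where "D = real n - real L"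
  have D: "0 < D" "D \<le> real n - real l" using Suc.prems by (auto simp: D_def)
  have le: "(n + l + 1) / (real n - real l) \<le> exp ((2 * real l + 1) / D)"
  proof -
    have "(n + l + 1) / (real n - real l) = 1 + (2 * real l + 1) / (real n - real l)"
      using D by (simp add: field_simps)
    also have "\<dots> \<le> 1 + (2 * real l + 1) / D" using D by (intro add_left_mono divide_left_mono) auto
    also have "\<dots> \<le> exp ((2 * real l + 1) / D)" by (rule exp_ge_add_one_self)
    finally show ?thesis .
  qed
  have "cbin n 0 * exp (- (real (Suc l))\<^sup>2 / D) = (cbin n 0 * exp (- (real l)\<^sup>2 / D)) * exp (- ((2 * real l + 1) / D))"
    by (simp add: mult.assoc exp_add[symmetric] power2_eq_square algebra_simps add_divide_distrib diff_divide_distrib)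
  also have "\<dots> \<le> cbin n l * exp (- ((2 * real l + 1) / D))"
    using Suc unfolding D_def by (intro mult_right_mono) auto
  also have "\<dots> \<le> cbin n l * ((real n - real l) / (n + l + 1))"
    using le D cbin_nonneg[of n l] unfolding exp_minus
    by (intro mult_left_mono) (auto simp: field_simps)
  also have "\<dots> = cbin n (Suc l)"
    using cbin_Suc[of n l] Suc.prems by (simp add: field_simps of_nat_diff)
  finally show ?case unfolding D_def .
qed simp

lemma cos_ge_one_minus_half_square: "1 - x\<^sup>2 / 2 \<le> cos (x :: real)"
proof -
  have "(sin (x / 2))\<^sup>2 \<le> (x / 2)\<^sup>2"
    using abs_sin_x_le_abs_x[of "x / 2"] by (simp only: abs_le_square_iff)
  moreover have "cos x = 1 - 2 * (sin (x / 2))\<^sup>2" using cos_double_sin[of "x / 2"] by simp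
  ultimately show ?thesis by (simp add: power_divide)
qed

text \<open>\<open>cos y * exp (y\<^sup>2 / 2)\<close> decreases on \<open>[0, pi / 2]\<close>
  because \<open>y * cos y \<le> sin y\<close> there. Raised to a high power, this is the Gaussian
  majorant of the cosine side.\<close>

lemma cos_le_exp:
  fixes x :: real assumes "\<bar>x\<bar> \<le> pi / 2"
  shows "cos x \<le> exp (- x\<^sup>2 / 2)"
proof -
  have pos: "cos y * exp (y\<^sup>2 / 2) \<le> 1" if y: "0 \<le> y" "y \<le> pi / 2" for y :: real
  proof -
    have h: "z * cos z \<le> sin z" if z: "0 \<le> z" "z \<le> pi / 2" for z :: real
    proof -
      have "sin 0 - 0 * cos 0 \<le> sin z - z * cos z"
      proof (rule DERIV_nonneg_imp_nondecreasing[OF z(1)])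
        fix t assume t: "0 \<le> t" "t \<le> z"
        have "((\<lambda>t. sin t - t * cos t) has_real_derivative t * sin t) (at t)"
          by (auto intro!: derivative_eq_intros)
        moreover have "0 \<le> t * sin t" using t z sin_ge_zero[of t] by (intro mult_nonneg_nonneg) auto
        ultimately show "\<exists>y. ((\<lambda>t. sin t - t * cos t) has_real_derivative y) (at t) \<and> 0 \<le> y" by blast
      qed
      then show ?thesis by simp
    qed
    have "cos y * exp (y\<^sup>2 / 2) \<le> cos 0 * exp (0\<^sup>2 / 2)"
    proof (rule DERIV_nonpos_imp_nonincreasing[OF y(1)])
      fix t assume t: "0 \<le> t" "t \<le> y"
      have "((\<lambda>t. cos t * exp (t\<^sup>2 / 2)) has_real_derivative (t * cos t - sin t) * exp (t\<^sup>2 / 2)) (at t)"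
        by (auto intro!: derivative_eq_intros simp: algebra_simps)
      moreover have "(t * cos t - sin t) * exp (t\<^sup>2 / 2) \<le> 0"
        using h[of t] t y by (intro mult_nonpos_nonneg) auto
      ultimately show "\<exists>z. ((\<lambda>t. cos t * exp (t\<^sup>2 / 2)) has_real_derivative z) (at t) \<and> z \<le> 0" by blast
    qed
    then show ?thesis by simp
  qed
  have "cos x * exp (x\<^sup>2 / 2) \<le> 1" using pos[of "\<bar>x\<bar>"] assms by simp
  then show ?thesis by (simp add: exp_minus field_simps)
qed

text \<open>The sequence is increasing and bounded. Its limit, Wallis' \<open>1 / pi\<close>, is
  determined later from the functional equation itself.\<close>

lemma central_binomial_convergent: "convergent (\<lambda>n. real n * (cbin n 0 / 4 ^ n)\<^sup>2)"
proof -
  define a where "a n = (cbin n 0 / 4 ^ n)\<^sup>2" for n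
  have aS: "a (Suc n) = a n * ((2 * real n + 1) / (2 * real n + 2))\<^sup>2" for n
  proof -
    have "Suc n * Suc n * ((2 * Suc n) choose Suc n) = (2 * n + 1) * (2 * Suc n) * ((2 * n) choose n)"
    proof -
      have "Suc n * ((2 * Suc n) choose Suc n) = (2 * Suc n) * (Suc (2 * n) choose n)"
        using binomial_absorption[of n "2 * Suc n"] by (simp del: binomial_Suc_Suc)
      moreover have "Suc n * (Suc (2 * n) choose n) = Suc (2 * n) * ((2 * n) choose n)"
        using binomial_absorb_comp[of "Suc (2 * n)" n] by simp
      ultimately show ?thesis by (metis Suc_eq_plus1 mult.assoc mult.left_commute)
    qed
    then have "real (Suc n * Suc n * ((2 * Suc n) choose Suc n)) = real ((2 * n + 1) * (2 * Suc n) * ((2 * n) choose n))"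
      by (simp only:)
    then have "(real n + 1) * ((real n + 1) * cbin (Suc n) 0) = (real n + 1) * (2 * (2 * real n + 1) * cbin n 0)"
      by (simp add: cbin_def algebra_simps)
    then have "(real n + 1) * cbin (Suc n) 0 = 2 * (2 * real n + 1) * cbin n 0"
      by (subst (asm) mult_cancel_left) auto
    then have "cbin (Suc n) 0 / 4 ^ Suc n = cbin n 0 / 4 ^ n * ((2 * real n + 1) / (2 * real n + 2))"
    proof -
      have *: "x / (4 * z) = y / z * (w / (2 * m))" if "m * x = 2 * w * y" "m \<noteq> 0" "z \<noteq> 0" for x y z w m :: real
        using that by (simp add: field_simps)
      show ?thesis using *[OF \<open>(real n + 1) * cbin (Suc n) 0 = 2 * (2 * real n + 1) * cbin n 0\<close>, of "4 ^ n"] by (simp add: distrib_left)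
    qed
    then show ?thesis unfolding a_def by (simp only: power_mult_distrib)
  qed
  have a0: "0 \<le> a n" for n by (simp add: a_def)
  \<comment> \<open>The factor \<open>2 * n + 1\<close> makes the bound inductive: with it the
    sequence decreases, whereas \<open>n * a n\<close> increases.\<close>
  have up: "(2 * real n + 1) * a n \<le> 1" for n
  proof (induction n)
    case 0 then show ?case by (simp add: a_def cbin_def)
  next
    case (Suc n)
    have "(2 * real n + 3) * ((2 * real n + 1) / (2 * real n + 2))\<^sup>2 \<le> 2 * real n + 1"
      by (simp add: divide_simps power2_eq_square) (simp add: algebra_simps)
    from mult_right_mono[OF this a0[of n]]
    have "(2 * real (Suc n) + 1) * a (Suc n) \<le> (2 * real n + 1) * a n"
      unfolding aS by (simp add: mult_ac add.commute)
    then show ?case using Suc by simp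
  qed
  have "incseq (\<lambda>n. real n * a n)"
  proof (rule incseq_SucI)
    fix n
    have "real n \<le> (real n + 1) * ((2 * real n + 1) / (2 * real n + 2))\<^sup>2"
      by (simp add: divide_simps power2_eq_square) (simp add: algebra_simps)
    from mult_right_mono[OF this a0[of n]]
    show "real n * a n \<le> real (Suc n) * a (Suc n)"
      unfolding aS by (simp add: mult_ac add.commute)
  qed
  moreover have "real n * a n \<le> 1" for n
    using up[of n] a0[of n] mult_right_mono[OF _ a0[of n], of "real n" "2 * real n + 1"] by linarith
  ultimately obtain L where "(\<lambda>n. real n * a n) \<longlonglongrightarrow> L" using incseq_convergent by blast
  then show ?thesis unfolding a_def by (auto simp: convergent_def)
qed

lemma infsum_even_int:
  fixes f :: "int \<Rightarrow> real"
  assumes f: "f summable_on UNIV" and even: "\<And>k. f (- k) = f k"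
  shows "(\<lambda>n. f (int (Suc n))) sums ((infsum f UNIV - f 0) / 2)"
proof -
  let ?P = "range (\<lambda>n. int (Suc n))" and ?M = "range (\<lambda>n. - int (Suc n))"
  have U: "UNIV = {0} \<union> (?P \<union> ?M)"
  proof -
    have "k \<in> {0} \<union> (?P \<union> ?M)" for k
      by (cases k rule: int_cases3) (auto simp: image_iff dest!: gr0_implies_Suc)
    then show ?thesis by blast
  qed
  have sm: "f summable_on A" for A using f by (rule summable_on_subset_banach) simp
  have P: "infsum f ?P = (\<Sum>\<^sub>\<infinity>n. f (int (Suc n)))" and sP: "(\<lambda>n. f (int (Suc n))) summable_on UNIV"
    using sm[of ?P] by (simp_all add: infsum_reindex summable_on_reindex inj_on_def o_def)
  have M: "infsum f ?M = (\<Sum>\<^sub>\<infinity>n. f (int (Suc n)))"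
    by (subst infsum_reindex) (simp_all add: inj_on_def o_def even[of "int (Suc _)", simplified])
  have "infsum f UNIV = infsum f {0} + (infsum f ?P + infsum f ?M)"
    by (subst U, subst infsum_Un_disjoint[OF sm sm], force, subst infsum_Un_disjoint[OF sm sm]) (auto)
  then have "(infsum f UNIV - f 0) / 2 = (\<Sum>\<^sub>\<infinity>n. f (int (Suc n)))" using P M by simp
  then show ?thesis using has_sum_imp_sums[OF has_sum_infsum[OF sP]] by simp
qed

lemma floor_square_lim:
  assumes "0 < c"
  defines "n \<equiv> \<lambda>M. nat \<lfloor>c * (2 * real M + 1)\<^sup>2\<rfloor>"
  shows "(\<lambda>M. real (n M) / (2 * real M + 1)\<^sup>2) \<longlonglongrightarrow> c"
proof (rule tendsto_sandwich[of "\<lambda>M. c - 1 / (2 * real M + 1)\<^sup>2" _ _ "\<lambda>M. c"])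
  have b: "c * (2 * real M + 1)\<^sup>2 - 1 \<le> real (n M)" "real (n M) \<le> c * (2 * real M + 1)\<^sup>2" for M
  proof -
    have "0 \<le> c * (2 * real M + 1)\<^sup>2" using assms(1) by simp
    then have "real (n M) = of_int \<lfloor>c * (2 * real M + 1)\<^sup>2\<rfloor>" unfolding n_def by simp
    then show "c * (2 * real M + 1)\<^sup>2 - 1 \<le> real (n M)" "real (n M) \<le> c * (2 * real M + 1)\<^sup>2" by linarith+
  qed
  show "eventually (\<lambda>M. c - 1 / (2 * real M + 1)\<^sup>2 \<le> real (n M) / (2 * real M + 1)\<^sup>2) sequentially"
    "eventually (\<lambda>M. real (n M) / (2 * real M + 1)\<^sup>2 \<le> c) sequentially"
  proof -
    have "c - 1 / (2 * real M + 1)\<^sup>2 \<le> real (n M) / (2 * real M + 1)\<^sup>2 \<and> real (n M) / (2 * real M + 1)\<^sup>2 \<le> c" for M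
    proof -
      have "0 < (2 * real M + 1)\<^sup>2" using zero_less_power[of "2 * real M + 1" 2] by linarith
      moreover have "c - 1 / z \<le> y / z \<and> y / z \<le> c" if "c * z - 1 \<le> y" "y \<le> c * z" "0 < z" for y z
      proof -
        have "c - 1 / z = (c * z - 1) / z" using that by (simp add: diff_divide_distrib)
        also have "\<dots> \<le> y / z" using that by (intro divide_right_mono) auto
        finally show ?thesis using that by (simp add: pos_divide_le_eq)
      qed
      ultimately show ?thesis using b by blast
    qed
    then show "eventually (\<lambda>M. c - 1 / (2 * real M + 1)\<^sup>2 \<le> real (n M) / (2 * real M + 1)\<^sup>2) sequentially"
      "eventually (\<lambda>M. real (n M) / (2 * real M + 1)\<^sup>2 \<le> c) sequentially" by simp_all
  qed
  show "(\<lambda>M. c - 1 / (2 * real M + 1)\<^sup>2) \<longlonglongrightarrow> c" by real_asymp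
qed auto

text \<open>Polya's proof of the functional equation: with \<open>n \<approx> c N\<^sup>2\<close>, both sides of \<open>sum_cos_power_eq\<close>
  converge, after division by the central binomial coefficient and by \<open>4 ^ n\<close> respectively.\<close>

lemma theta3_Polya:
  assumes c: "0 < c"
  shows "(theta3 (1 / c))\<^sup>2 * lim (\<lambda>n. real n * (cbin n 0 / 4 ^ n)\<^sup>2) = c * (theta3 (c * pi\<^sup>2))\<^sup>2"
proof -
  define K where "K = lim (\<lambda>n. real n * (cbin n 0 / 4 ^ n)\<^sup>2)"
  define N where "N M = 2 * M + 1" for M :: nat
  define n where "n M = nat \<lfloor>c * (2 * real M + 1)\<^sup>2\<rfloor>" for M
  have rN: "real (N M) = 2 * real M + 1" for M by (simp add: N_def)
  have lim_c: "(\<lambda>M. real (n M) / (real (N M))\<^sup>2) \<longlonglongrightarrow> c"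
    using floor_square_lim[OF c] unfolding n_def rN by simp
  have lim_0: "(\<lambda>M. a / real (N M)) \<longlonglongrightarrow> 0" for a :: real unfolding rN by real_asymp
  have n_top: "filterlim n at_top sequentially"
  proof -
    have "filterlim (\<lambda>M. \<lfloor>c * (2 * real M + 1)\<^sup>2\<rfloor>) at_top sequentially"
      by (rule filterlim_compose[OF filterlim_floor_sequentially]) (use c in real_asymp)
    then show ?thesis unfolding n_def by (rule filterlim_compose[OF filterlim_nat_sequentially])
  qed
  have nle: "real (n M) \<le> c * (real (N M))\<^sup>2" for M
  proof -
    have "0 \<le> c * (real (N M))\<^sup>2" using c by simp
    then have "real (n M) = of_int \<lfloor>c * (real (N M))\<^sup>2\<rfloor>" unfolding n_def rN by simp
    then show ?thesis by linarith
  qed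
  \<comment> \<open>From \<open>M0\<close> on, \<open>n\<close> is at least half of
    \<open>c * N\<^sup>2\<close>. This gives a majorant of the cosine side independent of
    \<open>M\<close>, and keeps a fixed multiple of \<open>N\<close> below \<open>n\<close> in the
    lower binomial bound.\<close>
  obtain M0 where M0: "\<And>M. M \<ge> M0 \<Longrightarrow> c / 2 * (real (N M))\<^sup>2 \<le> real (n M) \<and> 1 \<le> n M"
  proof -
    have "eventually (\<lambda>M. c / 2 < real (n M) / (real (N M))\<^sup>2) sequentially"
      using order_tendstoD(1)[OF lim_c, of "c / 2"] c by simp
    moreover have "eventually (\<lambda>M. 1 \<le> n M) sequentially"
      using n_top by (simp add: filterlim_at_top)
    ultimately have "eventually (\<lambda>M. c / 2 * (real (N M))\<^sup>2 \<le> real (n M) \<and> 1 \<le> n M) sequentially"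
      by eventually_elim (auto simp: rN field_simps add_nonneg_pos)
    then show ?thesis using that unfolding eventually_sequentially by blast
  qed
  define L where "L M = (\<Sum>\<^sub>\<infinity>k::int. cbin (n M) (nat \<bar>k\<bar> * N M) / cbin (n M) 0)" for M
  define R where "R M = (\<Sum>\<^sub>\<infinity>j::int. if \<bar>j\<bar> \<le> int M then (cos (pi * of_int j / real (N M))) ^ (2 * n M) else 0)" for M
  have rel: "real (N M) * (cbin (n M) 0 / 4 ^ n M) * L M = R M" for M
  proof -
    have "R M = (\<Sum>j\<in>{- int M..int M}. (cos (pi * of_int j / real (N M))) ^ (2 * n M))"
      unfolding R_def by (subst infsum_finite[symmetric], simp, intro infsum_cong_neutral) auto
    then have "4 ^ n M * R M = (\<Sum>j\<in>{- int M..int M}. (2 * cos (pi * of_int j / real (N M))) ^ (2 * n M))"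
      by (simp add: sum_distrib_left power_mult_distrib power_mult)
    also have "\<dots> = real (N M) * (\<Sum>\<^sub>\<infinity>k::int. cbin (n M) (nat \<bar>k\<bar> * N M))"
      unfolding N_def by (rule sum_cos_power_eq)
    also have "\<dots> = real (N M) * (\<Sum>\<^sub>\<infinity>k::int. cbin (n M) 0 * (cbin (n M) (nat \<bar>k\<bar> * N M) / cbin (n M) 0))"
      using cbin_pos[of "n M"] by simp
    also have "\<dots> = real (N M) * (cbin (n M) 0 * L M)" unfolding L_def infsum_cmult_right' ..
    finally show ?thesis by (simp add: field_simps)
  qed
  have "(\<lambda>M. L (M + M0)) \<longlonglongrightarrow> theta3 (1 / c)"
    unfolding L_def theta3_def
  proof (rule dominated_convergence_infsum)
    show "gauss (1 / (2 * c)) summable_on UNIV" using c by simp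
  next
    fix M and k :: int
    let ?M = "M + M0"
    define l where "l = nat \<bar>k\<bar> * N ?M"
    have n1: "1 \<le> n ?M" using M0[of ?M] by simp
    have "cbin (n ?M) l \<le> cbin (n ?M) 0 * gauss (1 / (2 * c)) k"
    proof (cases "l \<le> n ?M")
      case True
      have "(of_int k)\<^sup>2 / (2 * c) \<le> (real l)\<^sup>2 / (real (n ?M) + real (n ?M))"
      proof -
        have "(of_int k)\<^sup>2 / (2 * c) = (real l)\<^sup>2 / (2 * (c * (real (N ?M))\<^sup>2))"
        proof -
          have "(real l)\<^sup>2 = (of_int k)\<^sup>2 * (real (N ?M))\<^sup>2" by (simp add: l_def power_mult_distrib)
          moreover have "(real (N ?M))\<^sup>2 \<noteq> 0" by (simp add: N_def)
          ultimately show ?thesis using c by simp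
        qed
        also have "\<dots> \<le> (real l)\<^sup>2 / (2 * real (n ?M))"
          using nle[of ?M] n1 c by (intro divide_left_mono mult_left_mono mult_pos_pos) (auto simp: N_def)
        finally show ?thesis by simp
      qed
      then have "exp (- (real l)\<^sup>2 / (real (n ?M) + real (n ?M))) \<le> gauss (1 / (2 * c)) k"
        by (simp add: gauss_def)
      then show ?thesis using cbin_upper[OF True, of "n ?M"] cbin_pos[of "n ?M"]
        by (meson mult_left_mono order_trans less_imp_le)
    next
      case False
      then show ?thesis using cbin_pos[of "n ?M"] by (simp add: cbin_eq_0)
    qed
    then show "\<bar>cbin (n ?M) (nat \<bar>k\<bar> * N ?M) / cbin (n ?M) 0\<bar> \<le> gauss (1 / (2 * c)) k"
      using cbin_pos[of "n ?M"] cbin_nonneg by (simp add: l_def field_simps)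
  next
    fix k :: int
    define a where "a = real_of_int \<bar>k\<bar>"
    have al: "real (nat \<bar>k\<bar> * N M) = a * real (N M)" for M by (simp add: a_def)
    have e: "(a * x)\<^sup>2 / (y + d * (a * x)) = a\<^sup>2 / (y / x\<^sup>2 + d * (a / x))" if "x > 0" for x y d :: real
      using that by (simp add: field_simps power2_eq_square)
    \<comment> \<open>\<open>d = 1\<close> and \<open>d = - 1\<close> are the exponents of
      \<open>cbin_upper\<close> and \<open>cbin_lower\<close> with \<open>L = l\<close>; both have
      the same limit because \<open>l / N\<^sup>2\<close> tends to 0.\<close>
    have lm: "(\<lambda>M. exp (- (real (nat \<bar>k\<bar> * N M))\<^sup>2 / (real (n M) + d * real (nat \<bar>k\<bar> * N M)))) \<longlonglongrightarrow> gauss (1 / c) k" for d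
    proof -
      have "(\<lambda>M. exp (- (a\<^sup>2 / (real (n M) / (real (N M))\<^sup>2 + d * (a / real (N M)))))) \<longlonglongrightarrow> exp (- (a\<^sup>2 / (c + d * 0)))"
        using c by (intro tendsto_intros lim_c lim_0) auto
      moreover have "exp (- (a\<^sup>2 / (c + d * 0))) = gauss (1 / c) k" by (simp add: a_def gauss_def)
      ultimately show ?thesis unfolding al minus_divide_left[symmetric] by (subst e) (auto simp: rN add_nonneg_pos)
    qed
    have "(\<lambda>M. cbin (n M) (nat \<bar>k\<bar> * N M) / cbin (n M) 0) \<longlonglongrightarrow> gauss (1 / c) k"
    proof (rule tendsto_sandwich[OF _ _ lm[of "-1"] lm[of 1]])
      have "(\<lambda>M. a / real (N M)) \<longlonglongrightarrow> 0" by (rule lim_0)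
      then have "eventually (\<lambda>M. a / real (N M) < c / 2) sequentially"
        by (rule order_tendstoD) (use c in auto)
      then have "eventually (\<lambda>M. nat \<bar>k\<bar> * N M < n M) sequentially"
        using eventually_ge_at_top[of M0]
      proof eventually_elim
        case (elim M)
        have N0: "real (N M) > 0" by (simp add: rN add_nonneg_pos)
        have "a * real (N M) = (a / real (N M)) * (real (N M))\<^sup>2" using N0 by (simp add: power2_eq_square)
        also have "\<dots> < c / 2 * (real (N M))\<^sup>2" using elim N0 by (intro mult_strict_right_mono) auto
        also have "\<dots> \<le> real (n M)" using M0 elim by auto
        finally have "real (nat \<bar>k\<bar> * N M) < real (n M)" unfolding al .
        then show ?case by (simp only: of_nat_less_iff)
      qed
      then show "eventually (\<lambda>M. exp (- (real (nat \<bar>k\<bar> * N M))\<^sup>2 / (real (n M) + - 1 * real (nat \<bar>k\<bar> * N M)))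
           \<le> cbin (n M) (nat \<bar>k\<bar> * N M) / cbin (n M) 0) sequentially"
      proof eventually_elim
        case (elim M)
        show ?case using cbin_lower[OF order_refl elim] cbin_pos[of "n M"] by (simp add: field_simps)
      qed
      show "eventually (\<lambda>M. cbin (n M) (nat \<bar>k\<bar> * N M) / cbin (n M) 0
          \<le> exp (- (real (nat \<bar>k\<bar> * N M))\<^sup>2 / (real (n M) + 1 * real (nat \<bar>k\<bar> * N M)))) sequentially"
      proof (rule always_eventually, rule allI)
        fix M
        show "cbin (n M) (nat \<bar>k\<bar> * N M) / cbin (n M) 0
          \<le> exp (- (real (nat \<bar>k\<bar> * N M))\<^sup>2 / (real (n M) + 1 * real (nat \<bar>k\<bar> * N M)))"
          using cbin_upper[OF order_refl, of "n M" "nat \<bar>k\<bar> * N M"] cbin_pos[of "n M"] by (simp add: field_simps)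
      qed
    qed
    then show "(\<lambda>M. cbin (n (M + M0)) (nat \<bar>k\<bar> * N (M + M0)) / cbin (n (M + M0)) 0) \<longlonglongrightarrow> gauss (1 / c) k"
      by (rule LIMSEQ_ignore_initial_segment)
  qed
  then have L: "L \<longlonglongrightarrow> theta3 (1 / c)" by (rule LIMSEQ_offset)
  have "(\<lambda>M. R (M + M0)) \<longlonglongrightarrow> theta3 (c * pi\<^sup>2)"
    unfolding R_def theta3_def
  proof (rule dominated_convergence_infsum)
    show "gauss (c * pi\<^sup>2 / 2) summable_on UNIV" using c by simp
  next
    fix M and j :: int
    let ?M = "M + M0"
    let ?x = "pi * of_int j / real (N ?M)"
    have N0: "real (N ?M) > 0" by (simp add: rN add_nonneg_pos)
    have "(cos ?x) ^ (2 * n ?M) \<le> gauss (c * pi\<^sup>2 / 2) j \<and> 0 \<le> (cos ?x) ^ (2 * n ?M)" if "\<bar>j\<bar> \<le> int ?M"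
    proof -
      have "\<bar>?x\<bar> = pi * (of_int \<bar>j\<bar> / real (N ?M))" using N0 by (simp add: abs_mult)
      also have "\<dots> \<le> pi * (1 / 2)"
      proof (rule mult_left_mono)
        have "real_of_int \<bar>j\<bar> \<le> real_of_int (int ?M)" using that by (simp only: of_int_le_iff)
        then show "real_of_int \<bar>j\<bar> / real (N ?M) \<le> 1 / 2" using N0 by (simp add: rN field_simps)
      qed simp
      finally have x: "\<bar>?x\<bar> \<le> pi / 2" by simp
      then have "- (pi / 2) \<le> ?x" "?x \<le> pi / 2" unfolding abs_le_iff by linarith+
      then have c0: "0 \<le> cos ?x" by (rule cos_ge_zero)
      have "(cos ?x) ^ (2 * n ?M) \<le> exp (- ?x\<^sup>2 / 2) ^ (2 * n ?M)"
        using cos_le_exp[OF x] c0 by (rule power_mono)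
      also have "\<dots> = exp (- (real (n ?M) * ?x\<^sup>2))" by (simp add: exp_of_nat_mult[symmetric])
      also have "real (n ?M) * ?x\<^sup>2 \<ge> (c / 2 * (real (N ?M))\<^sup>2) * ?x\<^sup>2"
        using M0[of ?M] by (intro mult_right_mono) auto
      then have "exp (- (real (n ?M) * ?x\<^sup>2)) \<le> exp (- ((c / 2 * (real (N ?M))\<^sup>2) * ?x\<^sup>2))" by simp
      also have "\<dots> = gauss (c * pi\<^sup>2 / 2) j"
        using N0 by (simp add: gauss_def power_mult_distrib power_divide)
      finally show ?thesis using c0 by simp
    qed
    then show "\<bar>if \<bar>j\<bar> \<le> int ?M then (cos ?x) ^ (2 * n ?M) else 0\<bar> \<le> gauss (c * pi\<^sup>2 / 2) j"
      by simp
  next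
    fix j :: int
    define x where "x M = pi * of_int j / real (N M)" for M
    have N0: "real (N M) > 0" for M by (simp add: rN add_nonneg_pos)
    have x0: "x \<longlonglongrightarrow> 0" unfolding x_def by (rule lim_0)
    have nx: "(\<lambda>M. real (n M) * (x M)\<^sup>2) \<longlonglongrightarrow> c * (pi\<^sup>2 * (of_int j)\<^sup>2)"
    proof -
      have "(\<lambda>M. real (n M) / (real (N M))\<^sup>2 * (pi\<^sup>2 * (of_int j)\<^sup>2)) \<longlonglongrightarrow> c * (pi\<^sup>2 * (of_int j)\<^sup>2)"
        by (intro tendsto_intros lim_c)
      then show ?thesis by (simp add: x_def power_divide power_mult_distrib)
    qed
    have "(\<lambda>M. if \<bar>j\<bar> \<le> int M then cos (x M) ^ (2 * n M) else 0) \<longlonglongrightarrow> gauss (c * pi\<^sup>2) j"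
    proof (rule tendsto_sandwich)
      have "eventually (\<lambda>M. \<bar>x M\<bar> < 1) sequentially"
        using order_tendstoD(2)[OF tendsto_rabs[OF x0], of 1] by simp
      then have ev: "eventually (\<lambda>M. \<bar>x M\<bar> < 1 \<and> \<bar>j\<bar> \<le> int M) sequentially"
        using eventually_ge_at_top[of "nat \<bar>j\<bar>"] by eventually_elim auto
      then show "eventually (\<lambda>M. exp (- (real (n M) * (x M)\<^sup>2) / (1 - (x M)\<^sup>2 / 2))
          \<le> (if \<bar>j\<bar> \<le> int M then cos (x M) ^ (2 * n M) else 0)) sequentially"
      proof eventually_elim
        case (elim M)
        define y where "y = (x M)\<^sup>2 / 2"
        have "(x M)\<^sup>2 < 1" using elim by (simp add: abs_square_less_1)
        then have y: "0 \<le> y" "y < 1" by (auto simp: y_def)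
        have "exp (- (y / (1 - y))) \<le> 1 - y"
          using exp_ge_add_one_self[of "y / (1 - y)"] y by (simp add: exp_minus field_simps)
        also have "1 - y \<le> cos (x M)" unfolding y_def by (rule cos_ge_one_minus_half_square)
        finally have "exp (- (y / (1 - y))) ^ (2 * n M) \<le> cos (x M) ^ (2 * n M)" by (rule power_mono) simp
        moreover have "exp (- (y / (1 - y))) ^ (2 * n M) = exp (- (real (n M) * (x M)\<^sup>2) / (1 - (x M)\<^sup>2 / 2))"
        proof -
          have "real (2 * n M) * - (y / (1 - y)) = - (real (n M) * (2 * y)) / (1 - y)" by simp
          moreover have "2 * y = (x M)\<^sup>2" by (simp add: y_def)
          ultimately show ?thesis unfolding exp_of_nat_mult[symmetric] by (simp only: y_def)
        qed
        ultimately show ?case using elim by simp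
      qed
      show "eventually (\<lambda>M. (if \<bar>j\<bar> \<le> int M then cos (x M) ^ (2 * n M) else 0) \<le> exp (- (real (n M) * (x M)\<^sup>2))) sequentially"
        using ev
      proof eventually_elim
        case (elim M)
        have "\<bar>x M\<bar> \<le> pi / 2" using elim pi_gt3 by linarith
        then have "cos (x M) ^ (2 * n M) \<le> exp (- (x M)\<^sup>2 / 2) ^ (2 * n M)"
          by (intro power_mono cos_le_exp cos_ge_zero) auto
        also have "\<dots> = exp (- (real (n M) * (x M)\<^sup>2))" by (simp add: exp_of_nat_mult[symmetric])
        finally show ?case using elim by simp
      qed
      have "(\<lambda>M. exp (- (real (n M) * (x M)\<^sup>2) / (1 - (x M)\<^sup>2 / 2))) \<longlonglongrightarrow> exp (- (c * (pi\<^sup>2 * (of_int j)\<^sup>2)) / (1 - 0\<^sup>2 / 2))"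
        by (intro tendsto_intros nx x0) auto
      then show "(\<lambda>M. exp (- (real (n M) * (x M)\<^sup>2) / (1 - (x M)\<^sup>2 / 2))) \<longlonglongrightarrow> gauss (c * pi\<^sup>2) j"
        by (simp add: gauss_def mult.assoc)
      have "(\<lambda>M. exp (- (real (n M) * (x M)\<^sup>2))) \<longlonglongrightarrow> exp (- (c * (pi\<^sup>2 * (of_int j)\<^sup>2)))"
        by (intro tendsto_intros nx)
      then show "(\<lambda>M. exp (- (real (n M) * (x M)\<^sup>2))) \<longlonglongrightarrow> gauss (c * pi\<^sup>2) j"
        by (simp add: gauss_def mult.assoc)
    qed
    then have "(\<lambda>M. if \<bar>j\<bar> \<le> int (M + M0) then cos (x (M + M0)) ^ (2 * n (M + M0)) else 0) \<longlonglongrightarrow> gauss (c * pi\<^sup>2) j"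
      by (rule LIMSEQ_ignore_initial_segment)
    then show "(\<lambda>M. if \<bar>j\<bar> \<le> int (M + M0) then cos (pi * of_int j / real (N (M + M0))) ^ (2 * n (M + M0)) else 0) \<longlonglongrightarrow> gauss (c * pi\<^sup>2) j"
      unfolding x_def .
  qed
  then have R: "R \<longlonglongrightarrow> theta3 (c * pi\<^sup>2)" by (rule LIMSEQ_offset)
  have K: "(\<lambda>M. real (n M) * (cbin (n M) 0 / 4 ^ n M)\<^sup>2) \<longlonglongrightarrow> K"
    unfolding K_def using central_binomial_convergent
    by (intro filterlim_compose[OF _ n_top]) (simp add: convergent_LIMSEQ_iff)
  \<comment> \<open>The prefactor in \<open>rel\<close> is of the size of the square root of a
    convergent quantity; squaring avoids the root, which is why the functional equation appears in
    squared form.\<close>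
  have "(\<lambda>M. real (n M) * (cbin (n M) 0 / 4 ^ n M)\<^sup>2 * (L M)\<^sup>2) \<longlonglongrightarrow> K * (theta3 (1 / c))\<^sup>2"
    by (intro tendsto_intros K L)
  moreover have "real (n M) * (cbin (n M) 0 / 4 ^ n M)\<^sup>2 * (L M)\<^sup>2 = real (n M) / (real (N M))\<^sup>2 * (R M)\<^sup>2" for M
  proof -
    have "(R M)\<^sup>2 = (real (N M))\<^sup>2 * ((cbin (n M) 0 / 4 ^ n M)\<^sup>2 * (L M)\<^sup>2)"
      unfolding rel[symmetric] power_mult_distrib by simp
    then show ?thesis by (simp add: rN add_nonneg_pos)
  qed
  moreover have "(\<lambda>M. real (n M) / (real (N M))\<^sup>2 * (R M)\<^sup>2) \<longlonglongrightarrow> c * (theta3 (c * pi\<^sup>2))\<^sup>2"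
    by (intro tendsto_intros lim_c R)
  ultimately have "K * (theta3 (1 / c))\<^sup>2 = c * (theta3 (c * pi\<^sup>2))\<^sup>2"
    using LIMSEQ_unique by simp
  then show ?thesis by (simp add: K_def mult.commute)
qed

lemma theta3_ge_1: "0 < s \<Longrightarrow> 1 \<le> theta3 s"
proof -
  assume s: "0 < s"
  have "(\<Sum>k\<in>{0}. gauss s k) \<le> theta3 s" unfolding theta3_def
    by (rule finite_sum_le_infsum) (use s in auto)
  then show ?thesis by simp
qed

theorem theta3_functional_equation:
  assumes s: "0 < s"
  shows "s * (theta3 s)\<^sup>2 = pi * (theta3 (pi\<^sup>2 / s))\<^sup>2"
proof -
  define K where "K = lim (\<lambda>n. real n * (cbin n 0 / 4 ^ n)\<^sup>2)"
  have *: "pi\<^sup>2 * ((theta3 (pi\<^sup>2 / t))\<^sup>2 * K) = t * (theta3 t)\<^sup>2" if "0 < t" for t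
    using theta3_Polya[of "t / pi\<^sup>2"] that unfolding K_def[symmetric] by (simp add: field_simps)
  \<comment> \<open>At the fixed point \<open>pi\<close> of
    \<open>t \<mapsto> pi\<^sup>2 / t\<close> the two theta values coincide and cancel, leaving the
    constant.\<close>
  have "K * pi = 1" using *[of pi] theta3_ge_1[of pi]
    by (simp add: power2_eq_square mult.commute)
  have "s * (theta3 s)\<^sup>2 = (K * pi) * (pi * (theta3 (pi\<^sup>2 / s))\<^sup>2)"
    using *[OF s] by (simp add: power2_eq_square mult_ac)
  then show ?thesis unfolding \<open>K * pi = 1\<close> by simp
qed

section \<open>Logarithmic convexity of the theta function\<close>

definition gauss_moment :: "nat \<Rightarrow> real \<Rightarrow> real" where
  "gauss_moment j s = (\<Sum>n. real (Suc n) ^ (2 * j) * exp (- (real (Suc n))\<^sup>2 * s))"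

text \<open>Uses \<open>exp y \<ge> (y / 3) ^ 3\<close> with \<open>y = m\<^sup>2 * a\<close>. The
  third power leaves a summable \<open>1 / m\<^sup>2\<close> even against the weight
  \<open>m ^ 4\<close> of the second moment; \<open>27 = 3 ^ 3\<close>.\<close>

lemma gauss_moment_term_bound:
  assumes "j \<le> 2" "0 < a" "a \<le> s"
  shows "real (Suc n) ^ (2 * j) * exp (- (real (Suc n))\<^sup>2 * s) \<le> 27 / a ^ 3 * (1 / (real (Suc n))\<^sup>2)"
proof -
  define m where "m = real (Suc n)"
  have m: "1 \<le> m" by (simp add: m_def)
  have "(m\<^sup>2 * a / 3) ^ 3 \<le> exp (m\<^sup>2 * a / 3) ^ 3"
  proof (rule power_mono)
    show "m\<^sup>2 * a / 3 \<le> exp (m\<^sup>2 * a / 3)" using exp_ge_add_one_self[of "m\<^sup>2 * a / 3"] by linarith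
  qed (use assms in auto)
  also have "\<dots> = exp (m\<^sup>2 * a)" by (simp add: exp_of_nat_mult[symmetric])
  finally have e: "m ^ 6 * a ^ 3 / 27 \<le> exp (m\<^sup>2 * a)" by (simp add: power_divide power_mult_distrib power_mult[symmetric])
  have "m ^ (2 * j) * exp (- m\<^sup>2 * s) \<le> m ^ 4 * exp (- m\<^sup>2 * a)"
    using assms m by (intro mult_mono power_increasing) auto
  also have "\<dots> = m ^ 4 / exp (m\<^sup>2 * a)" by (simp add: exp_minus divide_inverse)
  also have "\<dots> \<le> m ^ 4 / (m ^ 6 * a ^ 3 / 27)"
    using e m assms by (intro divide_left_mono mult_pos_pos) auto
  also have "\<dots> = 27 / a ^ 3 * (1 / m\<^sup>2)"
  proof -
    have "m ^ 6 = m ^ 4 * m\<^sup>2" by (simp add: power_add[symmetric])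
    have *: "x / (x * y * z / 27) = 27 / z * (1 / y)" if "x \<noteq> 0" for x y z :: real
      using that by simp
    show ?thesis unfolding \<open>m ^ 6 = m ^ 4 * m\<^sup>2\<close> by (rule *) (use m in simp)
  qed
  finally show ?thesis unfolding m_def .
qed

lemma summable_inverse_Suc_squares: "summable (\<lambda>n. c * (1 / (real (Suc n))\<^sup>2))"
  using summable_Suc_iff[THEN iffD2, OF inverse_power_summable[of 2, where 'a=real]]
  by (intro summable_mult) (simp add: divide_inverse)

lemma gauss_moment_summable:
  assumes "j \<le> 2" "0 < s"
  shows "summable (\<lambda>n. real (Suc n) ^ (2 * j) * exp (- (real (Suc n))\<^sup>2 * s))"
  by (rule summable_comparison_test'[OF summable_inverse_Suc_squares[of "27 / s ^ 3"]])
    (use gauss_moment_term_bound[OF assms order_refl] in \<open>simp del: of_nat_Suc\<close>)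

lemma gauss_moment_deriv:
  assumes "j \<le> 1" "0 < s"
  shows "(gauss_moment j has_real_derivative - gauss_moment (Suc j) s) (at s)"
proof -
  let ?f = "\<lambda>n s. real (Suc n) ^ (2 * j) * exp (- (real (Suc n))\<^sup>2 * s)"
  let ?f' = "\<lambda>n s. - (real (Suc n) ^ (2 * Suc j) * exp (- (real (Suc n))\<^sup>2 * s))"
  have "((\<lambda>x. \<Sum>n. ?f n x) has_field_derivative (\<Sum>n. ?f' n s)) (at s)"
  proof (rule has_field_derivative_series'(2))
    show "convex {s / 2..}" by simp
    show "(?f n has_field_derivative ?f' n x) (at x within {s / 2..})" for n x
      by (auto intro!: derivative_eq_intros simp: power2_eq_square algebra_simps)
    show "uniformly_convergent_on {s / 2..} (\<lambda>n x. \<Sum>i<n. ?f' i x)"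
    proof (rule Weierstrass_m_test'[OF _ summable_inverse_Suc_squares[of "27 / (s / 2) ^ 3"]])
      fix n x assume "x \<in> {s / 2..}"
      then show "norm (?f' n x) \<le> 27 / (s / 2) ^ 3 * (1 / (real (Suc n))\<^sup>2)"
        using gauss_moment_term_bound[of "Suc j" "s / 2" x n] assms by (simp del: of_nat_Suc)
    qed
    show "summable (\<lambda>n. ?f n s)" using gauss_moment_summable[of j s] assms by simp
  qed (use assms in auto)
  moreover have "(\<Sum>n. ?f' n s) = - gauss_moment (Suc j) s"
    unfolding gauss_moment_def using gauss_moment_summable[of "Suc j" s] assms by (intro suminf_minus) auto
  ultimately show ?thesis by (simp add: gauss_moment_def[abs_def])
qed

lemma gauss_moment_mono:
  assumes "i \<le> j" "j \<le> 2" "0 < s"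
  shows "gauss_moment i s \<le> gauss_moment j s"
  unfolding gauss_moment_def
  by (intro suminf_le gauss_moment_summable mult_right_mono power_increasing) (use assms in auto)

lemma gauss_moment_lower:
  assumes "j \<le> 2" "0 < s"
  shows "exp (- s) \<le> gauss_moment j s"
  using sum_le_suminf[OF gauss_moment_summable[OF assms], of "{0}"] by (simp add: gauss_moment_def)

lemma theta3_eq_gauss_moment:
  assumes "0 < s" shows "theta3 s = 1 + 2 * gauss_moment 0 s"
proof -
  have "(\<lambda>n. gauss s (int (Suc n))) sums ((theta3 s - 1) / 2)"
    using infsum_even_int[of "gauss s"] assms by (simp add: theta3_def)
  then have "gauss_moment 0 s = (theta3 s - 1) / 2"
    unfolding gauss_moment_def by (simp add: gauss_def sums_iff mult.commute)
  then show ?thesis by simp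
qed

text \<open>For \<open>s \<ge> 3\<close> one has \<open>exp (- s) \<le> 1 / 8\<close>, and
  \<open>(n + 1)\<^sup>2 \<le> 4 ^ n\<close> still leaves a geometric series of ratio
  \<open>1 / 2\<close>. The threshold 3 is chosen to lie below \<open>pi\<close>.\<close>

lemma gauss_moment_1_upper:
  assumes "3 \<le> s" shows "gauss_moment 1 s \<le> 1 / 4"
proof -
  have sq: "real (Suc n) ^ 2 \<le> 4 ^ n" for n
  proof (induction n)
    case (Suc n)
    have "real (Suc (Suc n)) ^ 2 \<le> 4 * real (Suc n) ^ 2" by (simp add: power2_eq_square algebra_simps)
    then show ?case using Suc by simp
  qed simp
  have "8 \<le> exp (3::real)" using exp_lower_Taylor_quadratic[of 3] by simp
  also have "\<dots> \<le> exp s" using assms by simp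
  finally have y: "exp (- s) \<le> 1 / 8" by (simp add: exp_minus field_simps)
  have "real (Suc n) ^ (2 * 1) * exp (- (real (Suc n))\<^sup>2 * s) \<le> 4 ^ n * (1 / 8) ^ Suc n" for n
  proof -
    have "real (Suc n) \<le> (real (Suc n))\<^sup>2" by (simp add: power2_eq_square)
    then have "exp (- (real (Suc n))\<^sup>2 * s) \<le> exp (real (Suc n) * - s)" using assms mult_right_mono[of "real (Suc n)" "(real (Suc n))\<^sup>2" s] by simp
    also have "\<dots> = exp (- s) ^ Suc n" by (rule exp_of_nat_mult)
    also have "\<dots> \<le> (1 / 8) ^ Suc n" using y by (intro power_mono) auto
    finally show ?thesis using sq[of n] by (intro mult_mono) auto
  qed
  moreover have "4 ^ n * (1 / 8) ^ Suc n = 1 / 8 * (1 / 2 :: real) ^ n" for n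
    by (simp add: power_divide field_simps power_mult_distrib[symmetric])
  ultimately have "gauss_moment 1 s \<le> (\<Sum>n. 1 / 8 * (1 / 2 :: real) ^ n)"
    unfolding gauss_moment_def using assms
    by (intro suminf_le gauss_moment_summable summable_mult summable_geometric) auto
  also have "\<dots> = 1 / 4" by (subst suminf_mult) (auto simp: suminf_geometric)
  finally show ?thesis .
qed

text \<open>Minus the derivative of \<open>ln (theta3 s)\<close> with respect to
  \<open>ln s\<close>.\<close>

definition theta3_logderiv :: "real \<Rightarrow> real" where
  "theta3_logderiv s = s * (2 * gauss_moment 1 s) / theta3 s"

lemma theta3_deriv: "0 < s \<Longrightarrow> (theta3 has_real_derivative - (2 * gauss_moment 1 s)) (at s)"
proof -
  assume s: "0 < s"
  have "((\<lambda>s. 1 + 2 * gauss_moment 0 s) has_real_derivative - (2 * gauss_moment 1 s)) (at s)"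
    by (rule derivative_eq_intros gauss_moment_deriv refl | use s in simp)+
  then show ?thesis
    by (rule has_field_derivative_transform_within_open[of _ _ _ "{0<..}"]) (use s in \<open>auto simp: theta3_eq_gauss_moment\<close>)
qed

text \<open>With \<open>A = theta3\<close>, \<open>B = - A'\<close> and \<open>C = A''\<close>: as \<open>B \<le> C\<close>, the numerator \<open>(B - s C) A + s B\<^sup>2\<close>
  of the derivative is at most \<open>- B ((s - 1) A - s B)\<close>.\<close>

lemma theta3_logderiv_deriv:
  assumes s: "3 \<le> s"
  obtains D where "(theta3_logderiv has_real_derivative D) (at s)" "D \<le> - (exp (- s) / 4)"
proof -
  define A where "A = theta3 s"
  define B where "B = 2 * gauss_moment 1 s"
  define C where "C = 2 * gauss_moment 2 s"
  have s0: "0 < s" using s by simp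
  have A1: "1 \<le> A" unfolding A_def by (rule theta3_ge_1[OF s0])
  have BC: "B \<le> C" unfolding B_def C_def using gauss_moment_mono[of 1 2 s] s by simp
  have B2: "B \<le> 1 / 2" unfolding B_def using gauss_moment_1_upper[OF s] by simp
  have Blow: "2 * exp (- s) \<le> B" unfolding B_def using gauss_moment_lower[of 1 s] s by simp
  have B0: "0 < B" using Blow by (smt (verit) exp_gt_zero)
  have A2: "A \<le> 3 / 2" unfolding A_def theta3_eq_gauss_moment[OF s0]
    using gauss_moment_mono[of 0 1 s] B2 s by (simp add: B_def)
  have gB: "(gauss_moment 1 has_real_derivative - gauss_moment 2 s) (at s)"
    using gauss_moment_deriv[of 1 s] s by (simp add: numeral_2_eq_2)
  have "(theta3_logderiv has_real_derivative ((B - s * C) * A + s * B * B) / (A * A)) (at s)"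
    unfolding theta3_logderiv_def[abs_def]
    by (rule DERIV_cong[OF DERIV_divide[OF DERIV_mult[OF DERIV_ident DERIV_cmult[OF gB, of 2]] theta3_deriv[OF s0]]])
      (use A1 in \<open>simp_all add: A_def B_def C_def algebra_simps\<close>)
  moreover have "((B - s * C) * A + s * B * B) / (A * A) \<le> - (exp (- s) / 4)"
  proof -
    have "s * B * A \<le> s * C * A" using BC B0 s A1 by (intro mult_right_mono mult_left_mono) auto
    then have "(B - s * C) * A + s * B * B \<le> - (B * ((s - 1) * A - s * B))"
      by (simp add: algebra_simps)
    \<comment> \<open>With \<open>A \<ge> 1\<close> and \<open>B \<le> 1 / 2\<close> the bracket is
      at least \<open>s / 2 - 1\<close>, which is at least \<open>1 / 2\<close> for
      \<open>s \<ge> 3\<close>.\<close>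
    also have "\<dots> \<le> - (B * (1 / 2))"
    proof -
      have "s - 1 \<le> (s - 1) * A" using mult_left_mono[OF A1, of "s - 1"] s by simp
      moreover have "s * B \<le> s / 2" using mult_left_mono[OF B2, of s] s by simp
      ultimately have "1 / 2 \<le> (s - 1) * A - s * B" using s by linarith
      then show ?thesis using B0 by simp
    qed
    also have "\<dots> \<le> - exp (- s)" using Blow by simp
    finally have n: "(B - s * C) * A + s * B * B \<le> - exp (- s)" .
    have "A * A \<le> 3 / 2 * (3 / 2)" using A1 A2 by (intro mult_mono) auto
    then have "A * A * exp (- s) \<le> 4 * exp (- s)" by (intro mult_right_mono) auto
    moreover have "0 < A * A" using A1 by (intro mult_pos_pos) auto
    moreover have "x / y \<le> - (e / 4)" if "x \<le> - e" "y * e \<le> 4 * e" "0 < y" for x y e :: real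
      using that by (simp only: pos_divide_le_eq) (simp add: mult.commute)
    ultimately show ?thesis using n by blast
  qed
  ultimately show ?thesis by (rule that)
qed

section \<open>Convexity in the logarithmic coordinate\<close>

text \<open>The factor \<open>pi\<close> places the fixed point of the functional equation at
  \<open>t = 0\<close>, so that the equation becomes a symmetry under \<open>t \<mapsto> - t\<close>
  up to a linear term.\<close>

definition ltheta :: "real \<Rightarrow> real" where "ltheta t = ln (theta3 (pi * exp t))"

definition dltheta :: "real \<Rightarrow> real" where "dltheta t = - theta3_logderiv (pi * exp t)"

lemma ltheta_deriv: "(ltheta has_real_derivative dltheta t) (at t)"
proof -
  have p: "0 < pi * exp t" by simp
  have "((\<lambda>t. theta3 (pi * exp t)) has_real_derivative - (2 * gauss_moment 1 (pi * exp t)) * (pi * exp t)) (at t)"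
    by (rule DERIV_chain2[where f=theta3 and g="\<lambda>t. pi * exp t", OF theta3_deriv[OF p]]) (auto intro!: derivative_eq_intros)
  then show ?thesis
    unfolding ltheta_def[abs_def] dltheta_def theta3_logderiv_def
    using theta3_ge_1[OF p]
    by (auto intro!: derivative_eq_intros simp: field_simps)
qed

lemma ltheta_uminus: "ltheta (- t) = ltheta t + t / 2"
proof -
  have p: "0 < pi * exp t" "0 < pi * exp (- t)" by simp_all
  have "pi\<^sup>2 / (pi * exp t) = pi * exp (- t)" by (simp add: power2_eq_square exp_minus divide_inverse)
  then have "pi * (exp t * (theta3 (pi * exp t))\<^sup>2) = pi * (theta3 (pi * exp (- t)))\<^sup>2"
    using theta3_functional_equation[OF p(1)] by (simp add: mult.assoc)
  then have "ln (exp t * (theta3 (pi * exp t))\<^sup>2) = ln ((theta3 (pi * exp (- t)))\<^sup>2)" by simp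
  then show ?thesis
    using theta3_ge_1[OF p(1)] theta3_ge_1[OF p(2)]
    by (simp add: ltheta_def ln_mult ln_realpow)
qed

lemma dltheta_uminus: "dltheta (- t) = - dltheta t - 1 / 2"
proof -
  have "((\<lambda>t. ltheta (- t)) has_real_derivative dltheta (- t) * - 1) (at t)"
    by (rule DERIV_chain2[OF ltheta_deriv]) (auto intro!: derivative_eq_intros)
  moreover have "((\<lambda>t. ltheta t + t / 2) has_real_derivative dltheta t + 1 / 2) (at t)"
    by (rule derivative_eq_intros ltheta_deriv refl | simp)+
  ultimately show ?thesis
    unfolding ltheta_uminus using DERIV_unique by force
qed

text \<open>For \<open>t \<ge> 0\<close> the argument \<open>pi * exp t\<close> is at least 3, so
  \<open>theta3_logderiv_deriv\<close> applies; the bound at the right end \<open>z\<close> serves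
  as one rate for the whole interval.\<close>

lemma dltheta_increase:
  assumes "0 \<le> x" "x \<le> y" "y \<le> z"
  shows "exp (- (pi * exp z)) / 4 * (y - x) \<le> dltheta y - dltheta x"
proof -
  let ?c = "exp (- (pi * exp z)) / 4"
  have "dltheta x - ?c * x \<le> dltheta y - ?c * y"
  proof (rule DERIV_nonneg_imp_nondecreasing[OF assms(2)])
    fix t assume t: "x \<le> t" "t \<le> y"
    have e1: "1 \<le> exp t" using t assms by simp
    then have s: "3 \<le> pi * exp t" using pi_gt3 mult_mono[of 3 pi 1 "exp t"] by simp
    obtain D where D: "(theta3_logderiv has_real_derivative D) (at (pi * exp t))" "D \<le> - (exp (- (pi * exp t)) / 4)"
      using theta3_logderiv_deriv[OF s] .
    have "((\<lambda>t. theta3_logderiv (pi * exp t)) has_real_derivative D * (pi * exp t)) (at t)"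
      by (rule DERIV_chain2[where f=theta3_logderiv and g="\<lambda>t. pi * exp t", OF D(1)]) (auto intro!: derivative_eq_intros)
    then have "((\<lambda>t. dltheta t - ?c * t) has_real_derivative - (D * (pi * exp t)) - ?c) (at t)"
      unfolding dltheta_def by (auto intro!: derivative_eq_intros)
    moreover have "?c \<le> - (D * (pi * exp t))"
    proof -
      have "?c \<le> exp (- (pi * exp t)) / 4 * 1" using t assms by simp
      also have "\<dots> \<le> (- D) * (pi * exp t)"
        using D(2) s exp_gt_zero[of "- (pi * exp t)"] by (intro mult_mono) linarith+
      finally show ?thesis by simp
    qed
    ultimately show "\<exists>d. ((\<lambda>t. dltheta t - ?c * t) has_real_derivative d) (at t) \<and> 0 \<le> d" by force
  qed
  then show ?thesis unfolding right_diff_distrib by linarith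
qed

text \<open>Negative coordinates are reached by reflection, and intervals containing 0 are handled
  by comparing both ends with the value \<open>- 1 / 4\<close> at 0.\<close>

lemma dltheta_mono: assumes "x \<le> y" shows "dltheta x \<le> dltheta y"
proof -
  have pos: "dltheta x \<le> dltheta y" if "0 \<le> x" "x \<le> y" for x y
    using dltheta_increase[OF that order_refl] that by (smt (verit) mult_nonneg_nonneg exp_ge_zero divide_nonneg_pos)
  consider "0 \<le> x" | "y \<le> 0" | "x < 0" "0 < y" using assms by linarith
  then show ?thesis
  proof cases
    case 2
    then show ?thesis using pos[of "- y" "- x"] assms by (simp add: dltheta_uminus)
  next
    case 3
    then have "dltheta 0 \<le> dltheta y" "dltheta 0 \<le> dltheta (- x)" using pos by auto
    moreover have "dltheta 0 = - 1 / 4" using dltheta_uminus[of 0] by simp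
    ultimately show ?thesis by (simp add: dltheta_uminus)
  qed (use pos assms in auto)
qed

text \<open>The derivative is controlled from below only within distance \<open>h\<close> of
  \<open>\<sigma>\<close>. Farther out, monotonicity of \<open>dltheta\<close> keeps the gap above
  the tangent from shrinking, hence the truncation by \<open>min\<close>.\<close>

lemma ltheta_ge_tangent_quadratic:
  assumes c: "0 \<le> c" "0 \<le> h"
    and inc: "\<And>x y. \<sigma> - h \<le> x \<Longrightarrow> x \<le> y \<Longrightarrow> y \<le> \<sigma> + h \<Longrightarrow> c * (y - x) \<le> dltheta y - dltheta x"
  shows "ltheta \<sigma> + dltheta \<sigma> * t + c / 2 * (min h \<bar>t\<bar>)\<^sup>2 \<le> ltheta (\<sigma> + t)"
proof -
  define G where "G t = ltheta (\<sigma> + t) - ltheta \<sigma> - dltheta \<sigma> * t" for t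
  have G': "(G has_real_derivative dltheta (\<sigma> + t) - dltheta \<sigma>) (at t)" for t
  proof -
    have "((\<lambda>t. ltheta (\<sigma> + t)) has_real_derivative dltheta (\<sigma> + t) * 1) (at t)"
      by (rule DERIV_chain2[OF ltheta_deriv]) (auto intro!: derivative_eq_intros)
    then show ?thesis unfolding G_def[abs_def] by (auto intro!: derivative_eq_intros)
  qed
  have near: "c / 2 * t\<^sup>2 \<le> G t" if "\<bar>t\<bar> \<le> h" for t
  proof -
    have d: "((\<lambda>t. G t - c / 2 * t\<^sup>2) has_real_derivative dltheta (\<sigma> + t) - dltheta \<sigma> - c * t) (at t)" for t
      by (rule derivative_eq_intros G' refl | simp)+
    have "G 0 - c / 2 * 0\<^sup>2 \<le> G t - c / 2 * t\<^sup>2"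
    proof (cases "0 \<le> t")
      case True
      show ?thesis
      proof (rule DERIV_nonneg_imp_nondecreasing[OF True])
        fix u assume "0 \<le> u" "u \<le> t"
        then show "\<exists>y. ((\<lambda>t. G t - c / 2 * t\<^sup>2) has_real_derivative y) (at u) \<and> 0 \<le> y"
          using d[of u] inc[of \<sigma> "\<sigma> + u"] that True c by (intro exI conjI) (assumption, simp)
      qed
    next
      case False
      then have "t \<le> 0" by simp
      then show ?thesis
      proof (rule DERIV_nonpos_imp_nonincreasing)
        fix u assume "t \<le> u" "u \<le> 0"
        then show "\<exists>y. ((\<lambda>t. G t - c / 2 * t\<^sup>2) has_real_derivative y) (at u) \<and> y \<le> 0"
          using d[of u] inc[of "\<sigma> + u" \<sigma>] that False c by (intro exI conjI) (assumption, simp)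
      qed
    qed
    then show ?thesis by (simp add: G_def)
  qed
  have "c / 2 * (min h \<bar>t\<bar>)\<^sup>2 \<le> G t"
  proof -
    consider "\<bar>t\<bar> \<le> h" | "h \<le> t" | "t \<le> - h" by linarith
    then show ?thesis
    proof cases
      case 1 then show ?thesis using near[of t] by simp
    next
      case 2
      have "G h \<le> G t"
      proof (rule DERIV_nonneg_imp_nondecreasing[OF 2])
        fix u assume "h \<le> u" "u \<le> t"
        then show "\<exists>y. (G has_real_derivative y) (at u) \<and> 0 \<le> y"
          using G'[of u] dltheta_mono[of \<sigma> "\<sigma> + u"] c by (intro exI conjI) (assumption, simp)
      qed
      then show ?thesis using near[of h] 2 c by simp
    next
      case 3
      have "G (- h) \<le> G t"
      proof (rule DERIV_nonpos_imp_nonincreasing[OF 3])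
        fix u assume "t \<le> u" "u \<le> - h"
        then show "\<exists>y. (G has_real_derivative y) (at u) \<and> y \<le> 0"
          using G'[of u] dltheta_mono[of "\<sigma> + u" \<sigma>] c by (intro exI conjI) (assumption, simp)
      qed
      then show ?thesis using near[of "- h"] 3 c by simp
    qed
  qed
  then show ?thesis by (simp add: G_def)
qed

text \<open>Because the \<open>t i\<close> sum to 0, the linear terms of the tangents cancel. The
  range from 6 to 7 is a unit interval on which \<open>\<sigma> = ln (s / pi)\<close> lies between
  \<open>1 / 2\<close> and \<open>3 / 2\<close>, so that the radius \<open>1 / 2\<close> stays
  inside \<open>[0, 2]\<close>, where \<open>dltheta_increase\<close> is applied.\<close>

lemma prod_theta3_ge:
  fixes t :: "'n::finite \<Rightarrow> real"
  assumes s: "0 < s" and t: "(\<Sum>i\<in>UNIV. t i) = 0"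
  shows "theta3 s ^ CARD('n) \<le> (\<Prod>i\<in>UNIV. theta3 (s * exp (t i)))"
    and "6 \<le> s \<Longrightarrow> s \<le> 7 \<Longrightarrow> theta3 s ^ CARD('n) + exp (- (pi * exp 2)) / 32 * (\<Sum>i\<in>UNIV. min 1 ((t i)\<^sup>2)) \<le> (\<Prod>i\<in>UNIV. theta3 (s * exp (t i)))"
proof -
  define \<sigma> where "\<sigma> = ln (s / pi)"
  have s': "pi * exp \<sigma> = s" using s by (simp add: \<sigma>_def)
  have pos: "0 < theta3 (s * exp (t i))" for i using theta3_ge_1[of "s * exp (t i)"] s by simp
  have lnp: "ln (\<Prod>i\<in>UNIV. theta3 (s * exp (t i))) = (\<Sum>i\<in>UNIV. ltheta (\<sigma> + t i))"
    using pos less_imp_neq[OF pos] by (subst ln_prod) (auto simp: ltheta_def exp_add s' mult.assoc[symmetric])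
  have key: "theta3 s ^ CARD('n) + (\<Sum>i\<in>UNIV. w i) \<le> (\<Prod>i\<in>UNIV. theta3 (s * exp (t i)))"
    if w: "\<And>i. ltheta \<sigma> + dltheta \<sigma> * t i + w i \<le> ltheta (\<sigma> + t i)" and w0: "\<And>i. 0 \<le> w i" for w
  proof -
    let ?W = "\<Sum>i\<in>UNIV. w i" and ?P = "theta3 s ^ CARD('n)"
    have P1: "1 \<le> ?P" using theta3_ge_1[OF s] by simp
    have "(\<Sum>i\<in>UNIV. ltheta \<sigma> + dltheta \<sigma> * t i + w i) \<le> (\<Sum>i\<in>UNIV. ltheta (\<sigma> + t i))"
      by (intro sum_mono w)
    then have "real CARD('n) * ltheta \<sigma> + ?W \<le> ln (\<Prod>i\<in>UNIV. theta3 (s * exp (t i)))"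
      unfolding lnp by (simp add: sum.distrib sum_distrib_left[symmetric] t)
    moreover have "real CARD('n) * ltheta \<sigma> = ln ?P"
      using theta3_ge_1[OF s] by (simp add: ltheta_def s' ln_realpow)
    ultimately have "exp (ln ?P + ?W) \<le> exp (ln (\<Prod>i\<in>UNIV. theta3 (s * exp (t i))))" by simp
    then have "?P * exp ?W \<le> (\<Prod>i\<in>UNIV. theta3 (s * exp (t i)))"
      using P1 pos by (simp add: exp_add prod_pos)
    \<comment> \<open>As \<open>?P \<ge> 1\<close>, the multiplicative gain can be weakened to an
      additive one, which is what integration over \<open>s\<close> requires.\<close>
    moreover have "?P + ?W \<le> ?P * exp ?W"
    proof -
      have "?P * (1 + ?W) \<le> ?P * exp ?W" using P1 exp_ge_add_one_self[of ?W] by (intro mult_left_mono) auto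
      moreover have "1 * ?W \<le> ?P * ?W" using P1 by (intro mult_right_mono sum_nonneg w0) auto
      ultimately show ?thesis by (simp add: distrib_left)
    qed
    ultimately show ?thesis by simp
  qed
  show "theta3 s ^ CARD('n) \<le> (\<Prod>i\<in>UNIV. theta3 (s * exp (t i)))"
    using key[of "\<lambda>_. 0"] ltheta_ge_tangent_quadratic[of 0 0 \<sigma>] dltheta_mono by simp
  assume s67: "6 \<le> s" "s \<le> 7"
  have e1: "exp (1 / 2 :: real) \<le> 9 / 5"
  proof -
    have "exp (1 / 2 :: real) ^ 2 = exp 1" by (simp add: exp_of_nat_mult[symmetric])
    also have "\<dots> \<le> (9 / 5)\<^sup>2" using exp_le by (simp add: power2_eq_square)
    finally show ?thesis by (rule power2_le_imp_le) simp
  qed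
  have "pi * exp (1 / 2) \<le> 3.2 * (9 / 5)" using e1 pi_approx by (intro mult_mono) auto
  then have "pi * exp (1 / 2) \<le> pi * exp \<sigma>" unfolding s' using s67 by simp
  then have \<sigma>1: "1 / 2 \<le> \<sigma>" by simp
  have "3 * (1 + 3 / 2 + (3 / 2)\<^sup>2 / 2) \<le> pi * exp (3 / 2)"
    using pi_gt3 exp_lower_Taylor_quadratic[of "3 / 2"] by (intro mult_mono) auto
  then have "pi * exp \<sigma> \<le> pi * exp (3 / 2)" unfolding s' using s67 by (simp add: power2_eq_square)
  then have \<sigma>2: "\<sigma> \<le> 3 / 2" by simp
  let ?c = "exp (- (pi * exp 2)) / 4 :: real"
  have "ltheta \<sigma> + dltheta \<sigma> * x + ?c / 8 * min 1 (x\<^sup>2) \<le> ltheta (\<sigma> + x)" for x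
  proof -
    have "ltheta \<sigma> + dltheta \<sigma> * x + ?c / 2 * (min (1 / 2) \<bar>x\<bar>)\<^sup>2 \<le> ltheta (\<sigma> + x)"
      by (rule ltheta_ge_tangent_quadratic) (use \<sigma>1 \<sigma>2 dltheta_increase[of _ _ 2] in auto)
    moreover have "min 1 (x\<^sup>2) / 4 \<le> (min (1 / 2) \<bar>x\<bar>)\<^sup>2"
      by (cases "\<bar>x\<bar> \<le> 1 / 2") (auto simp: min_def power2_eq_square)
    then have "?c / 2 * (min 1 (x\<^sup>2) / 4) \<le> ?c / 2 * (min (1 / 2) \<bar>x\<bar>)\<^sup>2" by (intro mult_left_mono) auto
    ultimately show ?thesis by linarith
  qed
  from key[of "\<lambda>i. ?c / 8 * min 1 ((t i)\<^sup>2)", OF this]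
  show "theta3 s ^ CARD('n) + exp (- (pi * exp 2)) / 32 * (\<Sum>i\<in>UNIV. min 1 ((t i)\<^sup>2)) \<le> (\<Prod>i\<in>UNIV. theta3 (s * exp (t i)))"
    by (simp add: sum_distrib_left)
qed

section \<open>Lattice sums as Gamma mixtures of Gaussian sums\<close>

lemma Gamma_integral_scaled:
  fixes q X :: real assumes "0 < q" "0 < X"
  shows "((\<lambda>s. exp (- s * X) * s powr (q - 1)) has_integral Gamma q * X powr (- q)) {0..}"
proof -
  have "((\<lambda>t. t powr (q - 1) / exp t) has_integral Gamma q) {0..}"
    by (rule Gamma_integral_real) (rule assms)
  then have "(\<lambda>t. t powr (q - 1) / exp t) absolutely_integrable_on {0..} \<and> integral {0..} (\<lambda>t. t powr (q - 1) / exp t) = Gamma q"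
    by (auto intro!: nonnegative_absolutely_integrable_1)
  moreover have "(\<lambda>x. X * x) ` {0..} = {0..}"
  proof -
    have "x \<in> (\<lambda>x. X * x) ` {0..}" if "0 \<le> x" for x
      by (rule image_eqI[of _ _ "x / X"]) (use that assms in auto)
    then show ?thesis using assms by auto
  qed
  ultimately have "(\<lambda>s. \<bar>X\<bar> * ((X * s) powr (q - 1) / exp (X * s))) absolutely_integrable_on {0..}
      \<and> integral {0..} (\<lambda>s. \<bar>X\<bar> * ((X * s) powr (q - 1) / exp (X * s))) = Gamma q"
    using assms
    by (subst has_absolute_integral_change_of_variables_1'[where g="\<lambda>x. X * x"])
      (auto intro!: derivative_eq_intros simp: inj_on_def)
  then have "((\<lambda>s. X * ((X * s) powr (q - 1) / exp (X * s))) has_integral Gamma q) {0..}"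
    using assms by (simp add: has_integral_iff set_lebesgue_integral_eq_integral(1))
  from has_integral_mult_right[OF this, of "X powr (- q)"]
  have "((\<lambda>s. X powr (- q) * (X * ((X * s) powr (q - 1) / exp (X * s)))) has_integral X powr (- q) * Gamma q) {0..}" .
  moreover have "X powr (- q) * Gamma q = Gamma q * X powr (- q)"
    by simp
  moreover have "X powr (- q) * (X * ((X * s) powr (q - 1) / exp (X * s))) = exp (- s * X) * s powr (q - 1)" if "s \<in> {0..}" for s
    using that assms by (simp add: powr_mult powr_diff powr_minus exp_minus field_simps)
  ultimately show ?thesis by (smt (verit) has_integral_cong)
qed

text \<open>Each term is a Gamma integral. The integral of the absolute value of the
  \<open>i\<close>-th term is \<open>Gamma q * \<bar>c i\<bar> * X i powr (- q)\<close>, so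
  \<open>sq\<close> is what justifies exchanging sum and integral; enumerating \<open>I\<close>
  makes the theorems on series of integrals available.\<close>

lemma Gamma_mixture:
  fixes c X :: "'i \<Rightarrow> real"
  assumes q: "0 < q" and I: "countable I" "infinite I" and X: "\<And>i. i \<in> I \<Longrightarrow> 0 < X i"
    and sq: "(\<lambda>i. \<bar>c i\<bar> * X i powr (- q)) summable_on I"
    and se: "\<And>s. 0 < s \<Longrightarrow> (\<lambda>i. \<bar>c i\<bar> * exp (- s * X i)) summable_on I"
  shows "((\<lambda>s. (\<Sum>\<^sub>\<infinity>i\<in>I. c i * exp (- s * X i)) * s powr (q - 1)) has_integral
    Gamma q * (\<Sum>\<^sub>\<infinity>i\<in>I. c i * X i powr (- q))) {0<..}"
proof -
  define b where "b = from_nat_into I"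
  have b: "bij_betw b UNIV I" unfolding b_def by (rule bij_betw_from_nat_into[OF I])
  have bI: "b n \<in> I" for n using b by (auto simp: bij_betw_def)
  have sums: "(\<lambda>n. g (b n)) sums infsum g I" if "(\<lambda>i. \<bar>g i\<bar>) summable_on I" for g :: "'i \<Rightarrow> real"
  proof -
    have "g summable_on I" using that by (rule summable_on_abs_bound) simp
    then have "(g has_sum infsum g I) I" by simp
    then have "((\<lambda>n. g (b n)) has_sum infsum g I) UNIV" by (subst has_sum_reindex_bij_betw[OF b])
    then show ?thesis by (rule has_sum_imp_sums)
  qed
  define F where "F n s = indicator {0<..} s * (c (b n) * (exp (- s * X (b n)) * s powr (q - 1)))" for n and s :: real
  have base: "integrable lebesgue (\<lambda>s. indicator {0<..} s * (exp (- s * X (b n)) * s powr (q - 1)))"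
    "(\<integral>s. indicator {0<..} s * (exp (- s * X (b n)) * s powr (q - 1)) \<partial>lebesgue) = Gamma q * X (b n) powr (- q)" for n
  proof -
    let ?g = "\<lambda>s. exp (- s * X (b n)) * s powr (q - 1)"
    have "(?g has_integral Gamma q * X (b n) powr (- q)) {0..}"
      by (rule Gamma_integral_scaled[OF q X[OF bI]])
    then have h: "(?g has_integral Gamma q * X (b n) powr (- q)) {0<..}"
      by (rule has_integral_spike_set_eq[THEN iffD1, rotated -1]) (auto intro: negligible_subset[of "{0}"])
    then have a: "?g absolutely_integrable_on {0<..}"
      by (intro nonnegative_absolutely_integrable_1) auto
    then show "integrable lebesgue (\<lambda>s. indicator {0<..} s * ?g s)" by (simp add: set_integrable_def)
    have "(?g has_integral (LINT s:{0<..}|lebesgue. ?g s)) {0<..}" by (rule has_integral_set_lebesgue[OF a])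
    then show "(\<integral>s. indicator {0<..} s * ?g s \<partial>lebesgue) = Gamma q * X (b n) powr (- q)"
      using has_integral_unique[OF h] by (simp add: set_lebesgue_integral_def)
  qed
  have Feq: "F n = (\<lambda>s. c (b n) * (indicator {0<..} s * (exp (- s * X (b n)) * s powr (q - 1))))" for n
    by (simp add: F_def fun_eq_iff)
  have intF: "integrable lebesgue (F n)" for n unfolding Feq using base(1) by (intro integrable_mult_right)
  have valF: "integral\<^sup>L lebesgue (F n) = Gamma q * (c (b n) * X (b n) powr (- q))" for n
    unfolding Feq using base(2)[of n] by simp
  have normF: "(\<integral>s. norm (F n s) \<partial>lebesgue) = Gamma q * (\<bar>c (b n)\<bar> * X (b n) powr (- q))" for n
  proof -
    have "(\<lambda>s. norm (F n s)) = (\<lambda>s. \<bar>c (b n)\<bar> * (indicator {0<..} s * (exp (- s * X (b n)) * s powr (q - 1))))"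
      by (simp add: F_def fun_eq_iff abs_mult indicator_def)
    then show ?thesis using base(2)[of n] by simp
  qed
  have Fs: "(\<lambda>n. F n s) sums (indicator {0<..} s * ((\<Sum>\<^sub>\<infinity>i\<in>I. c i * exp (- s * X i)) * s powr (q - 1)))"
    and Fa: "summable (\<lambda>n. norm (F n s))" for s
  proof -
    show "(\<lambda>n. F n s) sums (indicator {0<..} s * ((\<Sum>\<^sub>\<infinity>i\<in>I. c i * exp (- s * X i)) * s powr (q - 1)))"
    proof (cases "0 < s")
      case True
      have "(\<lambda>n. c (b n) * exp (- s * X (b n))) sums (\<Sum>\<^sub>\<infinity>i\<in>I. c i * exp (- s * X i))"
        by (rule sums[of "\<lambda>i. c i * exp (- s * X i)"]) (use se[OF True] in \<open>simp add: abs_mult\<close>)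
      from sums_mult2[OF this, of "s powr (q - 1)"] True show ?thesis by (simp add: F_def mult.assoc)
    qed (simp add: F_def)
    show "summable (\<lambda>n. norm (F n s))"
    proof (cases "0 < s")
      case True
      have "(\<lambda>n. \<bar>c (b n)\<bar> * exp (- s * X (b n))) sums (\<Sum>\<^sub>\<infinity>i\<in>I. \<bar>c i\<bar> * exp (- s * X i))"
        by (rule sums[of "\<lambda>i. \<bar>c i\<bar> * exp (- s * X i)"]) (use se[OF True] in \<open>simp add: abs_mult\<close>)
      from sums_mult2[OF this, of "s powr (q - 1)"] True show ?thesis
        by (auto simp: F_def mult.assoc abs_mult sums_iff)
    qed (simp add: F_def)
  qed
  have sn: "summable (\<lambda>n. \<integral>s. norm (F n s) \<partial>lebesgue)"
    unfolding normF using sums[of "\<lambda>i. \<bar>c i\<bar> * X i powr (- q)"] sq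
    by (intro summable_mult) (auto simp: abs_mult sums_iff)
  have AE: "AE s in lebesgue. summable (\<lambda>n. norm (F n s))" using Fa by simp
  have S: "(\<Sum>n. F n s) = indicator {0<..} s * ((\<Sum>\<^sub>\<infinity>i\<in>I. c i * exp (- s * X i)) * s powr (q - 1))" for s
    using Fs by (simp add: sums_iff)
  have int: "integrable lebesgue (\<lambda>s. \<Sum>n. F n s)" by (rule integrable_suminf[OF intF AE sn])
  have "(\<lambda>n. c (b n) * X (b n) powr (- q)) sums (\<Sum>\<^sub>\<infinity>i\<in>I. c i * X i powr (- q))"
    by (rule sums[of "\<lambda>i. c i * X i powr (- q)"]) (use sq in \<open>simp add: abs_mult\<close>)
  from sums_mult[OF this, of "Gamma q"]
  have val: "(\<integral>s. (\<Sum>n. F n s) \<partial>lebesgue) = Gamma q * (\<Sum>\<^sub>\<infinity>i\<in>I. c i * X i powr (- q))"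
    using integral_suminf[OF intF AE sn] unfolding valF by (simp add: sums_iff)
  have "set_integrable lebesgue {0<..} (\<lambda>s. (\<Sum>\<^sub>\<infinity>i\<in>I. c i * exp (- s * X i)) * s powr (q - 1))"
    using int unfolding S set_integrable_def by simp
  from has_integral_set_lebesgue[OF this] show ?thesis
    using val unfolding S set_lebesgue_integral_def by simp
qed

text \<open>On the interval from \<open>T\<close> to \<open>T + 1\<close> the weight is at least
  \<open>1 / s \<ge> 1 / (T + 1)\<close>, because \<open>q > 0\<close> and \<open>s \<ge> 1\<close>.
  The case \<open>\<delta> = 0\<close> gives plain nonnegativity.\<close>

lemma Gamma_mixture_gap:
  fixes q \<delta> T I :: real
  assumes q: "0 < q" and int: "((\<lambda>s. h s * s powr (q - 1)) has_integral I) {0<..}"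
    and h0: "\<And>s. 0 < s \<Longrightarrow> 0 \<le> h s" and T: "1 \<le> T" and \<delta>: "0 \<le> \<delta>"
    and h1: "\<And>s. T \<le> s \<Longrightarrow> s \<le> T + 1 \<Longrightarrow> \<delta> \<le> h s"
  shows "\<delta> / (T + 1) \<le> I"
proof -
  have "((\<lambda>s::real. \<delta> / (T + 1)) has_integral \<delta> / (T + 1)) {T..T+1}"
    using has_integral_const_real[of "\<delta> / (T + 1)" T "T + 1"] by simp
  then have "((\<lambda>s. if s \<in> {T..T+1} then \<delta> / (T + 1) else 0) has_integral \<delta> / (T + 1)) {0<..}"
    using T by (subst has_integral_restrict) auto
  then show ?thesis
  proof (rule has_integral_le[OF _ int])
    fix s :: real assume s: "s \<in> {0<..}"
    show "(if s \<in> {T..T+1} then \<delta> / (T + 1) else 0) \<le> h s * s powr (q - 1)"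
    proof (cases "s \<in> {T..T+1}")
      case True
      have "1 / (T + 1) \<le> 1 / s" using True T by (intro divide_left_mono) auto
      also have "1 / s = s powr (- 1)" using s by (simp add: powr_minus divide_inverse)
      also have "\<dots> \<le> s powr (q - 1)" using True T q by (intro powr_mono) auto
      finally have "\<delta> * (1 / (T + 1)) \<le> h s * s powr (q - 1)"
        using h1[of s] True \<delta> h0[of s] s T by (intro mult_mono) auto
      then show ?thesis using True by simp
    qed (use h0 s in auto)
  qed
qed

section \<open>Epstein sums of rectangular lattices\<close>

definition qform :: "('n::finite \<Rightarrow> real) \<Rightarrow> ('n \<Rightarrow> int) \<Rightarrow> real" where
  "qform b m = (\<Sum>i\<in>UNIV. (b i)\<^sup>2 * (of_int (m i))\<^sup>2)"

text \<open>The Epstein zeta function of the rectangular lattice with edge lengths \<open>b\<close>,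
  twisted by the weights \<open>c\<close>.\<close>

definition epstein :: "(('n::finite \<Rightarrow> int) \<Rightarrow> real) \<Rightarrow> ('n \<Rightarrow> real) \<Rightarrow> real \<Rightarrow> real" where
  "epstein c b q = (\<Sum>\<^sub>\<infinity>m\<in>- {0}. c m * qform b m powr (- q))"

lemma half_card_less_imp_pos: "real CARD('n::finite) / 2 < q \<Longrightarrow> 0 < q"
  by (smt (verit) of_nat_0_le_iff divide_nonneg_pos)

lemma qform_ge:
  assumes "\<And>i. \<beta> \<le> (b i)\<^sup>2"
  shows "\<beta> * qform (\<lambda>_. 1) m \<le> qform b m"
  unfolding qform_def sum_distrib_left by (intro sum_mono) (simp add: mult_right_mono assms)

lemma qform_1_ge_1: "m \<noteq> 0 \<Longrightarrow> 1 \<le> qform (\<lambda>_. 1) m"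
proof -
  assume "m \<noteq> 0"
  then obtain i where i: "m i \<noteq> 0" by (auto simp: fun_eq_iff)
  have "1 \<le> (real_of_int (m i))\<^sup>2" using i by (simp add: one_le_power_int abs_le_square_iff[of 1, simplified, symmetric])
  also have "\<dots> \<le> qform (\<lambda>_. 1) m" unfolding qform_def using member_le_sum[of i UNIV "\<lambda>i. (real_of_int (m i))\<^sup>2"] by simp
  finally show ?thesis .
qed

lemma exists_min_square:
  fixes b :: "'n::finite \<Rightarrow> real"
  assumes "\<And>i. 0 < b i"
  obtains j where "\<And>i. (b j)\<^sup>2 \<le> (b i)\<^sup>2" "0 < (b j)\<^sup>2"
proof -
  have "Min (range (\<lambda>i. (b i)\<^sup>2)) \<in> range (\<lambda>i. (b i)\<^sup>2)" by (intro Min_in) auto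
  then obtain j where j: "Min (range (\<lambda>i. (b i)\<^sup>2)) = (b j)\<^sup>2" by (elim imageE)
  have "(b j)\<^sup>2 \<le> (b i)\<^sup>2" for i unfolding j[symmetric] by (intro Min_le) auto
  then show ?thesis using that[of j] assms[of j] by simp
qed

lemma qform_pos: "(\<And>i. 0 < b i) \<Longrightarrow> m \<noteq> 0 \<Longrightarrow> 0 < qform b m"
proof -
  assume b: "\<And>i. 0 < b i" and m: "m \<noteq> 0"
  obtain j where "\<And>i. (b j)\<^sup>2 \<le> (b i)\<^sup>2" "0 < (b j)\<^sup>2" using exists_min_square[of b] b by blast
  then show ?thesis using qform_ge[of "(b j)\<^sup>2" b m] qform_1_ge_1[OF m]
    by (smt (verit) mult_pos_pos)
qed

lemma summable_on_int_powr:
  fixes r :: real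
  assumes "1 < 2 * r"
  shows "(\<lambda>k::int. (1 + (of_int k)\<^sup>2) powr (- r)) summable_on UNIV"
proof -
  have "summable (\<lambda>n. real n powr (- 2 * r))" using assms by (subst summable_real_powr_iff) auto
  then have "summable (\<lambda>n. (1 + (real n)\<^sup>2) powr (- r))"
  proof (rule summable_comparison_test'[of _ 1])
    fix n :: nat assume n: "1 \<le> n"
    have "(1 + (real n)\<^sup>2) powr (- r) \<le> ((real n)\<^sup>2) powr (- r)"
      using n assms by (intro powr_mono2') auto
    also have "(real n)\<^sup>2 = real n powr 2" using n by simp
    also have "(real n powr 2) powr (- r) = real n powr (- 2 * r)" by (subst powr_powr) simp
    finally show "norm ((1 + (real n)\<^sup>2) powr (- r)) \<le> real n powr (- 2 * r)" by simp
  qed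
  then have "(\<lambda>n. (1 + (real n)\<^sup>2) powr (- r)) summable_on UNIV"
    by (intro summable_nonneg_imp_summable_on) auto
  then show ?thesis by (intro summable_on_int) simp_all
qed

text \<open>Each \<open>1 + (m i)\<^sup>2\<close> is at most twice the squared length of
  \<open>m\<close>, so their product bounds the \<open>d\<close>-th power of the latter from below.
  The sum is thereby dominated by a product of one-dimensional sums with exponent
  \<open>q / d > 1 / 2\<close>.\<close>

lemma qform_summable:
  fixes b :: "'n::finite \<Rightarrow> real"
  assumes b: "\<And>i. 0 < b i" and q: "real CARD('n) / 2 < q"
  shows "(\<lambda>m. qform b m powr (- q)) summable_on - {0}"
proof -
  let ?d = "real CARD('n)"
  have d: "0 < ?d" by simp
  have q0: "0 < q" by (rule half_card_less_imp_pos[OF q])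
  obtain j where j: "\<And>i. (b j)\<^sup>2 \<le> (b i)\<^sup>2" "0 < (b j)\<^sup>2" using exists_min_square[of b] b by blast
  let ?P = "\<lambda>m :: 'n \<Rightarrow> int. \<Prod>i\<in>UNIV. (1 + (real_of_int (m i))\<^sup>2) powr (- (q / ?d))"
  have "?P summable_on UNIV"
    by (rule summable_on_prod_UNIV) (use q d in \<open>auto intro!: summable_on_int_powr simp: field_simps\<close>)
  then have "?P summable_on - {0}" by (rule summable_on_subset_banach) simp
  then have s: "(\<lambda>m. ((b j)\<^sup>2) powr (- q) * 2 powr q * ?P m) summable_on - {0}" by (rule summable_on_cmult_right)
  show ?thesis
  proof (rule summable_on_comparison_test[OF s])
    fix m :: "'n \<Rightarrow> int" assume "m \<in> - {0}"
    then have N1: "1 \<le> qform (\<lambda>_. 1) m" by (intro qform_1_ge_1) simp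
    let ?N = "qform (\<lambda>_. 1) m"
    have P: "(\<Prod>i\<in>UNIV. 1 + (real_of_int (m i))\<^sup>2) \<le> (2 * ?N) ^ CARD('n)"
    proof -
      have "(\<Prod>i\<in>UNIV. 1 + (real_of_int (m i))\<^sup>2) \<le> (\<Prod>i\<in>(UNIV :: 'n set). 2 * ?N)"
      proof (rule prod_mono)
        fix i
        have "(real_of_int (m i))\<^sup>2 \<le> ?N" unfolding qform_def using member_le_sum[of i UNIV "\<lambda>i. (real_of_int (m i))\<^sup>2"] by simp
        then show "0 \<le> 1 + (real_of_int (m i))\<^sup>2 \<and> 1 + (real_of_int (m i))\<^sup>2 \<le> 2 * ?N" using N1 by simp
      qed
      then show ?thesis by simp
    qed
    have "qform b m powr (- q) \<le> ((b j)\<^sup>2 * ?N) powr (- q)"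
      using qform_ge[of "(b j)\<^sup>2" b m] j N1 q0 by (intro powr_mono2') auto
    also have "\<dots> = ((b j)\<^sup>2) powr (- q) * ?N powr (- q)" using N1 by (simp add: powr_mult)
    also have "?N powr (- q) = 2 powr q * (2 * ?N) powr (- q)" using N1 by (simp add: powr_mult powr_minus)
    also have "(2 * ?N) powr (- q) = ((2 * ?N) ^ CARD('n)) powr (- (q / ?d))"
    proof -
      have "(2 * ?N) ^ CARD('n) = (2 * ?N) powr ?d" using N1 by (intro powr_realpow[symmetric]) auto
      moreover have "?d * - (q / ?d) = - q" using d by simp
      ultimately show ?thesis by (simp only: powr_powr)
    qed
    also have "\<dots> \<le> (\<Prod>i\<in>UNIV. 1 + (real_of_int (m i))\<^sup>2) powr (- (q / ?d))"
      using P q0 d by (intro powr_mono2' prod_pos) (auto simp: add_pos_nonneg)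
    also have "\<dots> = ?P m" by (rule prod_powr_distrib)
    finally show "qform b m powr (- q) \<le> ((b j)\<^sup>2) powr (- q) * 2 powr q * ?P m"
      by (simp add: mult_left_mono mult.assoc)
  qed simp
qed


definition gauss_sum :: "(('n::finite \<Rightarrow> int) \<Rightarrow> real) \<Rightarrow> ('n \<Rightarrow> real) \<Rightarrow> real \<Rightarrow> real" where
  "gauss_sum c b s = (\<Sum>\<^sub>\<infinity>m. c m * exp (- s * qform b m))"

lemma exp_qform: "exp (- s * qform b m) = (\<Prod>i\<in>UNIV. gauss (s * (b i)\<^sup>2) (m i))"
  unfolding qform_def gauss_def by (simp add: exp_sum[symmetric] sum_distrib_left sum_negf[symmetric] mult.assoc)

lemma qform_0 [simp]: "qform b 0 = 0" by (simp add: qform_def)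

lemma mult_square_pos: "0 < s \<Longrightarrow> 0 < x \<Longrightarrow> 0 < s * (x :: real)\<^sup>2"
  by simp

lemma exp_qform_summable:
  assumes "\<And>i. 0 < b i" "0 < s"
  shows "(\<lambda>m. exp (- s * qform b m)) summable_on UNIV"
  unfolding exp_qform
  by (rule summable_on_prod_UNIV) (auto intro: gauss_summable mult_square_pos assms)

lemma bounded_mult_summable:
  fixes c f :: "'a \<Rightarrow> real"
  assumes "f summable_on A" "\<And>x. \<bar>c x\<bar> \<le> B" "\<And>x. 0 \<le> f x"
  shows "(\<lambda>x. c x * f x) summable_on A"
  using summable_on_cmult_right[OF assms(1), of B]
  by (rule summable_on_abs_bound) (auto simp: abs_mult assms intro!: mult_right_mono)

lemma bounded_mult_summable':
  fixes c f :: "'a \<Rightarrow> real"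
  assumes "f summable_on A" "\<And>x. \<bar>c x\<bar> \<le> B" "\<And>x. 0 \<le> f x"
  shows "(\<lambda>x. \<bar>c x\<bar> * f x) summable_on A"
  by (rule bounded_mult_summable[OF assms(1), of _ B]) (use assms in auto)

lemma infinite_int_vectors: "infinite (- {0 :: 'n::finite \<Rightarrow> int})"
proof -
  have "inj (\<lambda>k. (\<lambda>i. k) :: 'n \<Rightarrow> int)" by (auto simp: inj_def fun_eq_iff)
  then have "infinite (range (\<lambda>k. (\<lambda>i. k) :: 'n \<Rightarrow> int))" using finite_imageD infinite_UNIV_int by blast
  then have "infinite (UNIV :: ('n \<Rightarrow> int) set)" by (rule infinite_super[OF subset_UNIV])
  then show ?thesis by (simp add: Compl_eq_Diff_UNIV)
qed

lemma epstein_integral: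
  fixes b :: "'n::finite \<Rightarrow> real"
  assumes b: "\<And>i. 0 < b i" and q: "real CARD('n) / 2 < q" and c: "\<And>m. \<bar>c m\<bar> \<le> B"
  shows "((\<lambda>s. (gauss_sum c b s - c 0) * s powr (q - 1)) has_integral Gamma q * epstein c b q) {0<..}"
proof -
  have q0: "0 < q" by (rule half_card_less_imp_pos[OF q])
  have "((\<lambda>s. (\<Sum>\<^sub>\<infinity>m\<in>- {0}. c m * exp (- s * qform b m)) * s powr (q - 1)) has_integral
    Gamma q * (\<Sum>\<^sub>\<infinity>m\<in>- {0}. c m * qform b m powr (- q))) {0<..}"
  proof (rule Gamma_mixture[OF q0 _ infinite_int_vectors])
    show "(\<lambda>m. \<bar>c m\<bar> * qform b m powr (- q)) summable_on - {0}"
      by (rule bounded_mult_summable'[OF qform_summable[OF b q] c]) simp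
    show "(\<lambda>m. \<bar>c m\<bar> * exp (- s * qform b m)) summable_on - {0}" if "0 < s" for s
      by (rule summable_on_subset_banach[OF bounded_mult_summable'[OF exp_qform_summable[OF b that] c]]) auto
  qed (auto intro: qform_pos b)
  moreover have "(\<Sum>\<^sub>\<infinity>m\<in>- {0}. c m * exp (- s * qform b m)) = gauss_sum c b s - c 0" if "s \<in> {0<..}" for s
  proof -
    have "(\<lambda>m. c m * exp (- s * qform b m)) summable_on UNIV"
      by (rule bounded_mult_summable[OF exp_qform_summable[OF b] c]) (use that in auto)
    then have "(\<lambda>m. c m * exp (- s * qform b m)) summable_on - {0}"
      by (rule summable_on_subset_banach) simp
    moreover have "insert 0 (- {0 :: 'n \<Rightarrow> int}) = UNIV" by auto
    ultimately have "gauss_sum c b s = c 0 + (\<Sum>\<^sub>\<infinity>m\<in>- {0}. c m * exp (- s * qform b m))"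
      unfolding gauss_sum_def
      using infsum_insert[of "\<lambda>m. c m * exp (- s * qform b m)" "- {0}" 0] by simp
    then show ?thesis by simp
  qed
  ultimately show ?thesis
    unfolding epstein_def by (subst has_integral_cong[where g="\<lambda>s. (\<Sum>\<^sub>\<infinity>m\<in>- {0}. c m * exp (- s * qform b m)) * s powr (q - 1)"]) auto
qed

lemma gauss_sum_1: "(\<And>i. 0 < b i) \<Longrightarrow> 0 < s \<Longrightarrow> gauss_sum (\<lambda>_. 1) b s = (\<Prod>i\<in>UNIV. theta3 (s * (b i)\<^sup>2))"
  unfolding gauss_sum_def exp_qform theta3_def mult_1
  by (rule infsum_prod_UNIV) (auto intro: gauss_summable mult_square_pos)

lemma gauss_sum_alternating:
  "(\<And>i. 0 < b i) \<Longrightarrow> 0 < s \<Longrightarrow> gauss_sum alternating b s = (\<Prod>i\<in>UNIV. theta4 (s * (b i)\<^sup>2))"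
  unfolding gauss_sum_def exp_qform
  by (subst prod_theta4) (auto simp: mult.commute[of "alternating _"] intro: mult_square_pos)

lemma abs_alternating [simp]: "\<bar>alternating m\<bar> = 1"
  by (simp add: alternating_def abs_prod)

lemma alternating_0 [simp]: "alternating 0 = 1" by (simp add: alternating_def alt_def)

text \<open>The margin on \<open>[6, 7]\<close> is integrated: \<open>224 = 32 * 7\<close>, with 32
  from \<open>prod_theta3_ge\<close> and 7 from the right end of the interval.\<close>

lemma epstein_1_gap:
  fixes a :: "'n::finite \<Rightarrow> real"
  assumes a: "\<And>i. 0 < a i" and prod: "(\<Prod>i\<in>UNIV. a i) = 1" and q: "real CARD('n) / 2 < q"
  shows "exp (- (pi * exp 2)) / 224 / Gamma q * (\<Sum>i\<in>UNIV. min 1 ((2 * ln (a i))\<^sup>2))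
    \<le> epstein (\<lambda>_. 1) a q - epstein (\<lambda>_. 1) (\<lambda>_ :: 'n. 1) q"
proof -
  have q0: "0 < q" by (rule half_card_less_imp_pos[OF q])
  let ?t = "\<lambda>i. 2 * ln (a i)" and ?h = "\<lambda>s. gauss_sum (\<lambda>_. 1) a s - gauss_sum (\<lambda>_. 1) (\<lambda>_ :: 'n. 1) s"
  let ?S = "\<Sum>i\<in>UNIV. min 1 ((?t i)\<^sup>2)"
  have "ln (\<Prod>i\<in>UNIV. a i) = (\<Sum>i\<in>UNIV. ln (a i))" by (rule ln_prod) (use a in \<open>auto simp: less_imp_neq[OF a, THEN not_sym]\<close>)
  then have t0: "(\<Sum>i\<in>UNIV. ?t i) = 0" using prod by (simp add: sum_distrib_left[symmetric])
  have sq: "exp (?t i) = (a i)\<^sup>2" for i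
  proof -
    have "exp (?t i) = exp (ln (a i)) ^ 2" by (simp add: exp_of_nat_mult[symmetric])
    then show ?thesis using a by simp
  qed
  have h: "?h s = (\<Prod>i\<in>UNIV. theta3 (s * exp (?t i))) - theta3 s ^ CARD('n)" if "0 < s" for s
    using that a by (simp add: gauss_sum_1 sq)
  have "((\<lambda>s. ?h s * s powr (q - 1)) has_integral Gamma q * epstein (\<lambda>_. 1) a q - Gamma q * epstein (\<lambda>_. 1) (\<lambda>_ :: 'n. 1) q) {0<..}"
    using has_integral_diff[OF epstein_integral[of a q "\<lambda>_. 1" 1, OF a q] epstein_integral[of "\<lambda>_ :: 'n. 1" q "\<lambda>_. 1" 1, OF _ q]]
    by (simp add: algebra_simps)
  then have "exp (- (pi * exp 2)) / 32 * ?S / (6 + 1) \<le> Gamma q * epstein (\<lambda>_. 1) a q - Gamma q * epstein (\<lambda>_. 1) (\<lambda>_ :: 'n. 1) q"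
  proof (rule Gamma_mixture_gap[OF q0])
    show "0 \<le> ?h s" if "0 < s" for s using prod_theta3_ge(1)[OF that t0] h[OF that] by simp
    show "exp (- (pi * exp 2)) / 32 * ?S \<le> ?h s" if "6 \<le> s" "s \<le> 6 + 1" for s
      using prod_theta3_ge(2)[of s ?t] t0 h[of s] that by simp
  qed (auto intro!: mult_nonneg_nonneg sum_nonneg)
  then show ?thesis using Gamma_real_pos[OF q0] by (simp add: field_simps)
qed

section \<open>Bounds for \<open>theta4\<close> and the role of the charges\<close>

text \<open>Replacing every sign away from the origin by \<open>- 1\<close> gives
  \<open>2 - theta3 s\<close>, and \<open>theta3 s \<le> 3 / 2\<close> from 3 on. This keeps the
  factor in front of the charge defect away from 0.\<close>

lemma theta4_lower: "3 \<le> s \<Longrightarrow> 1 / 2 \<le> theta4 s"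
proof -
  assume s: "3 \<le> s"
  have s1: "gauss s summable_on UNIV" "(\<lambda>k. gauss s k * alt k) summable_on UNIV"
    using s gauss_summable_mult[of s alt 1] by simp_all
  have "(\<Sum>\<^sub>\<infinity>k. (if k = 0 then 2 else 0) - gauss s k) \<le> (\<Sum>\<^sub>\<infinity>k. gauss s k * alt k)"
  proof (rule infsum_mono[OF _ s1(2)])
    show "(\<lambda>k::int. (if k = 0 then 2 else 0) - gauss s k) summable_on UNIV"
      using summable_on_add[OF finite_nonzero_values_imp_summable_on[of UNIV "\<lambda>k::int. if k = 0 then 2 else 0 :: real"] summable_on_uminus[THEN iffD2, OF s1(1)]]
      by simp
    show "(if k = 0 then 2 else 0) - gauss s k \<le> gauss s k * alt k" for k
      by (auto simp: alt_def)
  qed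
  moreover have "(\<Sum>\<^sub>\<infinity>k::int. (if k = 0 then 2 else 0) - gauss s k) = 2 - theta3 s"
  proof -
    have "(\<Sum>\<^sub>\<infinity>k::int. (if k = 0 then 2 else 0 :: real)) = 2"
      using infsum_cong_neutral[of "{0::int}" UNIV "\<lambda>k. if k = 0 then 2 else 0 :: real" "\<lambda>k. if k = 0 then 2 else 0"]
      by simp
    moreover have "(\<lambda>k::int. (if k = 0 then 2 else 0 :: real)) summable_on UNIV"
      by (rule finite_nonzero_values_imp_summable_on) simp
    ultimately show ?thesis
      using infsum_add[of "\<lambda>k::int. (if k = 0 then 2 else 0 :: real)" UNIV "\<lambda>k. - gauss s k"] s1(1)
      by (simp add: infsum_uminus theta3_def summable_on_uminus)
  qed
  moreover have "theta3 s \<le> 3 / 2"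
    using theta3_eq_gauss_moment[of s] gauss_moment_1_upper[OF s] gauss_moment_mono[of 0 1 s] s by simp
  ultimately show ?thesis by (simp add: theta4_def)
qed

text \<open>The Leibniz estimate for the alternating series over positive integers, cut off after
  two terms.\<close>

lemma theta4_upper:
  assumes s: "0 < s"
  shows "theta4 s \<le> 1 - 2 * (exp (- s) - exp (- (4 * s)))"
proof -
  define a where "a n = exp (- s * (real (Suc n))\<^sup>2)" for n
  have ev: "(\<lambda>n. gauss s (int (Suc n)) * alt (int (Suc n))) sums ((theta4 s - 1) / 2)"
    using infsum_even_int[of "\<lambda>k. gauss s k * alt k"] gauss_summable_mult[of s alt 1] s
    by (simp add: theta4_def alt_def)
  have e: "gauss s (int (Suc n)) * alt (int (Suc n)) = - ((- 1) ^ n * a n)" for n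
    by (auto simp: a_def gauss_def alt_def uminus_power_if)
  have S: "(\<lambda>n. (- 1) ^ n * a n) sums ((1 - theta4 s) / 2)"
    using sums_minus[OF ev] unfolding e by (simp add: minus_divide_left)
  have a0: "a \<longlonglongrightarrow> 0"
  proof -
    have "summable (\<lambda>n. real (Suc n) ^ (2 * 0) * exp (- (real (Suc n))\<^sup>2 * s))" by (rule gauss_moment_summable) (use s in auto)
    from summable_LIMSEQ_zero[OF this] show ?thesis by (simp add: a_def[abs_def] mult.commute)
  qed
  have mono: "monoseq a"
  proof (rule mono_SucI2, rule allI)
    show "a (Suc n) \<le> a n" for n unfolding a_def using s by (simp add: power_mono)
  qed
  have "0 < a 0" by (simp add: a_def)
  then have "\<forall>n. (\<Sum>i. (- 1) ^ i * a i) \<in> {\<Sum>i<2 * n. (- 1) ^ i * a i..\<Sum>i<2 * n + 1. (- 1) ^ i * a i}"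
    using summable_Leibniz(2)[OF a0 mono] by blast
  from spec[OF this, of 1] have "(\<Sum>i<2 * 1. (- 1) ^ i * a i) \<le> (\<Sum>i. (- 1) ^ i * a i)"
    by (simp only: atLeastAtMost_iff)
  then have "a 0 - a 1 \<le> (1 - theta4 s) / 2" using S by (simp add: sums_iff numeral_2_eq_2)
  then show ?thesis by (simp add: a_def mult.commute)
qed

lemma theta4_le_1: "0 < s \<Longrightarrow> theta4 s \<le> 1"
proof -
  assume s: "0 < s"
  show ?thesis by (rule order_trans[OF theta4_upper[OF s]]) (use s in simp)
qed

lemma theta4_gap: "1 \<le> s \<Longrightarrow> s \<le> 2 \<Longrightarrow> theta4 s \<le> 1 - exp (- 2)"
proof -
  assume s: "1 \<le> s" "s \<le> 2"
  have "2 \<le> exp (3 * s)" using exp_ge_add_one_self[of "3 * s"] s by linarith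
  then have "exp (- (3 * s)) \<le> 1 / 2" by (simp add: exp_minus field_simps)
  then have "exp (- s) * exp (- (3 * s)) \<le> exp (- s) * (1 / 2)" by (intro mult_left_mono) auto
  then have "exp (- (4 * s)) \<le> exp (- s) / 2" by (simp add: exp_add[symmetric])
  moreover have "exp (- 2) \<le> exp (- s)" using s by simp
  moreover have "1 - 2 * (x - y) \<le> 1 - z" if "y \<le> x / 2" "z \<le> x" for x y z :: real
    using that by (simp add: right_diff_distrib)
  ultimately have "1 - 2 * (exp (- s) - exp (- (4 * s))) \<le> 1 - exp (- 2)" by blast
  moreover have "theta4 s \<le> 1 - 2 * (exp (- s) - exp (- (4 * s)))" using s by (intro theta4_upper) simp
  ultimately show ?thesis by (rule order_trans[rotated])
qed

lemma epstein_alternating_neg: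
  fixes b :: "'n::finite \<Rightarrow> real"
  assumes b: "\<And>i. 1 \<le> b i" "b j = 1" and q: "real CARD('n) / 2 < q"
  shows "epstein alternating b q \<le> - (exp (- 2) / (2 * Gamma q))"
proof -
  have q0: "0 < q" by (rule half_card_less_imp_pos[OF q])
  have b0: "0 < b i" for i using b(1)[of i] by simp
  let ?h = "\<lambda>s. 1 - gauss_sum alternating b s"
  have h: "1 - theta4 s \<le> ?h s" if s: "0 < s" for s
  proof -
    have "(\<Prod>i\<in>UNIV. theta4 (s * (b i)\<^sup>2)) = theta4 s * (\<Prod>i\<in>UNIV - {j}. theta4 (s * (b i)\<^sup>2))"
      by (subst prod.remove[of _ j]) (auto simp: b)
    also have "\<dots> \<le> theta4 s * 1"
      using s b0 by (intro mult_left_mono prod_le_1 theta4_nonneg conjI theta4_le_1 mult_square_pos) auto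
    finally show ?thesis using s b0 by (simp add: gauss_sum_alternating)
  qed
  have "((\<lambda>s. ?h s * s powr (q - 1)) has_integral - (Gamma q * epstein alternating b q)) {0<..}"
    using has_integral_neg[OF epstein_integral[of b q alternating 1, OF b0 q]]
    by (simp add: algebra_simps)
  then have "exp (- 2) / (1 + 1) \<le> - (Gamma q * epstein alternating b q)"
  proof (rule Gamma_mixture_gap[OF q0])
    show "0 \<le> ?h s" if "0 < s" for s using h[OF that] theta4_le_1[OF that] by simp
    show "exp (- 2) \<le> ?h s" if "1 \<le> s" "s \<le> 1 + 1" for s using h[of s] theta4_gap[of s] that by simp
  qed auto
  then show ?thesis using Gamma_real_pos[OF q0] by (simp add: field_simps)
qed

text \<open>Since \<open>C 0 = 1\<close>, the origin terms cancel in the difference, and the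
  Gaussian inequality can be integrated over \<open>s\<close>. If the defect along an axis were
  positive, it would leave a margin on some unit interval.\<close>

lemma epstein_charge_ge:
  fixes b :: "'n::finite \<Rightarrow> real"
  assumes b: "\<And>i. 0 < b i" and q: "real CARD('n) / 2 < q"
    and C: "pos_def C" "\<And>m. \<bar>C m\<bar> \<le> B" "C 0 = 1"
  shows "epstein alternating b q \<le> epstein C b q"
    and "epstein alternating b q = epstein C b q \<Longrightarrow> smear 1 (axis_int i 1) C 0 = 0"
proof -
  have q0: "0 < q" by (rule half_card_less_imp_pos[OF q])
  let ?h = "\<lambda>s. gauss_sum C b s - gauss_sum alternating b s"
  define \<mu> where "\<mu> s = exp (- (s * (b i)\<^sup>2)) / (1 - exp (- (s * (b i)\<^sup>2)))\<^sup>2" for s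
  define \<delta> where "\<delta> = smear 1 (axis_int i 1) C 0"
  have \<delta>0: "0 \<le> \<delta>" unfolding \<delta>_def by (rule pos_def_zero[OF pos_def_smear[OF C(1)]])
  have h: "(\<Prod>i\<in>UNIV. theta4 (s * (b i)\<^sup>2)) * (\<mu> s * \<delta>) \<le> ?h s" if s: "0 < s" for s
  proof -
    have "(\<Prod>i\<in>UNIV. theta4 (s * (b i)\<^sup>2)) * (C 0 + \<mu> s * \<delta>) \<le> gauss_sum C b s"
      using gauss_sum_pos_def_ge[of "\<lambda>i. s * (b i)\<^sup>2" C B i, OF mult_square_pos[OF s b] C(1,2)]
      unfolding gauss_sum_def exp_qform \<mu>_def \<delta>_def mult.commute[of "C _"] .
    then show ?thesis using gauss_sum_alternating[of b s, OF b s] by (simp add: C(3) distrib_left)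
  qed
  have P0: "0 \<le> (\<Prod>i\<in>UNIV. theta4 (s * (b i)\<^sup>2))" if "0 < s" for s
    using that b by (intro prod_nonneg theta4_nonneg mult_square_pos) auto
  have h0: "0 \<le> ?h s" if s: "0 < s" for s
    using h[OF s] P0[OF s] \<delta>0 by (smt (verit) \<mu>_def divide_nonneg_nonneg exp_ge_zero mult_nonneg_nonneg zero_le_power2)
  have I: "((\<lambda>s. ?h s * s powr (q - 1)) has_integral Gamma q * epstein C b q - Gamma q * epstein alternating b q) {0<..}"
    using has_integral_diff[OF epstein_integral[of b q C B, OF b q C(2)] epstein_integral[of b q alternating 1, OF b q]]
    by (simp add: algebra_simps C(3))
  have "0 / (1 + 1) \<le> Gamma q * epstein C b q - Gamma q * epstein alternating b q"
    by (rule Gamma_mixture_gap[OF q0 I h0]) (use h0 in auto)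
  then show "epstein alternating b q \<le> epstein C b q" using Gamma_real_pos[OF q0] by simp
  assume eq: "epstein alternating b q = epstein C b q"
  obtain j where j: "\<And>i. (b j)\<^sup>2 \<le> (b i)\<^sup>2" "0 < (b j)\<^sup>2" using exists_min_square[of b] b by blast
  \<comment> \<open>Chosen so that \<open>s * (b i)\<^sup>2 \<ge> 3\<close> for every axis once
    \<open>s \<ge> T\<close>; then \<open>theta4_lower\<close> bounds each factor below by
    \<open>1 / 2\<close>.\<close>
  define T where "T = max 1 (3 / (b j)\<^sup>2)"
  have T1: "1 \<le> T" by (simp add: T_def)
  have T: "3 \<le> s * (b i)\<^sup>2" if "T \<le> s" for s i
  proof -
    have "3 = 3 / (b j)\<^sup>2 * (b j)\<^sup>2" using j(2) by simp
    also have "\<dots> \<le> s * (b i)\<^sup>2" using that j T_def by (intro mult_mono) auto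
    finally show ?thesis .
  qed
  define \<epsilon> where "\<epsilon> = (1 / 2) ^ CARD('n) * (exp (- ((T + 1) * (b i)\<^sup>2)) * \<delta>)"
  have "\<epsilon> / (T + 1) \<le> Gamma q * epstein C b q - Gamma q * epstein alternating b q"
  proof (rule Gamma_mixture_gap[OF q0 I h0 T1])
    show "0 \<le> \<epsilon>" using \<delta>0 by (simp add: \<epsilon>_def)
    fix s assume s: "T \<le> s" "s \<le> T + 1"
    then have s0: "0 < s" using T1 by simp
    have "(\<Prod>i\<in>(UNIV::'n set). 1 / 2) \<le> (\<Prod>i\<in>UNIV. theta4 (s * (b i)\<^sup>2))"
      by (intro prod_mono conjI theta4_lower T s) auto
    then have p: "(1 / 2) ^ CARD('n) \<le> (\<Prod>i\<in>UNIV. theta4 (s * (b i)\<^sup>2))" by simp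
    have "exp (- ((T + 1) * (b i)\<^sup>2)) \<le> exp (- (s * (b i)\<^sup>2))" using s by (simp add: mult_right_mono)
    also have "\<dots> \<le> \<mu> s"
    proof -
      have "exp (- (s * (b i)\<^sup>2)) < 1"
        using mult_square_pos[OF s0 b[of i]] by (simp only: exp_less_one_iff neg_less_0_iff_less)
      moreover have "0 < (1 - e)\<^sup>2" "(1 - e)\<^sup>2 \<le> 1" if "e < 1" "0 < e" for e :: real
        using that by (simp_all add: power_le_one)
      ultimately have "0 < (1 - exp (- (s * (b i)\<^sup>2)))\<^sup>2" "(1 - exp (- (s * (b i)\<^sup>2)))\<^sup>2 \<le> 1"
        using exp_gt_zero by blast+
      then show ?thesis unfolding \<mu>_def by (simp add: le_divide_eq)
    qed
    finally have "\<epsilon> \<le> (\<Prod>i\<in>UNIV. theta4 (s * (b i)\<^sup>2)) * (\<mu> s * \<delta>)"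
      unfolding \<epsilon>_def using p \<delta>0 P0[OF s0] by (intro mult_mono mult_right_mono mult_nonneg_nonneg) auto
    then show "\<epsilon> \<le> ?h s" using h[OF s0] by simp
  qed
  then have "\<epsilon> \<le> 0" using eq T1 by (simp add: divide_le_0_iff)
  moreover have "0 < \<epsilon>" if "0 < \<delta>" using that by (simp add: \<epsilon>_def)
  ultimately have "\<delta> \<le> 0" by linarith
  then show "smear 1 (axis_int i 1) C 0 = 0" using \<delta>0 by (simp add: \<delta>_def)
qed

section \<open>Comparison of the two lattice sums\<close>

text \<open>Both bounds are tangent-line inequalities for convex functions: for
  \<open>x powr (- q)\<close> itself, and for \<open>?K * (x - 1)\<^sup>2\<close> minus it. The
  constant comes from the size of the second derivative at the left end
  \<open>exp (- 1)\<close>.\<close>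

lemma powr_taylor:
  fixes q x :: real
  assumes q: "0 < q" and x: "exp (- 1) \<le> x"
  shows "\<bar>x powr (- q) - 1 + q * (x - 1)\<bar> \<le> q * (q + 1) * exp (q + 2) * (x - 1)\<^sup>2"
proof -
  let ?K = "q * (q + 1) * exp (q + 2)"
  have pos: "0 < y" if "exp (- 1) \<le> y" for y :: real using that exp_gt_zero[of "-1"] by linarith
  have 1: "- q * 1 powr (- q - 1) * (x - 1) \<le> x powr (- q) - 1 powr (- q)"
  proof (rule f''_imp_f'[where C="{exp (- 1)..}" and f="\<lambda>x. x powr (- q)" and f'="\<lambda>x. - q * x powr (- q - 1)"
        and f''="\<lambda>x. q * (q + 1) * x powr (- q - 2)"])
    fix y :: real assume "y \<in> {exp (- 1)..}"
    then have y: "0 < y" using pos by simp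
    show "DERIV (\<lambda>x. x powr (- q)) y :> - q * y powr (- q - 1)"
      using y by (auto intro!: derivative_eq_intros)
    show "DERIV (\<lambda>x. - q * x powr (- q - 1)) y :> q * (q + 1) * y powr (- q - 2)"
      using y by (auto intro!: derivative_eq_intros simp: algebra_simps)
    show "q * (q + 1) * y powr (- q - 2) \<ge> 0" using q by simp
  qed (use x in auto)
  have 2: "(2 * ?K * (1 - 1) - - q * 1 powr (- q - 1)) * (x - 1) \<le> (?K * (x - 1)\<^sup>2 - x powr (- q)) - (?K * (1 - 1)\<^sup>2 - 1 powr (- q))"
  proof (rule f''_imp_f'[where C="{exp (- 1)..}" and f="\<lambda>x. ?K * (x - 1)\<^sup>2 - x powr (- q)" and f'="\<lambda>x. 2 * ?K * (x - 1) - - q * x powr (- q - 1)"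
        and f''="\<lambda>x. 2 * ?K - q * (q + 1) * x powr (- q - 2)"])
    fix y :: real assume yC: "y \<in> {exp (- 1)..}"
    then have y: "0 < y" using pos by simp
    show "DERIV (\<lambda>x. ?K * (x - 1)\<^sup>2 - x powr (- q)) y :> 2 * ?K * (y - 1) - - q * y powr (- q - 1)"
      using y by (auto intro!: derivative_eq_intros)
    show "DERIV (\<lambda>x. 2 * ?K * (x - 1) - - q * x powr (- q - 1)) y :> 2 * ?K - q * (q + 1) * y powr (- q - 2)"
      using y by (auto intro!: derivative_eq_intros simp: algebra_simps)
    have "y powr (- q - 2) \<le> exp (- 1) powr (- q - 2)" using yC q by (intro powr_mono2') auto
    also have "\<dots> = exp (q + 2)" by (simp add: powr_def algebra_simps)
    finally have "q * (q + 1) * y powr (- q - 2) \<le> ?K" using q by (intro mult_left_mono) auto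
    moreover have "0 \<le> ?K" using q by simp
    ultimately show "0 \<le> 2 * ?K - q * (q + 1) * y powr (- q - 2)" by linarith
  qed (use x in auto)
  have "- q * (x - 1) \<le> x powr (- q) - 1" using 1 by simp
  moreover have "q * (x - 1) \<le> ?K * (x - 1)\<^sup>2 - x powr (- q) + 1" using 2 by simp
  moreover have "0 \<le> ?K * (x - 1)\<^sup>2" using q by simp
  ultimately show ?thesis by (simp only: abs_le_iff) linarith
qed

lemma exp_taylor_1: "\<bar>t\<bar> \<le> 1 \<Longrightarrow> \<bar>exp t - 1 - t\<bar> \<le> (t :: real)\<^sup>2"
proof -
  assume t: "\<bar>t\<bar> \<le> 1"
  have low: "0 \<le> exp t - 1 - t" using exp_ge_add_one_self[of t] by linarith
  have "exp t - 1 - t \<le> t\<^sup>2"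
  proof (cases "0 \<le> t")
    case True
    then show ?thesis using exp_bound[of t] t by simp
  next
    case False
    define x where "x = - t"
    have x: "0 < x" using False by (simp add: x_def)
    have "exp (- x) \<le> 1 / (1 + x)"
      using exp_ge_add_one_self[of x] x by (simp add: exp_minus field_simps)
    also have "\<dots> \<le> 1 - x + x\<^sup>2" using x by (simp add: field_simps power2_eq_square)
    finally show ?thesis by (simp add: x_def)
  qed
  then show ?thesis using low by simp
qed

text \<open>A weighted mean of the \<open>exp (t i)\<close> is at least \<open>exp (- 1)\<close>, so
  \<open>powr_taylor\<close> applies. The factor \<open>CARD('n)\<close> stems from the
  Cauchy-Schwarz inequality, 4 from \<open>\<bar>exp t - 1\<bar> \<le> 2 * \<bar>t\<bar>\<close>,
  and the extra \<open>q\<close> from linearizing \<open>exp\<close>.\<close>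

lemma weighted_powr_taylor:
  fixes w t :: "'n::finite \<Rightarrow> real"
  assumes q: "0 < q" and w: "\<And>i. 0 \<le> w i" "(\<Sum>i\<in>UNIV. w i) = 1" and t: "\<And>i. \<bar>t i\<bar> \<le> 1"
  shows "\<bar>(\<Sum>i\<in>UNIV. w i * exp (t i)) powr (- q) - 1 + q * (\<Sum>i\<in>UNIV. w i * t i)\<bar>
    \<le> (q * (q + 1) * exp (q + 2) * (4 * real CARD('n)) + q) * (\<Sum>i\<in>UNIV. (t i)\<^sup>2)"
proof -
  let ?x = "\<Sum>i\<in>UNIV. w i * exp (t i)" and ?L = "\<Sum>i\<in>UNIV. w i * t i" and ?S = "\<Sum>i\<in>UNIV. (t i)\<^sup>2"
  let ?K = "q * (q + 1) * exp (q + 2)"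
  have w1: "w i \<le> 1" for i
    using member_le_sum[of i UNIV w] w by simp
  have "(\<Sum>i\<in>UNIV. w i * exp (- 1)) \<le> ?x"
    by (intro sum_mono mult_left_mono w) (use t in \<open>auto simp: abs_le_iff\<close>)
  then have x: "exp (- 1) \<le> ?x" by (simp add: sum_distrib_right[symmetric] w)
  have a: "\<bar>?x - 1 - ?L\<bar> \<le> ?S"
  proof -
    have "?x - 1 - ?L = (\<Sum>i\<in>UNIV. w i * (exp (t i) - 1 - t i))"
      by (simp add: right_diff_distrib sum_subtractf w)
    also have "\<bar>\<dots>\<bar> \<le> (\<Sum>i\<in>UNIV. \<bar>w i * (exp (t i) - 1 - t i)\<bar>)" by (rule sum_abs)
    also have "\<dots> \<le> (\<Sum>i\<in>UNIV. 1 * (t i)\<^sup>2)"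
      unfolding abs_mult by (intro sum_mono mult_mono exp_taylor_1 t) (use w w1 in auto)
    finally show ?thesis by simp
  qed
  have b: "(?x - 1)\<^sup>2 \<le> 4 * real CARD('n) * ?S"
  proof -
    have "?x - 1 = (\<Sum>i\<in>UNIV. w i * (exp (t i) - 1))"
      by (simp add: right_diff_distrib sum_subtractf w)
    also have "\<dots>\<^sup>2 \<le> (\<Sum>i\<in>UNIV. (w i * (exp (t i) - 1))\<^sup>2) * real CARD('n)"
      by (rule sum_squared_le_sum_of_squares)
    also have "(\<Sum>i\<in>UNIV. (w i * (exp (t i) - 1))\<^sup>2) \<le> (\<Sum>i\<in>UNIV. 4 * (t i)\<^sup>2)"
    proof (rule sum_mono)
      fix i
      have "(t i)\<^sup>2 \<le> \<bar>t i\<bar>" using t[of i] by (metis abs_ge_zero mult_left_le power2_abs power2_eq_square)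
      then have e: "\<bar>exp (t i) - 1\<bar> \<le> 2 * \<bar>t i\<bar>" using exp_taylor_1[OF t[of i]] by linarith
      have "\<bar>w i * (exp (t i) - 1)\<bar> \<le> 1 * (2 * \<bar>t i\<bar>)"
        unfolding abs_mult using e w1[of i] w(1)[of i] by (intro mult_mono) auto
      then have "\<bar>w i * (exp (t i) - 1)\<bar>\<^sup>2 \<le> (2 * \<bar>t i\<bar>)\<^sup>2" by (intro power_mono) auto
      then show "(w i * (exp (t i) - 1))\<^sup>2 \<le> 4 * (t i)\<^sup>2" by (simp add: power_mult_distrib)
    qed
    finally show ?thesis by (simp add: sum_distrib_left mult_ac)
  qed
  have "\<bar>?x powr (- q) - 1 + q * ?L\<bar> \<le> \<bar>?x powr (- q) - 1 + q * (?x - 1)\<bar> + \<bar>q * (?x - 1 - ?L)\<bar>"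
    by (simp add: algebra_simps abs_triangle_ineq4)
  also have "\<dots> \<le> ?K * (?x - 1)\<^sup>2 + q * ?S"
    using powr_taylor[OF q x] a q by (intro add_mono) (auto simp: abs_mult)
  also have "\<dots> \<le> ?K * (4 * real CARD('n) * ?S) + q * ?S"
    using b q by (intro add_right_mono mult_left_mono) auto
  finally show ?thesis by (simp add: algebra_simps)
qed

lemma epstein_summable:
  fixes b :: "'n::finite \<Rightarrow> real"
  assumes "\<And>i. 0 < b i" "real CARD('n) / 2 < q" "\<And>m. \<bar>c m\<bar> \<le> B"
  shows "(\<lambda>m. c m * qform b m powr (- q)) summable_on - {0}"
  by (rule bounded_mult_summable[OF qform_summable[OF assms(1,2)] assms(3)]) simp

lemma epstein_abs_le:
  fixes b :: "'n::finite \<Rightarrow> real"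
  assumes "\<And>i. 0 < b i" "real CARD('n) / 2 < q" "\<And>m. \<bar>c m\<bar> \<le> 1"
  shows "\<bar>epstein c b q\<bar> \<le> epstein (\<lambda>_. 1) b q"
proof -
  have s1: "(\<lambda>m. 1 * qform b m powr (- q)) summable_on - {0}"
    by (rule epstein_summable[OF assms(1,2), of "\<lambda>_. 1" 1]) auto
  have sc: "(\<lambda>m. c m * qform b m powr (- q)) summable_on - {0}"
    by (rule epstein_summable[OF assms])
  have "c m * qform b m powr (- q) \<le> 1 * qform b m powr (- q)" "- (c m * qform b m powr (- q)) \<le> 1 * qform b m powr (- q)" for m
    using assms(3)[of m] mult_right_mono[of "c m" 1 "qform b m powr (- q)"] mult_right_mono[of "- c m" 1 "qform b m powr (- q)"]
    by (auto simp: abs_le_iff)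
  then have "epstein c b q \<le> epstein (\<lambda>_. 1) b q" "- epstein c b q \<le> epstein (\<lambda>_. 1) b q"
    unfolding epstein_def infsum_uminus[symmetric]
    by (intro infsum_mono sc s1 summable_on_uminus[THEN iffD2, OF sc]; simp)+
  then show ?thesis by simp
qed

lemma qform_scale: "qform (\<lambda>i. v * b i) m = v\<^sup>2 * qform b m"
  by (simp add: qform_def sum_distrib_left power_mult_distrib mult.assoc)

lemma epstein_scale: "0 \<le> v \<Longrightarrow> epstein c (\<lambda>i. v * b i) q = (v\<^sup>2) powr (- q) * epstein c b q"
  unfolding epstein_def qform_scale
  by (simp add: powr_mult mult.left_commute[of "c _"] infsum_cmult_right')

lemma epstein_1_antimono:
  fixes a b :: "'n::finite \<Rightarrow> real"
  assumes a: "\<And>i. 0 < a i" and ab: "\<And>i. (a i)\<^sup>2 \<le> (b i)\<^sup>2" and b: "\<And>i. 0 < b i" and q: "real CARD('n) / 2 < q"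
  shows "epstein (\<lambda>_. 1) b q \<le> epstein (\<lambda>_. 1) a q"
  unfolding epstein_def
proof (rule infsum_mono)
  have q0: "0 < q" by (rule half_card_less_imp_pos[OF q])
  fix m :: "'n \<Rightarrow> int" assume "m \<in> - {0}"
  then have "0 < qform a m" using qform_pos a by auto
  moreover have "qform a m \<le> qform b m" unfolding qform_def by (intro sum_mono mult_right_mono ab) auto
  ultimately show "1 * qform b m powr (- q) \<le> 1 * qform a m powr (- q)" using q0 by (simp add: powr_mono2')
qed (rule epstein_summable[OF _ q, of _ _ 1]; use a b in simp)+

lemma epstein_1_nonneg: "0 \<le> epstein (\<lambda>_. 1) b q"
  unfolding epstein_def by (intro infsum_nonneg) simp

text \<open>The shortest edge \<open>b j\<close> is at most 1. Shrinking all edges to it bounds the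
  sum for \<open>q\<close> by a multiple of \<open>((b j)\<^sup>2) powr (- q)\<close>; this grows
  when \<open>q\<close> is replaced by \<open>p\<close>, and the result is a single term of the sum
  for \<open>p\<close>.\<close>

lemma epstein_dominated:
  fixes b :: "'n::finite \<Rightarrow> real"
  assumes b: "\<And>i. 0 < b i" and prod: "(\<Prod>i\<in>UNIV. b i) = 1" and q: "real CARD('n) / 2 < q" and pq: "q < p"
  shows "epstein (\<lambda>_. 1) b q \<le> epstein (\<lambda>_. 1) (\<lambda>_ :: 'n. 1) q * epstein (\<lambda>_. 1) b p"
proof -
  have q0: "0 < q" by (rule half_card_less_imp_pos[OF q])
  obtain j where j: "\<And>i. (b j)\<^sup>2 \<le> (b i)\<^sup>2" "0 < (b j)\<^sup>2" using exists_min_square[of b] b by blast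
  have j1: "(b j)\<^sup>2 \<le> 1"
  proof (rule ccontr)
    assume "\<not> ?thesis"
    then have "1 < b i" for i using j(1)[of i] b[of i]
      by (smt (verit) one_less_power power_le_one zero_less_numeral)
    then have "1 < (\<Prod>i\<in>(UNIV::'n set). b i)" using less_1_prod[of "UNIV :: 'n set" b] by simp
    then show False using prod by simp
  qed
  have "epstein (\<lambda>_. 1) b q \<le> epstein (\<lambda>_. 1) (\<lambda>i :: 'n. b j * 1) q"
    by (rule epstein_1_antimono) (use j b q in auto)
  also have "\<dots> = ((b j)\<^sup>2) powr (- q) * epstein (\<lambda>_. 1) (\<lambda>_ :: 'n. 1) q"
    by (rule epstein_scale) (use b[of j] in simp)
  also have "\<dots> \<le> ((b j)\<^sup>2) powr (- p) * epstein (\<lambda>_. 1) (\<lambda>_ :: 'n. 1) q"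
    using j j1 pq epstein_1_nonneg by (intro mult_right_mono powr_mono') auto
  also have "((b j)\<^sup>2) powr (- p) \<le> epstein (\<lambda>_. 1) b p"
  proof -
    have e: "axis_int j 1 \<noteq> 0" by (auto simp: axis_int_def fun_eq_iff)
    have "qform b (axis_int j 1) = (b j)\<^sup>2"
      unfolding qform_def axis_int_def by (simp add: if_distrib[of real_of_int] if_distrib[of "\<lambda>x. x\<^sup>2"] if_distrib[of "\<lambda>x. _ * x"] cong: if_cong)
    then have "((b j)\<^sup>2) powr (- p) = (\<Sum>m\<in>{axis_int j 1}. 1 * qform b m powr (- p))" by simp
    also have "\<dots> \<le> epstein (\<lambda>_. 1) b p" unfolding epstein_def
      by (rule finite_sum_le_infsum[OF epstein_summable[OF b, of p "\<lambda>_. 1" 1]]) (use e q pq in auto)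
    finally show ?thesis .
  qed
  then have "((b j)\<^sup>2) powr (- p) * epstein (\<lambda>_. 1) (\<lambda>_ :: 'n. 1) q \<le> epstein (\<lambda>_. 1) b p * epstein (\<lambda>_. 1) (\<lambda>_ :: 'n. 1) q"
    using epstein_1_nonneg by (intro mult_right_mono) auto
  finally show ?thesis by (simp add: mult.commute)
qed

lemma infsum_sum:
  fixes f :: "'i \<Rightarrow> 'a \<Rightarrow> real"
  assumes "finite I" "\<And>i. i \<in> I \<Longrightarrow> f i summable_on A"
  shows "(\<lambda>x. \<Sum>i\<in>I. f i x) summable_on A" "(\<Sum>\<^sub>\<infinity>x\<in>A. \<Sum>i\<in>I. f i x) = (\<Sum>i\<in>I. infsum (f i) A)"
proof -
  have "(\<lambda>x. \<Sum>i\<in>I. f i x) summable_on A \<and> (\<Sum>\<^sub>\<infinity>x\<in>A. \<Sum>i\<in>I. f i x) = (\<Sum>i\<in>I. infsum (f i) A)"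
    using assms by induction (auto simp: infsum_add summable_on_add)
  then show "(\<lambda>x. \<Sum>i\<in>I. f i x) summable_on A" "(\<Sum>\<^sub>\<infinity>x\<in>A. \<Sum>i\<in>I. f i x) = (\<Sum>i\<in>I. infsum (f i) A)"
    by auto
qed

text \<open>The linear term in \<open>t\<close> vanishes because its coefficients agree by symmetry and \<open>\<Sum> t = 0\<close>.\<close>

lemma epstein_alternating_near:
  fixes b t :: "'n::finite \<Rightarrow> real"
  assumes b: "\<And>i. 0 < b i" and bt: "\<And>i. (b i)\<^sup>2 = exp (t i)" and t: "\<And>i. \<bar>t i\<bar> \<le> 1" "(\<Sum>i\<in>UNIV. t i) = 0"
    and q: "real CARD('n) / 2 < q"
  shows "\<bar>epstein alternating (\<lambda>_ :: 'n. 1) q - epstein alternating b q\<bar>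
    \<le> (q * (q + 1) * exp (q + 2) * (4 * real CARD('n)) + q) * epstein (\<lambda>_. 1) (\<lambda>_ :: 'n. 1) q * (\<Sum>i\<in>UNIV. (t i)\<^sup>2)"
proof -
  have q0: "0 < q" by (rule half_card_less_imp_pos[OF q])
  let ?N = "\<lambda>m :: 'n \<Rightarrow> int. qform (\<lambda>_. 1) m"
  let ?C = "(q * (q + 1) * exp (q + 2) * (4 * real CARD('n)) + q) * (\<Sum>i\<in>UNIV. (t i)\<^sup>2)"
  \<comment> \<open>The share of the \<open>i\<close>-th coordinate in the squared length of
    \<open>m\<close>; it writes \<open>qform b m\<close> as that squared length times a weighted
    mean of the \<open>exp (t i)\<close>.\<close>
  define w where "w m i = (of_int (m i))\<^sup>2 / ?N m" for m i
  define g where "g i m = alternating m * ?N m powr (- q) * w m i" for i m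
  have N1: "1 \<le> ?N m" if "m \<in> - {0}" for m using qform_1_ge_1[of m] that by simp
  have w0: "0 \<le> w m i" if "m \<in> - {0}" for m i using N1[OF that] by (simp add: w_def)
  have wsum: "(\<Sum>i\<in>UNIV. w m i) = 1" if "m \<in> - {0}" for m
    using N1[OF that] by (simp add: w_def sum_divide_distrib[symmetric] qform_def)
  have w1: "w m i \<le> 1" if "m \<in> - {0}" for m i
    using member_le_sum[of i UNIV "w m"] w0[OF that] wsum[OF that] by simp
  have qb: "qform b m = ?N m * (\<Sum>i\<in>UNIV. w m i * exp (t i))" if "m \<in> - {0}" for m
    using N1[OF that] by (simp add: w_def qform_def[of b] bt sum_distrib_left mult.commute)
  have sN: "(\<lambda>m. c m * ?N m powr (- q)) summable_on - {0}" if "\<And>m. \<bar>c m\<bar> \<le> B" for c B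
    by (rule epstein_summable[OF _ q that]) simp
  have sg: "g i summable_on - {0}" for i
  proof (rule summable_on_abs_bound[OF sN[of "\<lambda>_. 1" 1]])
    show "\<bar>g i m\<bar> \<le> 1 * ?N m powr (- q)" if "m \<in> - {0}" for m
      unfolding g_def abs_mult using w0[OF that] w1[OF that] by (simp add: mult_left_le)
  qed simp
  define G where "G i = infsum (g i) (- {0})" for i
  have Gsym: "G i = G j" for i j
  proof -
    let ?p = "Transposition.transpose i j"
    have bij: "bij_betw (\<lambda>m. m \<circ> ?p) (- {0 :: 'n \<Rightarrow> int}) (- {0})"
    proof -
      have inv: "(m \<circ> ?p) \<circ> ?p = m" for m :: "'n \<Rightarrow> int" by (simp add: comp_assoc)
      have "m = 0" if "m \<circ> ?p = 0" for m :: "'n \<Rightarrow> int"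
        using inv[of m] unfolding that by (simp add: fun_eq_iff)
      then show ?thesis
        by (intro bij_betw_byWitness[where f'="\<lambda>m. m \<circ> ?p"]) (auto simp: inv)
    qed
    have al: "alternating (m \<circ> ?p) = alternating m" for m
      unfolding alternating_def o_def by (rule prod.reindex_bij_betw) simp
    have qf: "?N (m \<circ> ?p) = ?N m" for m
      unfolding qform_def o_def by (rule sum.reindex_bij_betw[of ?p UNIV UNIV "\<lambda>i. 1\<^sup>2 * (of_int (m i))\<^sup>2"]) simp
    have "G i = (\<Sum>\<^sub>\<infinity>m\<in>- {0}. g i (m \<circ> ?p))" unfolding G_def by (rule infsum_reindex_bij_betw[OF bij, symmetric])
    also have "\<dots> = G j" unfolding G_def by (rule infsum_cong) (simp add: g_def al qf w_def)
    finally show ?thesis .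
  qed
  have lin: "(\<Sum>\<^sub>\<infinity>m\<in>- {0}. \<Sum>i\<in>UNIV. t i * g i m) = 0"
  proof -
    fix j :: 'n
    have "(\<Sum>\<^sub>\<infinity>m\<in>- {0}. \<Sum>i\<in>UNIV. t i * g i m) = (\<Sum>i\<in>UNIV. \<Sum>\<^sub>\<infinity>m\<in>- {0}. t i * g i m)"
      by (rule infsum_sum(2)) (auto intro!: summable_on_cmult_right sg)
    also have "\<dots> = (\<Sum>i\<in>UNIV. t i * G j)"
    proof (rule sum.cong)
      show "(\<Sum>\<^sub>\<infinity>m\<in>- {0}. t i * g i m) = t i * G j" for i
        using Gsym[of i j] by (simp add: infsum_cmult_right' G_def)
    qed simp
    also have "\<dots> = 0" by (simp add: sum_distrib_right[symmetric] t)
    finally show ?thesis .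
  qed
  have sl: "(\<lambda>m. \<Sum>i\<in>UNIV. t i * g i m) summable_on - {0}"
    by (rule infsum_sum(1)) (auto intro!: summable_on_cmult_right sg)
  have sa: "(\<lambda>m. alternating m * ?N m powr (- q)) summable_on - {0}"
    and sb: "(\<lambda>m. alternating m * qform b m powr (- q)) summable_on - {0}"
    by (rule epstein_summable[OF _ q, of _ _ 1]; use b in simp)+
  let ?D = "\<lambda>m. alternating m * ?N m powr (- q) + - (alternating m * qform b m powr (- q)) + - (q * (\<Sum>i\<in>UNIV. t i * g i m))"
  have sD: "?D summable_on - {0}"
    by (intro summable_on_add sa summable_on_uminus[THEN iffD2] sb summable_on_cmult_right sl)
  have "((\<lambda>m. \<Sum>i\<in>UNIV. t i * g i m) has_sum 0) (- {0})" using has_sum_infsum[OF sl] lin by simp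
  from has_sum_add[OF has_sum_add[OF has_sum_infsum[OF sa] has_sum_uminusI[OF has_sum_infsum[OF sb]]]
      has_sum_uminusI[OF has_sum_cmult_right[OF this, of q]]]
  have "(?D has_sum (epstein alternating (\<lambda>_ :: 'n. 1) q + - epstein alternating b q + - (q * 0))) (- {0})"
    unfolding epstein_def .
  then have "infsum ?D (- {0}) = epstein alternating (\<lambda>_ :: 'n. 1) q - epstein alternating b q"
    by (simp add: infsumI)
  moreover have "\<bar>infsum ?D (- {0})\<bar> \<le> (\<Sum>\<^sub>\<infinity>m\<in>- {0}. ?C * (1 * ?N m powr (- q)))"
  proof -
    have "norm (infsum ?D (- {0})) \<le> (\<Sum>\<^sub>\<infinity>m\<in>- {0}. norm (?D m))"
      by (rule norm_infsum_bound[OF summable_on_iff_abs_summable_on_real[THEN iffD1, OF sD]])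
    also have "\<dots> \<le> (\<Sum>\<^sub>\<infinity>m\<in>- {0}. ?C * (1 * ?N m powr (- q)))"
    proof (rule infsum_mono[OF summable_on_iff_abs_summable_on_real[THEN iffD1, OF sD]])
      show "(\<lambda>m. ?C * (1 * ?N m powr (- q))) summable_on - {0}" by (intro summable_on_cmult_right sN[of "\<lambda>_. 1" 1]) simp
      fix m :: "'n \<Rightarrow> int" assume m: "m \<in> - {0}"
      have "?D m = - (alternating m * ?N m powr (- q)) *
        ((\<Sum>i\<in>UNIV. w m i * exp (t i)) powr (- q) - 1 + q * (\<Sum>i\<in>UNIV. w m i * t i))"
      proof -
        have 1: "qform b m powr (- q) = ?N m powr (- q) * (\<Sum>i\<in>UNIV. w m i * exp (t i)) powr (- q)"
          by (simp only: qb[OF m] powr_mult)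
        have 2: "(\<Sum>i\<in>UNIV. t i * g i m) = alternating m * ?N m powr (- q) * (\<Sum>i\<in>UNIV. w m i * t i)"
          by (simp add: g_def sum_distrib_left mult_ac)
        have 3: "a * n + - (a * (n * x)) + - (q * (a * n * l)) = - (a * n) * (x - 1 + q * l)" for a n x l :: real
          by (simp add: algebra_simps)
        show ?thesis unfolding 1 2 by (rule 3)
      qed
      then have "norm (?D m) = ?N m powr (- q) * \<bar>(\<Sum>i\<in>UNIV. w m i * exp (t i)) powr (- q) - 1 + q * (\<Sum>i\<in>UNIV. w m i * t i)\<bar>"
        by (simp add: abs_mult)
      also have "\<dots> \<le> ?N m powr (- q) * ?C"
        by (intro mult_left_mono weighted_powr_taylor[OF q0 w0[OF m] wsum[OF m] t(1)]) simp
      finally show "norm (?D m) \<le> ?C * (1 * ?N m powr (- q))" by (simp add: mult.commute)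
    qed
    finally show ?thesis by simp
  qed
  moreover have "(\<Sum>\<^sub>\<infinity>m\<in>- {0}. ?C * (1 * ?N m powr (- q))) = ?C * epstein (\<lambda>_. 1) (\<lambda>_ :: 'n. 1) q"
    unfolding epstein_def by (rule infsum_cmult_right')
  ultimately show ?thesis by (simp add: mult_ac)
qed

theorem epstein_alternating_le_epstein_1:
  fixes p q :: real
  assumes q: "real CARD('n::finite) / 2 < q" and pq: "q < p"
  obtains K where "0 < K"
    "\<And>b :: 'n \<Rightarrow> real. (\<And>i. 0 < b i) \<Longrightarrow> (\<Prod>i\<in>UNIV. b i) = 1 \<Longrightarrow>
      epstein alternating (\<lambda>_ :: 'n. 1) q - epstein alternating b q
        \<le> K * (epstein (\<lambda>_. 1) b p - epstein (\<lambda>_. 1) (\<lambda>_ :: 'n. 1) p)"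
proof -
  have q0: "0 < q" by (rule half_card_less_imp_pos[OF q])
  define S where "S = epstein (\<lambda>_. 1) (\<lambda>_ :: 'n. 1) q"
  define F1 where "F1 = epstein (\<lambda>_. 1) (\<lambda>_ :: 'n. 1) p"
  define \<kappa> where "\<kappa> = exp (- (pi * exp 2)) / 224 / Gamma p"
  define C where "C = (q * (q + 1) * exp (q + 2) * (4 * real CARD('n)) + q) * S"
  have S0: "0 \<le> S" "0 \<le> F1" unfolding S_def F1_def by (rule epstein_1_nonneg)+
  have k0: "0 < \<kappa>" unfolding \<kappa>_def using q0 pq by (intro divide_pos_pos Gamma_real_pos) auto
  have C0: "0 \<le> C" unfolding C_def using q0 S0 by (intro mult_nonneg_nonneg add_nonneg_nonneg) auto
  \<comment> \<open>The first summand serves the case of small \<open>t\<close>. In the other case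
    \<open>\<kappa> \<le> ?D\<close>, and \<open>S * (1 + F1 + ?D)\<close> is at most the second
    summand times \<open>?D\<close>. The final 1 makes \<open>K\<close> positive.\<close>
  define K where "K = C / \<kappa> + S * ((1 + F1) / \<kappa> + 1) + 1"
  have K0: "0 < K" unfolding K_def using C0 k0 S0 by (intro add_nonneg_pos add_nonneg_nonneg mult_nonneg_nonneg divide_nonneg_pos) auto
  show ?thesis
  proof (rule that[OF K0])
    fix b :: "'n \<Rightarrow> real" assume b: "\<And>i. 0 < b i" and prod: "(\<Prod>i\<in>UNIV. b i) = 1"
    let ?t = "\<lambda>i. 2 * ln (b i)"
    let ?D = "epstein (\<lambda>_. 1) b p - F1" and ?G = "epstein alternating (\<lambda>_ :: 'n. 1) q - epstein alternating b q"
    have gap: "\<kappa> * (\<Sum>i\<in>UNIV. min 1 ((?t i)\<^sup>2)) \<le> ?D"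
      unfolding \<kappa>_def F1_def by (rule epstein_1_gap[OF b prod]) (use q pq in simp)
    have D0: "0 \<le> ?D" using gap k0 by (smt (verit) mult_nonneg_nonneg sum_nonneg min_def zero_le_power2)
    have "?G \<le> (K - 1) * ?D"
    proof (cases "\<forall>i. \<bar>?t i\<bar> \<le> 1")
      case True
      have "ln (\<Prod>i\<in>UNIV. b i) = (\<Sum>i\<in>UNIV. ln (b i))" by (rule ln_prod) (use b in \<open>auto simp: less_imp_neq[OF b, THEN not_sym]\<close>)
      then have t0: "(\<Sum>i\<in>UNIV. ?t i) = 0" using prod by (simp add: sum_distrib_left[symmetric])
      have sq: "(b i)\<^sup>2 = exp (?t i)" for i
      proof -
        have "exp (?t i) = exp (ln (b i)) ^ 2" by (simp add: exp_of_nat_mult[symmetric])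
        then show ?thesis using b by simp
      qed
      have "min 1 ((?t i)\<^sup>2) = (?t i)\<^sup>2" for i
      proof -
        have "(?t i)\<^sup>2 \<le> 1" using True by (simp only: abs_square_le_1)
        then show ?thesis by simp
      qed
      then have g: "\<kappa> * (\<Sum>i\<in>UNIV. (?t i)\<^sup>2) \<le> ?D" using gap by simp
      have "\<bar>?G\<bar> \<le> C * (\<Sum>i\<in>UNIV. (?t i)\<^sup>2)"
        unfolding C_def S_def by (rule epstein_alternating_near[OF b sq _ t0 q]) (use True in blast)
      then have "?G \<le> C * (\<Sum>i\<in>UNIV. (?t i)\<^sup>2)" by (rule order_trans[OF abs_ge_self])
      also have "\<dots> = C / \<kappa> * (\<kappa> * (\<Sum>i\<in>UNIV. (?t i)\<^sup>2))" using k0 by simp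
      also have "\<dots> \<le> C / \<kappa> * ?D" using g C0 k0 by (intro mult_left_mono) auto
      also have "\<dots> \<le> (K - 1) * ?D" unfolding K_def using D0 S0 k0 by (intro mult_right_mono) auto
      finally show ?thesis .
    next
      case False
      then obtain i where i: "1 < \<bar>?t i\<bar>" by (meson not_le)
      have "1 \<le> \<bar>?t i\<bar>\<^sup>2" using i by (intro one_le_power) simp
      then have "1 = min 1 ((?t i)\<^sup>2)" by (simp add: min_def)
      also have "\<dots> \<le> (\<Sum>i\<in>UNIV. min 1 ((?t i)\<^sup>2))" by (rule member_le_sum) auto
      finally have "\<kappa> * 1 \<le> \<kappa> * (\<Sum>i\<in>UNIV. min 1 ((?t i)\<^sup>2))" using k0 by (intro mult_left_mono) auto
      then have kD: "\<kappa> \<le> ?D" using gap by simp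
      have "?G \<le> S + epstein (\<lambda>_. 1) b q"
        using epstein_abs_le[of "\<lambda>_ :: 'n. 1" q alternating] epstein_abs_le[of b q alternating] b q
        unfolding S_def by (simp add: abs_le_iff)
      also have "\<dots> \<le> S + S * epstein (\<lambda>_. 1) b p"
        using epstein_dominated[OF b prod q pq] by (simp add: S_def)
      also have "\<dots> = S * ((1 + F1) / \<kappa> * \<kappa> + ?D)"
      proof -
        have "(1 + F1) / \<kappa> * \<kappa> = 1 + F1" using k0 by simp
        then show ?thesis by (simp only:) (simp add: algebra_simps)
      qed
      also have "\<dots> \<le> S * ((1 + F1) / \<kappa> * ?D + ?D)"
        using kD S0 k0 by (intro mult_left_mono add_right_mono) auto
      also have "\<dots> = S * ((1 + F1) / \<kappa> + 1) * ?D"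
      proof -
        have "S * (x * y + y) = S * (x + 1) * y" for x y :: real by (simp add: algebra_simps)
        then show ?thesis .
      qed
      also have "\<dots> \<le> (K - 1) * ?D" unfolding K_def using D0 C0 k0 by (intro mult_right_mono) auto
      finally show ?thesis .
    qed
    also have "\<dots> \<le> K * ?D" using D0 by (intro mult_right_mono) auto
    finally show "?G \<le> K * (epstein (\<lambda>_. 1) b p - epstein (\<lambda>_. 1) (\<lambda>_ :: 'n. 1) p)" by (simp add: F1_def)
  qed
qed

section \<open>Orthogonal bases, charges and energies\<close>

text \<open>Orthogonal nonzero vectors are independent, and there are as many of them as dimensions;
  independence and spanning thus never have to be checked separately.\<close>

lemma orthogonal_basis_iff:
  fixes u :: "'n::finite \<Rightarrow> real ^ 'n"
  shows "orthogonal_basis u \<longleftrightarrow> (\<forall>i. u i \<noteq> 0) \<and> (\<forall>i j. i \<noteq> j \<longrightarrow> orthogonal (u i) (u j))"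
proof
  assume "orthogonal_basis u"
  then show "(\<forall>i. u i \<noteq> 0) \<and> (\<forall>i j. i \<noteq> j \<longrightarrow> orthogonal (u i) (u j))"
    unfolding orthogonal_basis_def lattice_basis_def using dependent_zero by (metis rangeI)
next
  assume a: "(\<forall>i. u i \<noteq> 0) \<and> (\<forall>i j. i \<noteq> j \<longrightarrow> orthogonal (u i) (u j))"
  then have inj: "inj u" unfolding inj_def using orthogonal_self by metis
  have ind: "independent (range u)"
    by (rule pairwise_orthogonal_independent) (use a in \<open>auto simp: pairwise_def, metis\<close>)
  have "UNIV \<subseteq> span (range u)"
    by (rule card_ge_dim_independent[OF subset_UNIV ind]) (simp add: card_image[OF inj] dim_UNIV)
  then show "orthogonal_basis u" unfolding orthogonal_basis_def lattice_basis_def using inj ind a by auto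
qed

lemma norm_lattice_point:
  assumes "orthogonal_basis u"
  shows "(norm (lattice_point u m))\<^sup>2 = qform (\<lambda>i. norm (u i)) m"
proof -
  have "(norm (lattice_point u m))\<^sup>2 = (\<Sum>i\<in>UNIV. (norm (of_int (m i) *\<^sub>R u i))\<^sup>2)"
    unfolding lattice_point_def
    by (rule norm_sum_Pythagorean) (use assms in \<open>auto simp: pairwise_def orthogonal_basis_iff orthogonal_clauses\<close>)
  then show ?thesis by (simp add: qform_def power_mult_distrib mult.commute)
qed

lemma lattice_point_add: "lattice_point u (k + m) = lattice_point u k + lattice_point u m"
  by (simp add: lattice_point_def scaleR_left_distrib sum.distrib)

lemma lattice_point_diff: "lattice_point u (k - m) = lattice_point u k - lattice_point u m"
  by (simp add: lattice_point_def scaleR_left_diff_distrib sum_subtractf)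

lemma lattice_point_0 [simp]: "lattice_point u 0 = 0" by (simp add: lattice_point_def)

lemma lattice_point_axis: "lattice_point u (axis_int i k) = of_int k *\<^sub>R u i"
  unfolding lattice_point_def axis_int_def
  by (simp add: if_distrib[of of_int] if_distrib[of "\<lambda>x. x *\<^sub>R _"] cong: if_cong)

lemma orthogonal_basis_norm_pos: "orthogonal_basis u \<Longrightarrow> 0 < norm (u i)"
  by (simp add: orthogonal_basis_iff)

lemma inj_lattice_point:
  assumes u: "orthogonal_basis u" shows "inj (lattice_point u)"
proof (rule injI)
  fix k m assume "lattice_point u k = lattice_point u m"
  then have "qform (\<lambda>i. norm (u i)) (k - m) = 0"
    using norm_lattice_point[OF u, of "k - m"] by (simp add: lattice_point_diff)
  then have "k - m = 0" using qform_pos[of "\<lambda>i. norm (u i)" "k - m"] orthogonal_basis_norm_pos[OF u] by force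
  then show "k = m" by simp
qed

lemma lattice_minus_0:
  assumes "orthogonal_basis u" shows "lattice u - {0} = lattice_point u ` (- {0})"
proof -
  have "lattice_point u m = 0 \<longleftrightarrow> m = 0" for m
    using inj_lattice_point[OF assms] by (metis inj_eq lattice_point_0)
  then show ?thesis unfolding lattice_def by auto
qed

section \<open>Periodic charges and their autocorrelation\<close>

definition int_cell :: "nat \<Rightarrow> ('n::finite \<Rightarrow> int) set" where
  "int_cell N = {m. \<forall>i. 0 \<le> m i \<and> m i < int N}"

lemma int_cell_PiE: "int_cell N = PiE UNIV (\<lambda>_. {0..<int N})"
  by (auto simp: int_cell_def PiE_def Pi_def)

lemma finite_int_cell [simp]: "finite (int_cell N)"
  unfolding int_cell_PiE by (intro finite_PiE) auto

lemma card_int_cell: "card (int_cell N :: ('n::finite \<Rightarrow> int) set) = N ^ CARD('n)"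
  unfolding int_cell_PiE by (simp add: card_PiE)

text \<open>The energy depends on the charges only through this average over one period.\<close>

definition autocorrelation :: "nat \<Rightarrow> (('n::finite \<Rightarrow> int) \<Rightarrow> real) \<Rightarrow> ('n \<Rightarrow> int) \<Rightarrow> real" where
  "autocorrelation N \<psi> m = 1 / real N ^ CARD('n) * (\<Sum>k\<in>int_cell N. \<psi> k * \<psi> (k + m))"

lemma sum_period_cell:
  assumes "orthogonal_basis u"
  shows "(\<Sum>x\<in>period_cell N u. h x) = (\<Sum>k\<in>int_cell N. h (lattice_point u k))"
  unfolding period_cell_def int_cell_def
  by (subst sum.reindex) (auto intro: inj_on_subset[OF inj_lattice_point[OF assms]])

lemma energy_orthogonal:
  fixes u :: "'n::finite \<Rightarrow> real ^ 'n"
  assumes u: "orthogonal_basis u"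
  shows "energy (\<lambda>r. r powr (- p)) (\<lambda>r. r powr (- q)) N u \<phi>
    = epstein (\<lambda>_. 1) (\<lambda>i. norm (u i)) p + epstein (autocorrelation N (\<lambda>k. \<phi> (lattice_point u k))) (\<lambda>i. norm (u i)) q"
proof -
  have inj: "inj_on (lattice_point u) (- {0})" by (rule inj_on_subset[OF inj_lattice_point[OF u]]) simp
  show ?thesis
    unfolding energy_def lattice_minus_0[OF u] infsum_reindex[OF inj] o_def norm_lattice_point[OF u]
      sum_period_cell[OF u] epstein_def autocorrelation_def lattice_point_add[symmetric]
    by (simp add: infsum_cmult_right'[symmetric] sum_distrib_right mult.assoc)
qed

definition periodic :: "nat \<Rightarrow> (('n \<Rightarrow> int) \<Rightarrow> real) \<Rightarrow> bool" where
  "periodic N h \<longleftrightarrow> (\<forall>k i. h (k + axis_int i (int N)) = h k)"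

lemma axis_int_0 [simp]: "axis_int i 0 = 0" by (simp add: axis_int_def fun_eq_iff)

lemma periodic_mult_axis:
  assumes "periodic N h" shows "h (k + axis_int i (int N * z)) = h k"
proof (induction z arbitrary: k rule: int_induct[where k=0])
  case (step1 z)
  have "h (k + axis_int i (int N * (z + 1))) = h ((k + axis_int i (int N * z)) + axis_int i (int N))"
    by (simp add: distrib_left axis_int_add add.assoc)
  then show ?case using assms step1 by (simp add: periodic_def plus_fun_def)
next
  case (step2 z)
  have "h k = h (k + axis_int i (int N * z))" using step2 by (simp add: plus_fun_def)
  also have "\<dots> = h ((k + axis_int i (int N * (z - 1))) + axis_int i (int N))"
    by (simp add: right_diff_distrib add.assoc axis_int_add[symmetric])
  also have "\<dots> = h (k + axis_int i (int N * (z - 1)))" using assms by (simp add: periodic_def)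
  finally show ?case by (simp add: plus_fun_def)
qed simp

lemma sum_fun_apply: "(\<Sum>i\<in>S. f i) x = (\<Sum>i\<in>S. f i x)"
  by (induction S rule: infinite_finite_induct) simp_all

lemma periodic_mult:
  fixes k :: "'n::finite \<Rightarrow> int"
  assumes "periodic N h" shows "h (k + (\<lambda>i. int N * v i)) = h k"
proof -
  have "h (k + (\<Sum>i\<in>S. axis_int i (int N * v i))) = h k" if "finite S" for S :: "'n set"
    using that
  proof (induction S)
    case (insert i S)
    have "h (k + (\<Sum>i\<in>insert i S. axis_int i (int N * v i)))
      = h ((k + (\<Sum>i\<in>S. axis_int i (int N * v i))) + axis_int i (int N * v i))"
      using insert.hyps by (simp add: add_ac)
    then show ?case using insert.IH periodic_mult_axis[OF assms] by (simp add: plus_fun_def)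
  qed simp
  moreover have "(\<Sum>i\<in>UNIV. axis_int i (int N * v i)) = (\<lambda>i. int N * v i)"
    by (simp add: fun_eq_iff axis_int_def sum_fun_apply)
  ultimately show ?thesis by (metis finite_class.finite_UNIV)
qed

lemma periodic_mod:
  fixes k :: "'n::finite \<Rightarrow> int"
  assumes "periodic N h" shows "h (\<lambda>i. k i mod int N) = h k"
proof -
  have "k = (\<lambda>i. k i mod int N) + (\<lambda>i. int N * (k i div int N))" by (simp add: fun_eq_iff)
  then show ?thesis using periodic_mult[OF assms] by metis
qed

lemma sum_int_cell_shift:
  assumes N: "1 \<le> N" and h: "periodic N h"
  shows "(\<Sum>k\<in>int_cell N. h (k + y)) = (\<Sum>k\<in>int_cell N. h k)"
proof -
  have "(\<Sum>k\<in>int_cell N. h (k + y)) = (\<Sum>k\<in>int_cell N. h (\<lambda>i. (k i + y i) mod int N))"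
    using periodic_mod[OF h, of "_ + y"] by simp
  also have "\<dots> = (\<Sum>k\<in>int_cell N. h k)"
    by (rule sum.reindex_bij_witness[of _ "\<lambda>k i. (k i - y i) mod int N" "\<lambda>k i. (k i + y i) mod int N"])
      (use N in \<open>auto simp: int_cell_def fun_eq_iff mod_simps\<close>)
  finally show ?thesis .
qed

lemma periodic_shift: "periodic N \<psi> \<Longrightarrow> periodic N (\<lambda>k. \<psi> (k + x))"
  unfolding periodic_def by (metis add.assoc add.commute)

lemma periodic_mult_fun: "periodic N f \<Longrightarrow> periodic N g \<Longrightarrow> periodic N (\<lambda>k. f k * g k)"
  by (simp add: periodic_def)

lemma autocorrelation_shift:
  fixes \<psi> :: "('n::finite \<Rightarrow> int) \<Rightarrow> real"
  assumes N: "1 \<le> N" and \<psi>: "periodic N \<psi>"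
  shows "autocorrelation N \<psi> (x - y) = 1 / real N ^ CARD('n) * (\<Sum>k\<in>int_cell N. \<psi> (k + x) * \<psi> (k + y))"
proof -
  have "periodic N (\<lambda>k. \<psi> k * \<psi> (k + (x - y)))"
    by (intro periodic_mult_fun \<psi> periodic_shift)
  from sum_int_cell_shift[OF N this, of y] show ?thesis
    by (simp add: autocorrelation_def algebra_simps)
qed

text \<open>Each cell point \<open>k\<close> contributes the square of
  \<open>\<Sum>x\<in>A. v x * \<psi> (k + x)\<close>; the form is the average of these.\<close>

lemma pos_def_autocorrelation:
  fixes \<psi> :: "('n::finite \<Rightarrow> int) \<Rightarrow> real"
  assumes "1 \<le> N" "periodic N \<psi>"
  shows "pos_def (autocorrelation N \<psi>)"
  unfolding pos_def_def
proof (intro allI impI)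
  fix A v assume "finite (A :: ('n \<Rightarrow> int) set)"
  have "(\<Sum>x\<in>A. \<Sum>y\<in>A. v x * v y * autocorrelation N \<psi> (x - y))
    = 1 / real N ^ CARD('n) * (\<Sum>k\<in>int_cell N. (\<Sum>x\<in>A. v x * \<psi> (k + x))\<^sup>2)"
  proof -
    have "(\<Sum>k\<in>int_cell N. (\<Sum>x\<in>A. v x * \<psi> (k + x))\<^sup>2)
      = (\<Sum>k\<in>int_cell N. \<Sum>x\<in>A. \<Sum>y\<in>A. v x * v y * (\<psi> (k + x) * \<psi> (k + y)))"
      by (simp add: power2_eq_square sum_product mult_ac)
    also have "\<dots> = (\<Sum>x\<in>A. \<Sum>k\<in>int_cell N. \<Sum>y\<in>A. v x * v y * (\<psi> (k + x) * \<psi> (k + y)))"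
      by (rule sum.swap)
    also have "\<dots> = (\<Sum>x\<in>A. \<Sum>y\<in>A. \<Sum>k\<in>int_cell N. v x * v y * (\<psi> (k + x) * \<psi> (k + y)))"
      by (intro sum.cong refl sum.swap)
    finally show ?thesis
      by (simp add: autocorrelation_shift[OF assms] sum_distrib_left mult_ac)
  qed
  then show "0 \<le> (\<Sum>x\<in>A. \<Sum>y\<in>A. v x * v y * autocorrelation N \<psi> (x - y))"
    by (simp add: sum_nonneg)
qed

lemma autocorrelation_0: "autocorrelation N \<psi> (0 :: 'n::finite \<Rightarrow> int) = 1 / real N ^ CARD('n) * (\<Sum>k\<in>int_cell N. (\<psi> k)\<^sup>2)"
  by (simp add: autocorrelation_def power2_eq_square)

lemma sum_square_shift:
  fixes \<psi> :: "('n::finite \<Rightarrow> int) \<Rightarrow> real"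
  assumes "1 \<le> N" "periodic N \<psi>"
  shows "(\<Sum>k\<in>int_cell N. (\<psi> (k + m))\<^sup>2) = (\<Sum>k\<in>int_cell N. (\<psi> k)\<^sup>2)"
  by (rule sum_int_cell_shift[OF assms(1)]) (use assms(2) in \<open>simp add: periodic_def\<close>)

lemma autocorrelation_abs_le:
  fixes \<psi> :: "('n::finite \<Rightarrow> int) \<Rightarrow> real"
  assumes "1 \<le> N" "periodic N \<psi>"
  shows "\<bar>autocorrelation N \<psi> m\<bar> \<le> autocorrelation N \<psi> 0"
proof -
  have "\<bar>\<Sum>k\<in>int_cell N. \<psi> k * \<psi> (k + m)\<bar> \<le> (\<Sum>k\<in>int_cell N. \<bar>\<psi> k * \<psi> (k + m)\<bar>)" by (rule sum_abs)
  also have "\<dots> \<le> (\<Sum>k\<in>int_cell N. ((\<psi> k)\<^sup>2 + (\<psi> (k + m))\<^sup>2) / 2)"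
  proof (rule sum_mono)
    fix k
    show "\<bar>\<psi> k * \<psi> (k + m)\<bar> \<le> ((\<psi> k)\<^sup>2 + (\<psi> (k + m))\<^sup>2) / 2"
      using sum_squares_bound[of "\<bar>\<psi> k\<bar>" "\<bar>\<psi> (k + m)\<bar>"] by (simp add: abs_mult)
  qed
  also have "\<dots> = (\<Sum>k\<in>int_cell N. (\<psi> k)\<^sup>2)"
    using sum_square_shift[OF assms, of m] by (simp add: sum_divide_distrib[symmetric] sum.distrib)
  finally show ?thesis
    unfolding autocorrelation_0 by (simp add: autocorrelation_def abs_mult divide_right_mono)
qed

text \<open>Translates the defect of the Gaussian inequality back to the charges: it is the mean
  square deviation from antiperiodicity along \<open>e\<close>.\<close>

lemma smear_autocorrelation:
  fixes \<psi> :: "('n::finite \<Rightarrow> int) \<Rightarrow> real"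
  assumes "1 \<le> N" "periodic N \<psi>"
  shows "smear 1 e (autocorrelation N \<psi>) 0 = 1 / real N ^ CARD('n) * (\<Sum>k\<in>int_cell N. (\<psi> k + \<psi> (k + e))\<^sup>2)"
proof -
  have "autocorrelation N \<psi> (- e) = autocorrelation N \<psi> e"
    using autocorrelation_shift[OF assms, of 0 e] by (simp add: autocorrelation_def mult.commute)
  then have 1: "smear 1 e (autocorrelation N \<psi>) 0 = 2 * (autocorrelation N \<psi> 0 + autocorrelation N \<psi> e)"
    by (simp add: smear_def)
  have "(\<Sum>k\<in>int_cell N. (\<psi> k + \<psi> (k + e))\<^sup>2)
    = (\<Sum>k\<in>int_cell N. (\<psi> k)\<^sup>2) + (\<Sum>k\<in>int_cell N. (\<psi> (k + e))\<^sup>2) + 2 * (\<Sum>k\<in>int_cell N. \<psi> k * \<psi> (k + e))"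
    by (simp add: power2_sum sum.distrib sum_distrib_left mult.assoc)
  then have 2: "(\<Sum>k\<in>int_cell N. (\<psi> k + \<psi> (k + e))\<^sup>2)
    = 2 * ((\<Sum>k\<in>int_cell N. (\<psi> k)\<^sup>2) + (\<Sum>k\<in>int_cell N. \<psi> k * \<psi> (k + e)))"
    using sum_square_shift[OF assms, of e] by simp
  show ?thesis unfolding 1 2 autocorrelation_0 unfolding autocorrelation_def by (simp add: algebra_simps)
qed

lemma alt_add: "alt (a + b) = alt a * alt b"
  by (auto simp: alt_def)

lemma alternating_add: "alternating (k + m) = alternating k * alternating m"
  by (simp add: alternating_def alt_add prod.distrib)

lemma alternating_eq: "alternating m = (if even (\<Sum>i\<in>UNIV. m i) then 1 else - 1)"
proof -
  have "(\<Prod>i\<in>S. alt (m i)) = alt (\<Sum>i\<in>S. m i)" if "finite S" for S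
    using that by induction (auto simp: alt_add, simp add: alt_def)
  then show ?thesis by (simp add: alternating_def alt_def)
qed

lemma alternating_axis: "alternating (axis_int i k) = alt k"
proof -
  have "alternating (axis_int i k) = (\<Prod>j\<in>UNIV. if j = i then alt k else 1)"
    unfolding alternating_def axis_int_def by (rule prod.cong) (auto simp: alt_def)
  then show ?thesis by simp
qed

lemma alternate_lattice_point:
  assumes "orthogonal_basis u" shows "alternate u (lattice_point u k) = alternating k"
  unfolding alternate_def alternating_eq using inj_eq[OF inj_lattice_point[OF assms]] by auto

lemma alternating_square [simp]: "alternating k * alternating k = 1"
  using abs_alternating[of k] by (metis abs_mult_self_eq mult_1)

lemma autocorrelation_alternating:
  assumes "1 \<le> N" shows "autocorrelation N alternating = alternating"
proof
  fix m :: "'a \<Rightarrow> int"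
  have "(\<Sum>k\<in>int_cell N. alternating k * alternating (k + m)) = (\<Sum>k\<in>(int_cell N :: ('a \<Rightarrow> int) set). alternating m)"
    by (simp add: alternating_add mult.assoc[symmetric])
  then show "autocorrelation N alternating m = alternating m"
    using assms by (simp add: autocorrelation_def card_int_cell)
qed

lemma charge_periodic:
  assumes u: "orthogonal_basis u" and \<phi>: "\<phi> \<in> charge_distributions N u"
  shows "periodic N (\<lambda>k. \<phi> (lattice_point u k))"
  using \<phi> unfolding charge_distributions_def periodic_def lattice_def
  by (simp add: lattice_point_add lattice_point_axis)

lemma charge_autocorrelation_0:
  assumes u: "orthogonal_basis u" and \<phi>: "\<phi> \<in> charge_distributions N u" and N: "1 \<le> N"
  shows "autocorrelation N (\<lambda>k. \<phi> (lattice_point u k)) 0 = 1"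
  using \<phi> N unfolding charge_distributions_def autocorrelation_0 sum_period_cell[OF u] by simp

lemma alternating_if_antiperiodic:
  fixes \<psi> :: "('n::finite \<Rightarrow> int) \<Rightarrow> real"
  assumes "\<And>k i. \<psi> (k + axis_int i 1) = - \<psi> k"
  shows "\<psi> k = alternating k * \<psi> 0"
proof -
  have ax: "\<psi> (k + axis_int i z) = alt z * \<psi> k" for k i z
  proof (induction z rule: int_induct[where k=0])
    case base then show ?case by (simp add: alt_def)
  next
    case (step1 z)
    have "\<psi> (k + axis_int i (z + 1)) = - \<psi> (k + axis_int i z)"
      using assms[of "k + axis_int i z" i] by (simp add: axis_int_add add.assoc)
    then show ?case using step1 by (simp add: alt_def plus_fun_def)
  next
    case (step2 z)
    have "\<psi> (k + axis_int i (z - 1)) = - \<psi> (k + axis_int i z)"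
      using assms[of "k + axis_int i (z - 1)" i] by (simp add: add.assoc axis_int_add[symmetric])
    then show ?case using step2 by (simp add: alt_def plus_fun_def)
  qed
  have "\<psi> (\<Sum>i\<in>S. axis_int i (k i)) = (\<Prod>i\<in>S. alt (k i)) * \<psi> 0" if "finite S" for S
    using that
  proof induction
    case (insert i S)
    have "\<psi> (\<Sum>i\<in>insert i S. axis_int i (k i)) = \<psi> ((\<Sum>i\<in>S. axis_int i (k i)) + axis_int i (k i))"
      using insert.hyps by (simp add: add.commute)
    also have "\<dots> = alt (k i) * \<psi> (\<Sum>i\<in>S. axis_int i (k i))" by (rule ax)
    finally show ?case using insert by (simp add: zero_fun_def plus_fun_def)
  qed simp
  moreover have "(\<Sum>i\<in>UNIV. axis_int i (k i)) = k"
    by (simp add: fun_eq_iff axis_int_def sum_fun_apply)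
  ultimately show ?thesis by (metis alternating_def finite_class.finite_UNIV)
qed

lemma charge_energy:
  fixes u :: "'n::finite \<Rightarrow> real ^ 'n"
  assumes u: "orthogonal_basis u" and \<phi>: "\<phi> \<in> charge_distributions N u" and N: "1 \<le> N"
    and q: "real CARD('n) / 2 < q"
  defines "c \<equiv> autocorrelation N (\<lambda>k. \<phi> (lattice_point u k))" and "b \<equiv> \<lambda>i. norm (u i)"
  shows "epstein alternating b q \<le> epstein c b q"
    and "epstein alternating b q = epstein c b q \<longleftrightarrow> even N \<and> (\<forall>x\<in>lattice u. \<phi> x = alternate u x)"
proof -
  let ?\<psi> = "\<lambda>k. \<phi> (lattice_point u k)"
  note per = charge_periodic[OF u \<phi>]
  have b: "0 < b i" for i unfolding b_def by (rule orthogonal_basis_norm_pos[OF u])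
  have c: "pos_def c" "\<And>m. \<bar>c m\<bar> \<le> 1" "c 0 = 1"
    unfolding c_def
    using pos_def_autocorrelation[OF N per] autocorrelation_abs_le[OF N per] charge_autocorrelation_0[OF u \<phi> N]
    by auto
  show "epstein alternating b q \<le> epstein c b q" by (rule epstein_charge_ge(1)[OF b q c])
  show "epstein alternating b q = epstein c b q \<longleftrightarrow> even N \<and> (\<forall>x\<in>lattice u. \<phi> x = alternate u x)"
  proof
    assume eq: "epstein alternating b q = epstein c b q"
    have "?\<psi> (k + axis_int i 1) = - ?\<psi> k" for k i
    proof -
      let ?h = "\<lambda>k. (?\<psi> k + ?\<psi> (k + axis_int i 1))\<^sup>2"
      have ph: "periodic N ?h"
        using per periodic_shift[OF per, of "axis_int i 1"] by (simp add: periodic_def)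
      have "smear 1 (axis_int i 1) c 0 = 0" by (rule epstein_charge_ge(2)[OF b q c eq])
      then have "(\<Sum>k\<in>int_cell N. ?h k) = 0"
        unfolding c_def smear_autocorrelation[OF N per] using N by simp
      then have "\<forall>k\<in>int_cell N. ?h k = 0" by (subst (asm) sum_nonneg_eq_0_iff) auto
      moreover have "(\<lambda>j. k j mod int N) \<in> int_cell N" using N by (simp add: int_cell_def)
      ultimately have "?h (\<lambda>j. k j mod int N) = 0" by blast
      then have "?h k = 0" using periodic_mod[OF ph, of k] by simp
      then show ?thesis by simp
    qed
    then have al: "?\<psi> k = alternating k * \<phi> 0" for k
      using alternating_if_antiperiodic[of ?\<psi> k] by simp
    \<comment> \<open>The normalization leaves only \<open>1\<close> and \<open>- 1\<close> for
      \<open>\<phi> 0\<close>; the condition \<open>\<phi> 0 > 0\<close> selects the sign.\<close>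
    have "c 0 = (\<phi> 0)\<^sup>2"
      unfolding c_def autocorrelation_0 al power_mult_distrib
      using N by (simp add: power2_eq_square card_int_cell)
    moreover have p0: "0 < \<phi> 0" using \<phi> by (simp add: charge_distributions_def)
    ultimately have 1: "\<phi> 0 = 1" using c(3) by (simp add: power2_eq_1_iff)
    \<comment> \<open>Translation by \<open>N\<close> along any one axis both fixes the charge and
      multiplies it by \<open>alt (int N)\<close>, which forces \<open>N\<close> to be even.\<close>
    have "?\<psi> (0 + axis_int undefined (int N)) = ?\<psi> 0" using per unfolding periodic_def by blast
    then have "alt (int N) = 1" unfolding al 1 by (simp add: alternating_axis)
    then have "even N" by (simp add: alt_def split: if_splits)
    moreover have "\<forall>x\<in>lattice u. \<phi> x = alternate u x"
      unfolding lattice_def using al 1 by (auto simp: alternate_lattice_point[OF u])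
    ultimately show "even N \<and> (\<forall>x\<in>lattice u. \<phi> x = alternate u x)" by simp
  next
    assume "even N \<and> (\<forall>x\<in>lattice u. \<phi> x = alternate u x)"
    then have "?\<psi> = alternating" by (auto simp: fun_eq_iff lattice_def alternate_lattice_point[OF u])
    then show "epstein alternating b q = epstein c b q"
      by (simp add: c_def autocorrelation_alternating[OF N])
  qed
qed

lemma energy_alternate:
  fixes u :: "'n::finite \<Rightarrow> real ^ 'n"
  assumes u: "orthogonal_basis u"
  shows "energy (\<lambda>r. r powr (- p)) (\<lambda>r. r powr (- q)) 2 u (alternate u)
    = epstein (\<lambda>_. 1) (\<lambda>i. norm (u i)) p + epstein alternating (\<lambda>i. norm (u i)) q"
  unfolding energy_orthogonal[OF u] alternate_lattice_point[OF u]
  by (simp add: autocorrelation_alternating)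

lemma alternate_charge:
  fixes u :: "'n::finite \<Rightarrow> real ^ 'n"
  assumes u: "orthogonal_basis u"
  shows "alternate u \<in> charge_distributions 2 u"
proof -
  have "alternate u (x + real 2 *\<^sub>R u i) = alternate u x" if xL: "x \<in> lattice u" for x i
  proof -
    obtain k where x: "x = lattice_point u k" using xL by (auto simp: lattice_def)
    have "x + real 2 *\<^sub>R u i = lattice_point u (k + axis_int i 2)"
      by (simp add: x lattice_point_add lattice_point_axis)
    then show ?thesis
      by (simp only: x alternate_lattice_point[OF u] alternating_add alternating_axis) (simp add: alt_def)
  qed
  moreover have "alternate u 0 = 1" using alternate_lattice_point[OF u, of 0] by simp
  moreover have "(\<Sum>x\<in>period_cell 2 u. (alternate u x)\<^sup>2) = real 2 ^ CARD('n)"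
    unfolding sum_period_cell[OF u] alternate_lattice_point[OF u]
    by (simp add: power2_eq_square card_int_cell)
  ultimately show ?thesis unfolding charge_distributions_def by simp
qed


section \<open>Volume and isometry of orthorhombic lattices\<close>

lemma abs_det_orthogonal_basis:
  fixes u :: "'n::finite \<Rightarrow> real ^ 'n"
  assumes u: "orthogonal_basis u"
  shows "\<bar>det (\<chi> i. u i)\<bar> = (\<Prod>i\<in>UNIV. norm (u i))"
proof -
  let ?A = "\<chi> i. u i"
  have e: "(?A ** transpose ?A) $ i $ j = u i \<bullet> u j" for i j
    by (simp add: matrix_matrix_mult_def transpose_def inner_vec_def)
  have "(det ?A)\<^sup>2 = det (?A ** transpose ?A)" by (simp add: det_mul det_transpose power2_eq_square)
  also have "\<dots> = (\<Prod>i\<in>UNIV. (?A ** transpose ?A) $ i $ i)"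
    by (rule det_diagonal) (use u in \<open>auto simp: e orthogonal_basis_iff orthogonal_def\<close>)
  also have "\<dots> = (\<Prod>i\<in>UNIV. norm (u i))\<^sup>2"
    by (simp add: e power2_norm_eq_inner prod_power_distrib)
  finally have "\<bar>det ?A\<bar>\<^sup>2 = (\<Prod>i\<in>UNIV. norm (u i))\<^sup>2" by simp
  then show ?thesis by (rule power2_eq_imp_eq) (auto intro: prod_nonneg)
qed

lemma det_Ints:
  fixes M :: "real ^ 'n ^ 'n::finite"
  assumes "\<And>i j. M $ i $ j \<in> \<int>" shows "det M \<in> \<int>"
  unfolding det_def by (intro Ints_sum Ints_mult Ints_prod assms) auto

lemma lattice_basis_change:
  fixes u w :: "'n::finite \<Rightarrow> real ^ 'n"
  assumes "lattice u \<subseteq> lattice w"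
  obtains z where "z \<in> \<int>" "det (\<chi> i. u i) = z * det (\<chi> i. w i)"
proof -
  have "\<exists>m. u i = lattice_point w m" for i
  proof -
    have "u i \<in> lattice u" unfolding lattice_def using lattice_point_axis[of u i 1] by (metis of_int_1 rangeI scaleR_one)
    then show ?thesis using assms by (auto simp: lattice_def)
  qed
  then obtain m where m: "\<And>i. u i = lattice_point w (m i)" by metis
  define M :: "real ^ 'n ^ 'n" where "M = (\<chi> i j. of_int (m i j))"
  have "(\<chi> i. u i) = M ** (\<chi> i. w i)"
    by (simp add: vec_eq_iff M_def m lattice_point_def matrix_matrix_mult_def)
  then have "det (\<chi> i. u i) = det M * det (\<chi> i. w i)" by (simp add: det_mul)
  moreover have "det M \<in> \<int>" by (rule det_Ints) (simp add: M_def)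
  ultimately show ?thesis using that by blast
qed

text \<open>Membership in \<open>orthorhombic V\<close> provides some orthogonal basis, not the one
  under consideration. Two bases of one lattice are related by integral matrices, whose determinants
  are inverse to each other and hence of absolute value 1.\<close>

lemma volume_lattice_eq:
  fixes u w :: "'n::finite \<Rightarrow> real ^ 'n"
  assumes L: "lattice u = lattice w" and w: "det (\<chi> i. w i) \<noteq> 0"
  shows "volume u = volume w"
proof -
  let ?U = "det (\<chi> i. u i)" and ?W = "det (\<chi> i. w i)"
  obtain a where a: "a \<in> \<int>" "?U = a * ?W" using lattice_basis_change[of u w] L by blast
  obtain b where b: "b \<in> \<int>" "?W = b * ?U" using lattice_basis_change[of w u] L by blast
  have "?W = (b * a) * ?W" using a(2) b(2) by (metis mult.assoc)
  then have ba: "b * a = 1" using w by simp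
  obtain a' b' where ab: "a = of_int a'" "b = of_int b'" using a b by (auto elim!: Ints_cases)
  have "b' * a' = 1" using ba unfolding ab by (metis of_int_1 of_int_eq_iff of_int_mult)
  then have "\<bar>a' * b'\<bar> = 1" by (simp add: mult.commute)
  then have "\<bar>a'\<bar> = 1" by (rule abs_zmult_eq_1)
  then have "\<bar>a\<bar> = 1" unfolding ab by (metis of_int_1 of_int_abs)
  then show ?thesis by (simp add: volume_def a(2) abs_mult)
qed

lemma orthorhombic_prod_norm:
  fixes u :: "'n::finite \<Rightarrow> real ^ 'n"
  assumes u: "orthogonal_basis u" and L: "lattice u \<in> orthorhombic 1"
  shows "(\<Prod>i\<in>UNIV. norm (u i)) = 1"
proof -
  obtain w where w: "orthogonal_basis w" "lattice u = lattice w" "volume w = 1"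
    using L by (auto simp: orthorhombic_def)
  then have "det (\<chi> i. w i) \<noteq> 0" by (metis abs_zero volume_def zero_neq_one)
  from volume_lattice_eq[OF w(2) this] have "volume u = 1" using w(3) by (rule trans)
  then show ?thesis using abs_det_orthogonal_basis[OF u] by (simp add: volume_def)
qed

lemma orthogonal_basis_scale: "orthogonal_basis u \<Longrightarrow> v \<noteq> 0 \<Longrightarrow> orthogonal_basis (scale_basis v u)"
  by (simp add: orthogonal_basis_iff scale_basis_def orthogonal_def)

lemma orthogonal_basis_std: "orthogonal_basis (std_basis :: 'n::finite \<Rightarrow> real ^ 'n)"
  unfolding orthogonal_basis_iff std_basis_def orthogonal_def by (simp add: inner_axis_axis)

lemma norm_std_basis [simp]: "norm (std_basis i) = 1" by (simp add: std_basis_def)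

text \<open>Nonzero vectors of the cubic lattice have length at least 1, so no edge is shorter than
  1; as the product is 1, none is longer.\<close>

lemma norm_1_if_isometric:
  fixes u :: "'n::finite \<Rightarrow> real ^ 'n"
  assumes u: "orthogonal_basis u" and prod: "(\<Prod>i\<in>UNIV. norm (u i)) = 1"
    and T: "orthogonal_transformation T" "T ` lattice u = lattice (std_basis :: 'n \<Rightarrow> real ^ 'n)"
  shows "norm (u i) = 1"
proof -
  have ge: "1 \<le> norm (u i)" for i
  proof -
    have "u i \<in> lattice u" unfolding lattice_def using lattice_point_axis[of u i 1] by (metis of_int_1 rangeI scaleR_one)
    then obtain m where m: "T (u i) = lattice_point (std_basis :: 'n \<Rightarrow> real ^ 'n) m"
      using T(2) unfolding lattice_def by blast
    have n: "norm (u i) = norm (T (u i))" using T(1) by (simp add: orthogonal_transformation_norm)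
    have "m \<noteq> 0"
    proof
      assume "m = 0"
      then have "norm (u i) = 0" using n m by simp
      then show False using orthogonal_basis_norm_pos[OF u, of i] by simp
    qed
    then have "1 \<le> (norm (u i))\<^sup>2"
      using qform_1_ge_1[of m] norm_lattice_point[OF orthogonal_basis_std, of m] by (simp add: n m)
    then show ?thesis using power2_le_imp_le[of 1 "norm (u i)"] by simp
  qed
  show ?thesis
  proof (rule ccontr)
    assume "norm (u i) \<noteq> 1"
    then have "1 < norm (u i)" using ge[of i] by simp
    then have "1 < (\<Prod>i\<in>UNIV. norm (u i))" using ge by (intro less_1_prod2[of _ i]) auto
    then show False using prod by simp
  qed
qed

text \<open>The matrix with rows \<open>u i\<close> is orthogonal and sends \<open>u j\<close> to
  the \<open>j\<close>-th standard basis vector.\<close>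

lemma isometric_if_norm_1:
  fixes u :: "'n::finite \<Rightarrow> real ^ 'n"
  assumes u: "orthogonal_basis u" and 1: "\<And>i. norm (u i) = 1"
  shows "\<exists>T. orthogonal_transformation T \<and> T ` lattice u = lattice (std_basis :: 'n \<Rightarrow> real ^ 'n)"
proof -
  let ?P = "(\<chi> i. u i) :: real ^ 'n ^ 'n"
  let ?T = "\<lambda>x. ?P *v x"
  have "orthogonal_matrix ?P"
    unfolding orthogonal_matrix_orthonormal_rows
    using u 1 by (simp add: row_def orthogonal_basis_iff)
  then have "orthogonal_transformation ?T"
    by (simp add: orthogonal_transformation_matrix)
  moreover have "?T (u j) = std_basis j" for j
    using u 1[of j] by (auto simp: vec_eq_iff matrix_vector_mul_component std_basis_def axis_def
      orthogonal_basis_iff orthogonal_def norm_eq_1)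
  then have "?T (lattice_point u m) = lattice_point std_basis m" for m
    unfolding lattice_point_def by (simp add: linear_sum[OF matrix_vector_mul_linear] linear_scale[OF matrix_vector_mul_linear])
  then have "?T ` lattice u = lattice (std_basis :: 'n \<Rightarrow> real ^ 'n)"
    unfolding lattice_def by (simp add: image_image)
  ultimately show ?thesis by blast
qed


section \<open>Lattices of negative energy and comparison of energies\<close>

lemma exists_powr_gt:
  fixes c e :: real
  assumes "0 < e" obtains R where "1 \<le> R" "c < R powr e"
proof -
  have "1 \<le> (\<bar>c\<bar> + 1) powr (1 / e)" using assms by (intro ge_one_powr_ge_zero) auto
  moreover have "c < ((\<bar>c\<bar> + 1) powr (1 / e)) powr e" using assms by (simp add: powr_powr)
  ultimately show ?thesis using that by blast
qed

text \<open>Dividing by the shortest edge \<open>r\<close> gives shortest edge 1, where the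
  repulsive sum is at most \<open>F1\<close> and the alternating sum at most \<open>- g\<close>. The
  scale factors are powers of \<open>R = r\<^sup>2\<close>, and as \<open>p > q\<close> a large
  \<open>R\<close> makes the negative part dominate, whatever the other edges are.\<close>

lemma negative_energy:
  fixes p q :: real
  assumes q: "real CARD('n::finite) / 2 < q" and pq: "q < p"
  obtains r \<epsilon> where "1 \<le> r" "0 < \<epsilon>"
    "\<And>b :: 'n \<Rightarrow> real. (\<And>i. r \<le> b i) \<Longrightarrow> (\<exists>j. b j = r) \<Longrightarrow>
      epstein (\<lambda>_. 1) b p + epstein alternating b q \<le> - \<epsilon>"
proof -
  have q0: "0 < q" by (rule half_card_less_imp_pos[OF q])
  define F1 where "F1 = epstein (\<lambda>_. 1) (\<lambda>_ :: 'n. 1) p"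
  define g where "g = exp (- 2) / (2 * Gamma q)"
  have g: "0 < g" unfolding g_def using Gamma_real_pos[OF q0] by simp
  obtain R where R: "1 \<le> R" "F1 / g < R powr (p - q)" using exists_powr_gt[of "p - q" "F1 / g"] pq by auto
  define r where "r = sqrt R"
  have r: "1 \<le> r" "r\<^sup>2 = R" using R by (simp_all add: r_def)
  define \<epsilon> where "\<epsilon> = R powr (- q) * g - R powr (- p) * F1"
  have "F1 < g * R powr (p - q)" using R g by (simp add: pos_divide_less_eq mult.commute)
  then have "R powr (- p) * F1 < R powr (- p) * (g * R powr (p - q))"
    using R by (intro mult_strict_left_mono) auto
  also have "\<dots> = R powr (- q) * g" using R by (simp add: powr_diff powr_minus field_simps)
  finally have e: "0 < \<epsilon>" by (simp add: \<epsilon>_def)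
  show ?thesis
  proof (rule that[OF r(1) e])
    fix b :: "'n \<Rightarrow> real" assume b: "\<And>i. r \<le> b i" and "\<exists>j. b j = r"
    then obtain j where j: "b j = r" by blast
    define b' where "b' i = b i / r" for i
    have b': "1 \<le> b' i" "b' j = 1" for i using b[of i] r j by (auto simp: b'_def)
    have bb: "b = (\<lambda>i. r * b' i)" using r by (auto simp: b'_def)
    have "epstein (\<lambda>_. 1) b' p \<le> F1"
      unfolding F1_def
    proof (rule epstein_1_antimono)
      show "1\<^sup>2 \<le> (b' i)\<^sup>2" for i using b'(1)[of i] by (intro power_mono) auto
      show "0 < b' i" for i using b'(1)[of i] by linarith
    qed (use q pq in auto)
    then have "R powr (- p) * epstein (\<lambda>_. 1) b' p \<le> R powr (- p) * F1" by (intro mult_left_mono) auto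
    moreover have "R powr (- q) * epstein alternating b' q \<le> R powr (- q) * - g"
      using epstein_alternating_neg[of b' j q, OF b' q] by (intro mult_left_mono) (auto simp: g_def)
    ultimately have "R powr (- p) * epstein (\<lambda>_. 1) b' p + R powr (- q) * epstein alternating b' q \<le> - \<epsilon>"
      by (simp add: \<epsilon>_def)
    then show "epstein (\<lambda>_. 1) b p + epstein alternating b q \<le> - \<epsilon>"
      unfolding bb using r by (simp add: epstein_scale)
  qed
qed

lemma epstein_1_eq_imp:
  fixes a :: "'n::finite \<Rightarrow> real"
  assumes a: "\<And>i. 0 < a i" and prod: "(\<Prod>i\<in>UNIV. a i) = 1" and q: "real CARD('n) / 2 < q"
    and eq: "epstein (\<lambda>_. 1) a q = epstein (\<lambda>_. 1) (\<lambda>_ :: 'n. 1) q"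
  shows "a i = 1"
proof -
  have q0: "0 < q" by (rule half_card_less_imp_pos[OF q])
  let ?S = "\<Sum>i\<in>UNIV. min 1 ((2 * ln (a i))\<^sup>2)"
  have "0 < exp (- (pi * exp 2)) / 224 / Gamma q" using Gamma_real_pos[OF q0] by simp
  moreover have "exp (- (pi * exp 2)) / 224 / Gamma q * ?S \<le> 0"
    by (rule order_trans[OF epstein_1_gap[OF a prod q]]) (simp add: eq)
  ultimately have "?S \<le> 0" by (meson mult_pos_pos not_le)
  moreover have "0 \<le> ?S" by (intro sum_nonneg) auto
  ultimately have "?S = 0" by linarith
  then have "\<forall>i\<in>UNIV. min 1 ((2 * ln (a i))\<^sup>2) = 0" by (subst (asm) sum_nonneg_eq_0_iff) auto
  then have "min 1 ((2 * ln (a i))\<^sup>2) = 0" by blast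
  then have "ln (a i) = 0" by (simp add: min_def split: if_splits)
  then show ?thesis using a[of i] by simp
qed

text \<open>In units where the volume is 1, the energy is \<open>A F + B G\<close>, with \<open>F\<close> and \<open>G\<close> the two lattice sums;
  for small volumes \<open>A\<close> exceeds \<open>K B\<close>, with \<open>K\<close> from \<open>epstein_alternating_le_epstein_1\<close>.\<close>

lemma small_volume:
  fixes u :: "'n::finite \<Rightarrow> real ^ 'n" and \<phi> :: "real ^ 'n \<Rightarrow> real"
  assumes q: "real CARD('n) / 2 < q" and pq: "q < p"
    and K: "\<And>b :: 'n \<Rightarrow> real. (\<And>i. 0 < b i) \<Longrightarrow> (\<Prod>i\<in>UNIV. b i) = 1 \<Longrightarrow>
      epstein alternating (\<lambda>_ :: 'n. 1) q - epstein alternating b q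
        \<le> K * (epstein (\<lambda>_. 1) b p - epstein (\<lambda>_. 1) (\<lambda>_ :: 'n. 1) p)"
    and v: "0 < v" "K * (v\<^sup>2) powr (- q) < (v\<^sup>2) powr (- p)"
    and u: "orthogonal_basis u" "lattice u \<in> orthorhombic 1"
    and N: "1 \<le> N" and \<phi>: "\<phi> \<in> charge_distributions N (scale_basis v u)"
  defines "E \<equiv> energy (\<lambda>r. r powr (- p)) (\<lambda>r. r powr (- q)) N (scale_basis v u) \<phi>"
    and "E0 \<equiv> energy (\<lambda>r. r powr (- p)) (\<lambda>r. r powr (- q)) 2 (scale_basis v (std_basis :: 'n \<Rightarrow> real ^ 'n)) (alternate (scale_basis v std_basis))"
  shows "E0 \<le> E" and "E = E0 \<longleftrightarrow> even N \<and> (\<forall>x\<in>lattice (scale_basis v u). \<phi> x = alternate (scale_basis v u) x) \<and>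
    (\<exists>T. orthogonal_transformation T \<and> T ` lattice u = lattice (std_basis :: 'n \<Rightarrow> real ^ 'n))"
proof -
  have v0: "v \<noteq> 0" using v by simp
  note vu = orthogonal_basis_scale[OF u(1) v0] and vZ = orthogonal_basis_scale[OF orthogonal_basis_std v0]
  define a where "a i = norm (u i)" for i
  have a: "0 < a i" for i unfolding a_def by (rule orthogonal_basis_norm_pos[OF u(1)])
  have prod: "(\<Prod>i\<in>UNIV. a i) = 1" unfolding a_def by (rule orthorhombic_prod_norm[OF u])
  define A B where "A = (v\<^sup>2) powr (- p)" and "B = (v\<^sup>2) powr (- q)"
  have AB: "0 < B" "0 < A" "0 < A - K * B" using v by (simp_all add: A_def B_def)
  define F F1 where "F = epstein (\<lambda>_. 1) a p" and "F1 = epstein (\<lambda>_. 1) (\<lambda>_ :: 'n. 1) p"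
  define c where "c = autocorrelation N (\<lambda>k. \<phi> (lattice_point (scale_basis v u) k))"
  define G G1 Gc where "G = epstein alternating a q" and "G1 = epstein alternating (\<lambda>_ :: 'n. 1) q" and "Gc = epstein c a q"
  have nu: "(\<lambda>i. norm (scale_basis v u i)) = (\<lambda>i. v * a i)" using v by (simp add: scale_basis_def a_def)
  have nZ: "(\<lambda>i. norm (scale_basis v std_basis i :: real ^ 'n)) = (\<lambda>i. v * 1)" using v by (simp add: scale_basis_def)
  note sc = epstein_scale[OF less_imp_le[OF v(1)]]
  have E: "E = A * F + B * Gc"
    unfolding E_def energy_orthogonal[OF vu] nu sc A_def B_def F_def Gc_def c_def ..
  have E0: "E0 = A * F1 + B * G1"
    unfolding E0_def energy_alternate[OF vZ] nZ sc A_def B_def F1_def G1_def ..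
  have "B * G \<le> B * Gc" and eqc: "B * G = B * Gc \<longleftrightarrow> even N \<and> (\<forall>x\<in>lattice (scale_basis v u). \<phi> x = alternate (scale_basis v u) x)"
    using charge_energy[OF vu \<phi> N q] unfolding nu sc c_def[symmetric] G_def Gc_def B_def by auto
  then have c1: "0 \<le> B * (Gc - G)" by (simp add: right_diff_distrib)
  have D0: "0 \<le> F - F1"
  proof -
    have "0 \<le> exp (- (pi * exp 2)) / 224 / Gamma p * (\<Sum>i\<in>UNIV. min 1 ((2 * ln (a i))\<^sup>2))"
      using q pq of_nat_0_le_iff[of "CARD('n)", where 'a=real]
      by (intro mult_nonneg_nonneg divide_nonneg_pos sum_nonneg Gamma_real_pos) auto
    also have "\<dots> \<le> F - F1" unfolding F_def F1_def by (rule epstein_1_gap[OF a prod]) (use q pq in simp)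
    finally show ?thesis .
  qed
  have "B * (G1 - G) \<le> B * (K * (F - F1))"
    using K[of a, OF a prod] AB unfolding F_def F1_def G_def G1_def by (intro mult_left_mono) auto
  moreover have "E - E0 = A * (F - F1) - B * (G1 - G) + B * (Gc - G)"
    unfolding E E0 by (simp add: algebra_simps)
  \<comment> \<open>Both summands on the left are nonnegative, so equality of energies annihilates
    each: the first identifies the lattice, the second the charges and the parity of
    \<open>N\<close>.\<close>
  ultimately have diff: "(A - K * B) * (F - F1) + B * (Gc - G) \<le> E - E0"
    by (simp add: algebra_simps)
  have c2: "0 \<le> (A - K * B) * (F - F1)" using AB D0 by simp
  show "E0 \<le> E" using diff c1 c2 by linarith
  show "E = E0 \<longleftrightarrow> even N \<and> (\<forall>x\<in>lattice (scale_basis v u). \<phi> x = alternate (scale_basis v u) x) \<and>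
    (\<exists>T. orthogonal_transformation T \<and> T ` lattice u = lattice (std_basis :: 'n \<Rightarrow> real ^ 'n))"
  proof
    assume "E = E0"
    then have "B * (Gc - G) = 0" "(A - K * B) * (F - F1) = 0" using diff c1 c2 by linarith+
    then have g: "B * G = B * Gc" and f: "F = F1" using AB by auto
    have "a i = 1" for i
      by (rule epstein_1_eq_imp[OF a prod, of p]) (use q pq f in \<open>auto simp: F_def F1_def\<close>)
    then show "even N \<and> (\<forall>x\<in>lattice (scale_basis v u). \<phi> x = alternate (scale_basis v u) x) \<and>
      (\<exists>T. orthogonal_transformation T \<and> T ` lattice u = lattice (std_basis :: 'n \<Rightarrow> real ^ 'n))"
      using g eqc isometric_if_norm_1[OF u(1)] by (simp add: a_def)
  next
    assume R: "even N \<and> (\<forall>x\<in>lattice (scale_basis v u). \<phi> x = alternate (scale_basis v u) x) \<and>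
      (\<exists>T. orthogonal_transformation T \<and> T ` lattice u = lattice (std_basis :: 'n \<Rightarrow> real ^ 'n))"
    then have "a = (\<lambda>_. 1)" using norm_1_if_isometric[OF u(1) prod[unfolded a_def]] by (auto simp: a_def)
    then have "F = F1" "G = G1" by (simp_all add: F_def F1_def G_def G1_def)
    moreover have "B * G = B * Gc" using R eqc by blast
    ultimately show "E = E0" by (auto simp: E E0)
  qed
qed

text \<open>The claim for large volumes has two readings. Against all charged lattices it holds in
  every dimension. At equal volume it is stated for \<open>d \<ge> 2\<close>: on the line all
  lattices of volume \<open>V\<close> coincide, and the alternate charges are optimal there at every
  volume.\<close>

theorem theorem2p2:
  fixes p q :: real
  assumes "p > q" and "q > real CARD('n::finite) / 2"
  defines "f1 \<equiv> \<lambda>r::real. r powr (- p)"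
    and "f2 \<equiv> \<lambda>r::real. r powr (- q)"
    and "s \<equiv> \<lambda>V::real. V powr (1 / real CARD('n))"
    and "Z \<equiv> std_basis :: 'n \<Rightarrow> real ^ 'n"
  shows "\<exists>V0 > 0. \<exists>V1 > 0.
    (\<forall>V. 0 < V \<and> V < V0 \<longrightarrow>
      (\<forall>L \<in> orthorhombic 1. \<forall>u :: 'n \<Rightarrow> real ^ 'n. orthogonal_basis u \<and> L = lattice u \<longrightarrow>
        (\<forall>N \<ge> 1. \<forall>\<phi> \<in> charge_distributions N (scale_basis (s V) u).
          energy f1 f2 N (scale_basis (s V) u) \<phi>
            \<ge> energy f1 f2 2 (scale_basis (s V) Z) (alternate (scale_basis (s V) Z)) \<and>
          (energy f1 f2 N (scale_basis (s V) u) \<phi>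
             = energy f1 f2 2 (scale_basis (s V) Z) (alternate (scale_basis (s V) Z))
           \<longleftrightarrow> even N \<and>
               (\<forall>x \<in> lattice (scale_basis (s V) u). \<phi> x = alternate (scale_basis (s V) u) x) \<and>
               (\<exists>T :: real ^ 'n \<Rightarrow> real ^ 'n. orthogonal_transformation T \<and> T ` L = lattice Z))))) \<and>
    (\<forall>V > V1.
      (\<exists>u :: 'n \<Rightarrow> real ^ 'n. lattice_basis u \<and>
        (\<exists>N \<ge> 1. \<exists>\<phi> \<in> charge_distributions N u.
          energy f1 f2 N u \<phi>
            < energy f1 f2 2 (scale_basis (s V) Z) (alternate (scale_basis (s V) Z)))) \<and>
      (CARD('n) \<ge> 2 \<longrightarrow>
        (\<exists>L \<in> orthorhombic V. \<exists>u :: 'n \<Rightarrow> real ^ 'n. orthogonal_basis u \<and> L = lattice u \<and>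
          (\<exists>N \<ge> 1. \<exists>\<phi> \<in> charge_distributions N u.
            energy f1 f2 N u \<phi>
              < energy f1 f2 2 (scale_basis (s V) Z) (alternate (scale_basis (s V) Z))))))"
proof -
  note pq = assms(1) and q = assms(2)
  let ?d = "real CARD('n)"
  have d0: "0 < ?d" by simp
  have q0: "0 < q" using q d0 by linarith
  have s0: "0 < s V" if "0 < V" for V using that by (simp add: s_def)
  have s2: "((s V)\<^sup>2) powr x = V powr (2 * x / ?d)" if "0 < V" for V x
  proof -
    have "(s V)\<^sup>2 = V powr (2 / ?d)" by (simp add: s_def power2_eq_square powr_add[symmetric])
    then show ?thesis by (simp add: powr_powr)
  qed
  obtain K where K: "0 < K" "\<And>b :: 'n \<Rightarrow> real. (\<And>i. 0 < b i) \<Longrightarrow> (\<Prod>i\<in>UNIV. b i) = 1 \<Longrightarrow>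
      epstein alternating (\<lambda>_ :: 'n. 1) q - epstein alternating b q
        \<le> K * (epstein (\<lambda>_. 1) b p - epstein (\<lambda>_. 1) (\<lambda>_ :: 'n. 1) p)"
    using epstein_alternating_le_epstein_1[OF q pq] by blast
  \<comment> \<open>The solution of \<open>K * V powr (2 * (p - q) / d) = 1\<close>, the volume at
    which the two scaled weights balance.\<close>
  define V0 where "V0 = (1 / K) powr (?d / (2 * (p - q)))"
  have V0: "0 < V0" using K by (simp add: V0_def)
  have small: "K * ((s V)\<^sup>2) powr (- q) < ((s V)\<^sup>2) powr (- p)" if V: "0 < V" "V < V0" for V
  proof -
    let ?e = "2 * (p - q) / ?d"
    have "V powr ?e < V0 powr ?e" using V pq d0 by (intro powr_less_mono2) auto
    also have "V0 powr ?e = 1 / K" using K pq d0 by (simp add: V0_def powr_powr)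
    finally have "K * V powr ?e < 1" using K by (simp add: field_simps)
    then have "V powr (2 * (- p) / ?d) * (K * V powr ?e) < V powr (2 * (- p) / ?d) * 1"
      using V by (intro mult_strict_left_mono) auto
    moreover have "V powr (2 * (- p) / ?d) * V powr ?e = V powr (2 * (- q) / ?d)"
    proof -
      have "2 * (- p) / ?d + ?e = 2 * (- q) / ?d"
        unfolding add_divide_distrib[symmetric] by (simp add: algebra_simps)
      then show ?thesis by (simp only: powr_add[symmetric])
    qed
    ultimately show ?thesis unfolding s2[OF V(1)] by (simp add: mult.left_commute)
  qed
  obtain r \<epsilon> where r: "1 \<le> r" "0 < \<epsilon>" and
    neg: "\<And>b :: 'n \<Rightarrow> real. (\<And>i. r \<le> b i) \<Longrightarrow> (\<exists>j. b j = r) \<Longrightarrow>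
      epstein (\<lambda>_. 1) b p + epstein alternating b q \<le> - \<epsilon>"
    using negative_energy[OF q pq] by blast
  define S where "S = epstein (\<lambda>_. 1) (\<lambda>_ :: 'n. 1) q"
  obtain R where R: "1 \<le> R" "S / \<epsilon> < R powr (2 * q / ?d)"
    using exists_powr_gt[of "2 * q / ?d" "S / \<epsilon>"] q0 d0 by auto
  \<comment> \<open>Beyond \<open>R\<close> the cubic energy exceeds \<open>- \<epsilon>\<close>,
    because its negative part is at most \<open>S\<close> times the scale factor. Beyond
    \<open>r ^ CARD('n)\<close> there is room for one edge of length \<open>r\<close> with all the
    others at least as long.\<close>
  define V1 where "V1 = max R (r ^ CARD('n))"
  have V1: "0 < V1" using R by (simp add: V1_def)
  have large: "- \<epsilon> < energy f1 f2 2 (scale_basis (s V) Z) (alternate (scale_basis (s V) Z))" if V: "V1 < V" for V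
  proof -
    have Vp: "0 < V" using V V1 by simp
    have sV: "0 < s V" by (rule s0[OF Vp])
    have nZ: "(\<lambda>i. norm (scale_basis (s V) Z i)) = (\<lambda>i. s V * 1)" using sV by (simp add: scale_basis_def Z_def)
    have "R powr (2 * q / ?d) \<le> V powr (2 * q / ?d)"
      using V R q0 d0 by (intro powr_mono2) (auto simp: V1_def)
    then have "S < \<epsilon> * V powr (2 * q / ?d)"
      using R(2) r(2) by (simp add: pos_divide_less_eq) (smt (verit) mult.commute mult_left_mono)
    then have "V powr (2 * (- q) / ?d) * S < V powr (2 * (- q) / ?d) * (\<epsilon> * V powr (2 * q / ?d))"
      using Vp by (intro mult_strict_left_mono) auto
    also have "\<dots> = \<epsilon>" using Vp by (simp add: powr_minus)
    finally have 1: "((s V)\<^sup>2) powr (- q) * S < \<epsilon>" unfolding s2[OF Vp] .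
    have "- S \<le> epstein alternating (\<lambda>_ :: 'n. 1) q"
      using epstein_abs_le[of "\<lambda>_ :: 'n. 1" q alternating] q by (simp add: S_def abs_le_iff)
    then have "((s V)\<^sup>2) powr (- q) * - S \<le> ((s V)\<^sup>2) powr (- q) * epstein alternating (\<lambda>_ :: 'n. 1) q"
      by (intro mult_left_mono) auto
    moreover have "0 \<le> ((s V)\<^sup>2) powr (- p) * epstein (\<lambda>_. 1) (\<lambda>_ :: 'n. 1) p"
      by (intro mult_nonneg_nonneg epstein_1_nonneg) auto
    ultimately have main: "- \<epsilon> < ((s V)\<^sup>2) powr (- p) * epstein (\<lambda>_. 1) (\<lambda>_ :: 'n. 1) p
        + ((s V)\<^sup>2) powr (- q) * epstein alternating (\<lambda>_ :: 'n. 1) q"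
      using 1 by simp
    have oZ: "orthogonal_basis (scale_basis (s V) Z)"
      unfolding Z_def by (rule orthogonal_basis_scale[OF orthogonal_basis_std]) (use sV in simp)
    show ?thesis
      unfolding f1_def f2_def energy_alternate[OF oZ] nZ epstein_scale[OF less_imp_le[OF sV]] by (rule main)
  qed
  have alt_energy: "energy f1 f2 2 u (alternate u) \<le> - \<epsilon>"
    if "orthogonal_basis u" "\<And>i. r \<le> norm (u i)" "\<exists>j. norm (u j) = r" for u :: "'n \<Rightarrow> real ^ 'n"
    unfolding f1_def f2_def energy_alternate[OF that(1)] by (rule neg) (use that in auto)
  show ?thesis
  proof (rule exI[of _ V0], rule conjI[OF V0], rule exI[of _ V1], rule conjI[OF V1], intro conjI allI ballI impI)
    fix V L and u :: "'n \<Rightarrow> real ^ 'n" and N :: nat and \<phi>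
    assume V: "0 < V \<and> V < V0" and L: "L \<in> orthorhombic 1" and u: "orthogonal_basis u \<and> L = lattice u"
      and N: "1 \<le> N" and \<phi>: "\<phi> \<in> charge_distributions N (scale_basis (s V) u)"
    then have V': "0 < V" "V < V0" and u': "orthogonal_basis u" "L = lattice u" and L': "lattice u \<in> orthorhombic 1" by auto
    note sm = small_volume[OF q pq K(2) s0[OF V'(1)] small[OF V'] u'(1) L' N \<phi>, folded f1_def f2_def Z_def]
    show "energy f1 f2 2 (scale_basis (s V) Z) (alternate (scale_basis (s V) Z)) \<le> energy f1 f2 N (scale_basis (s V) u) \<phi>"
      by (rule sm(1))
    show "energy f1 f2 N (scale_basis (s V) u) \<phi>
             = energy f1 f2 2 (scale_basis (s V) Z) (alternate (scale_basis (s V) Z))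
           \<longleftrightarrow> even N \<and>
               (\<forall>x \<in> lattice (scale_basis (s V) u). \<phi> x = alternate (scale_basis (s V) u) x) \<and>
               (\<exists>T :: real ^ 'n \<Rightarrow> real ^ 'n. orthogonal_transformation T \<and> T ` L = lattice Z)"
      unfolding u'(2) by (rule sm(2))
  next
    fix V assume V: "V1 < V"
    \<comment> \<open>The competitor's volume is free here, so the cubic lattice with the fixed edge
      \<open>r\<close> serves for all \<open>V\<close> at once.\<close>
    let ?u = "scale_basis r Z"
    have u: "orthogonal_basis ?u" unfolding Z_def by (rule orthogonal_basis_scale[OF orthogonal_basis_std]) (use r in simp)
    have n: "norm (?u i) = r" for i using r by (simp add: scale_basis_def Z_def)
    have "energy f1 f2 2 ?u (alternate ?u) \<le> - \<epsilon>" by (rule alt_energy[OF u]) (simp_all add: n)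
    then have "energy f1 f2 2 ?u (alternate ?u) < energy f1 f2 2 (scale_basis (s V) Z) (alternate (scale_basis (s V) Z))"
      using large[OF V] by simp
    moreover have "lattice_basis ?u" using u by (simp add: orthogonal_basis_def)
    ultimately show "\<exists>u :: 'n \<Rightarrow> real ^ 'n. lattice_basis u \<and> (\<exists>N \<ge> 1. \<exists>\<phi> \<in> charge_distributions N u.
          energy f1 f2 N u \<phi> < energy f1 f2 2 (scale_basis (s V) Z) (alternate (scale_basis (s V) Z)))"
      using alternate_charge[OF u] by (intro exI[of _ ?u] conjI exI[of _ "2::nat"]) auto
  next
    fix V assume V: "V1 < V" and d2: "2 \<le> CARD('n)"
    have Vp: "0 < V" using V V1 by simp
    fix j :: 'n
    \<comment> \<open>The common length of the remaining edges that gives total volume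
      \<open>V\<close>; \<open>V > r ^ CARD('n)\<close> makes it at least \<open>r\<close>.\<close>
    define \<beta> where "\<beta> = (V / r) powr (1 / real (CARD('n) - 1))"
    define u where "u i = (if i = j then r else \<beta>) *\<^sub>R Z i" for i
    have d1: "0 < CARD('n) - 1" using d2 by simp
    have \<beta>: "\<beta> ^ (CARD('n) - 1) = V / r" "0 < \<beta>"
    proof -
      show b0: "0 < \<beta>" using Vp r by (simp add: \<beta>_def)
      have "\<beta> ^ (CARD('n) - 1) = \<beta> powr real (CARD('n) - 1)" by (rule powr_realpow[OF b0, symmetric])
      also have "\<dots> = V / r" using d1 Vp r by (simp add: \<beta>_def powr_powr)
      finally show "\<beta> ^ (CARD('n) - 1) = V / r" .
    qed
    have "r ^ CARD('n) \<le> V" using V by (simp add: V1_def)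
    then have "r ^ (CARD('n) - 1) \<le> \<beta> ^ (CARD('n) - 1)"
      unfolding \<beta>(1) using r d1 by (simp add: pos_le_divide_eq power_eq_if mult.commute)
    then have r\<beta>: "r \<le> \<beta>" using \<beta>(2) d1 by (meson less_imp_le not_le power_strict_mono r(1) zero_le_one order_trans)
    have u: "orthogonal_basis u"
      using orthogonal_basis_std[where 'n='n] r \<beta>(2) unfolding orthogonal_basis_iff u_def Z_def by (simp add: orthogonal_def)
    have n: "norm (u i) = (if i = j then r else \<beta>)" for i using r \<beta>(2) by (simp add: u_def Z_def)
    have "volume u = (\<Prod>i\<in>UNIV. if i = j then r else \<beta>)"
      unfolding volume_def abs_det_orthogonal_basis[OF u] n ..
    also have "\<dots> = r * (\<Prod>i\<in>UNIV - {j}. \<beta>)" by (subst prod.remove[of _ j]) auto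
    also have "\<dots> = V" using \<beta>(1) r by (simp add: card_Diff_singleton)
    finally have vol: "volume u = V" .
    have "energy f1 f2 2 u (alternate u) \<le> - \<epsilon>" by (rule alt_energy[OF u]) (use r\<beta> in \<open>auto simp: n\<close>)
    then have "energy f1 f2 2 u (alternate u) < energy f1 f2 2 (scale_basis (s V) Z) (alternate (scale_basis (s V) Z))"
      using large[OF V] by simp
    moreover have "lattice u \<in> orthorhombic V" using u vol unfolding orthorhombic_def by blast
    ultimately show "\<exists>L \<in> orthorhombic V. \<exists>u :: 'n \<Rightarrow> real ^ 'n. orthogonal_basis u \<and> L = lattice u \<and>
          (\<exists>N \<ge> 1. \<exists>\<phi> \<in> charge_distributions N u.
            energy f1 f2 N u \<phi> < energy f1 f2 2 (scale_basis (s V) Z) (alternate (scale_basis (s V) Z)))"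
      using u alternate_charge[OF u]
      by (intro bexI[of _ "lattice u"] exI[of _ u] conjI exI[of _ "2::nat"] bexI[of _ "alternate u"]) auto
  qed
qed

end
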